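(* Let $g$ satisfy the standing assumptions in the context, and fix $\boldsymbol{\nu}=(\nu_1,\dots,\nu_K)'$ with all $\nu_k>0$. Let $\bar\nu=(\nu_1\cdots\nu_K)^{1/K}$. Consider the procedure which, given control parameter $\alpha\in(0,1)$, applies the BH procedure with control parameter $\alpha$ to $s_i=h(\boldsymbol{\nu}'\boldsymbol{\xi}_i^\varepsilon;\boldsymbol{\nu})$, $i=1,\dots,n$, and let $\mathrm{Pow}(\alpha)$ be the limit of its power as $n\to\infty$. Then the minimum attainable pFDR of this procedure is $(1-a)\alpha_*$, and $$\mathrm{Pow}(\alpha)\sim g(\mathbf{0})\,V_\varepsilon\left(\frac{K+\varepsilon}{a\alpha_*^2g(\mathbf{0})}\bigg/\sum_{k=1}^K\frac{\bar\nu\gamma_k}{\nu_k}\right)^{K/\varepsilon}(\alpha-\alpha_* )^{K/\varepsilon}\quad\text{as }\alpha\downarrow\alpha_*.$$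
   Context: $\ell$ is Lebesgue measure; $x\vee y=\max(x,y)$; $\boldsymbol{x}^\varepsilon=(x_1^\varepsilon,\dots,x_K^\varepsilon)'$; $f\sim g$ means the ratio tends to 1. Random effects model: $H_1,\dots,H_n$ are nulls, $\theta_i=\mathbf{1}\{H_i\text{ is false}\}$, $\boldsymbol{\xi}_i\in[0,1]^K$ the multivariate $p$-value of $H_i$; $(\theta_i,\boldsymbol{\xi}_i)$ are i.i.d., $P(\theta_i=1)=a\in(0,1)$; given $\theta_i=0$, the coordinates of $\boldsymbol{\xi}_i$ are i.i.d. $\mathrm{Unif}(0,1)$; given $\theta_i=1$, $\boldsymbol{\xi}_i\sim G$ with density $g$. Standing assumptions on $g$: $g\in C([0,1]^K)$ and $g(\boldsymbol{x})<g(\mathbf{0})<\infty$ for all $\boldsymbol{x}\ne\mathbf{0}$; for some $\varepsilon>0$ and $\boldsymbol{\gamma}=(\gamma_1,\dots,\gamma_K)'$ with all $\gamma_k>0$, $g(\boldsymbol{x})=g(\mathbf{0})(1-\boldsymbol{\gamma}'\boldsymbol{x}^\varepsilon+r(\boldsymbol{x}))$ with $r(\boldsymbol{x})=o(|\boldsymbol{x}|^\varepsilon)$ as $|\boldsymbol{x}|\to0$; and $u\mapsto\ell(\{\boldsymbol{x}\in[0,1]^K:g(\boldsymbol{x})\ge u\})$ is continuous. $\alpha_*=1/(1-a+ag(\mathbf{0}))$; $V_\varepsilon=\ell(\{\boldsymbol{x}\in[0,1]^K:\sum_kx_k^\varepsilon\le1\})$; $h(u;\boldsymbol{\nu})=\ell(\{\boldsymbol{x}\in[0,1]^K:\boldsymbol{\nu}'\boldsymbol{x}^\varepsilon\le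 u\})$. BH procedure with control parameter $\alpha$ applied to $s_1,\dots,s_n\in[0,1]$: reject $H_i$ iff $s_i\le\sup\{t\in[0,1]:t/\alpha\le(\#\{j:s_j\le t\}\vee1)/n\}$. With $R$, $V$, $N$ the numbers of rejected nulls, rejected true nulls, and true nulls: $\mathrm{pFDR}=E[V/R\mid R>0]$, $\mathrm{power}=E[(R-V)/((n-N)\vee1)]$. The minimum attainable pFDR of a procedure with control parameter $\alpha$ is the infimum of the pFDR levels it attains asymptotically (as $n\to\infty$) as $\alpha$ ranges over $(0,1)$. *)

theory Defs
  imports "HOL-Probability.Probability" "HOL-Library.Landau_Symbols"
begin

unbundle asymp_equiv_syntax

section \<open>Multivariate $p$-values\<close>

text \<open>The dimension $K$ is \<^term>\<open>CARD('k)\<close>, and $[0,1]^K$ is \<^term>\<open>cbox 0 1 :: (real ^ 'k) set\<close>.\<close>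

definition vpow :: "real ^ 'k \<Rightarrow> real \<Rightarrow> real ^ 'k" where
  "vpow x \<epsilon> = (\<chi> k. x $ k powr \<epsilon>)"

text \<open>The density \<open>g\<close> is only meaningful on the unit cube; its values elsewhere are irrelevant.
  The continuity of the level-set volume is required for all real \<open>u\<close>.\<close>

definition standing_assumptions ::
  "(real ^ 'k \<Rightarrow> real) \<Rightarrow> real \<Rightarrow> real ^ 'k \<Rightarrow> (real ^ 'k \<Rightarrow> real) \<Rightarrow> bool" where
  "standing_assumptions g \<epsilon> \<gamma> r \<longleftrightarrow>
     (\<forall>x \<in> cbox 0 1. 0 \<le> g x) \<and> (g has_integral 1) (cbox 0 1) \<and>
     continuous_on (cbox 0 1) g \<and>
     (\<forall>x \<in> cbox 0 1. x \<noteq> 0 \<longrightarrow> g x < g 0) \<and>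
     0 < \<epsilon> \<and> (\<forall>k. 0 < \<gamma> $ k) \<and>
     (\<forall>x \<in> cbox 0 1. g x = g 0 * (1 - \<gamma> \<bullet> vpow x \<epsilon> + r x)) \<and>
     r \<in> o[at 0 within cbox 0 1](\<lambda>x. norm x powr \<epsilon>) \<and>
     continuous_on UNIV (\<lambda>u. measure lborel {x \<in> cbox 0 1. u \<le> g x})"

text \<open>\<open>\<theta> i\<close> is true iff the null \<open>H\<^sub>i\<close> is false. One infinite i.i.d. sequence serves all
  sample sizes: the sample of size \<open>n\<close> consists of the indices \<open>i < n\<close>. The elementary
  conditional probability given an event is \<^const>\<open>uniform_measure\<close>.\<close>

definition random_effects_model ::
  "'w measure \<Rightarrow> (nat \<Rightarrow> 'w \<Rightarrow> bool) \<Rightarrow> (nat \<Rightarrow> 'w \<Rightarrow> real ^ 'k) \<Rightarrow> real \<Rightarrow> (real ^ 'k \<Rightarrow> real) \<Rightarrow> bool"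
where
  "random_effects_model M \<theta> \<xi> a g \<longleftrightarrow>
     prob_space M \<and> 0 < a \<and> a < 1 \<and>
     prob_space.indep_vars M (\<lambda>_. count_space UNIV \<Otimes>\<^sub>M borel) (\<lambda>i \<omega>. (\<theta> i \<omega>, \<xi> i \<omega>)) UNIV \<and>
     (\<forall>i. (\<forall>\<omega> \<in> space M. \<xi> i \<omega> \<in> cbox 0 1) \<and>
          measure M {\<omega> \<in> space M. \<theta> i \<omega>} = a \<and>
          (let M0 = uniform_measure M {\<omega> \<in> space M. \<not> \<theta> i \<omega>} in
             prob_space.indep_vars M0 (\<lambda>_. borel) (\<lambda>k \<omega>. \<xi> i \<omega> $ k) UNIV \<and>
             (\<forall>k. distr M0 borel (\<lambda>\<omega>. \<xi> i \<omega> $ k) = uniform_measure lborel {0..1})) \<and>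
          distributed (uniform_measure M {\<omega> \<in> space M. \<theta> i \<omega>}) lborel (\<xi> i)
            (\<lambda>x. ennreal (indicator (cbox 0 1) x * g x)))"


section \<open>The Benjamini--Hochberg procedure\<close>

definition BH_threshold :: "real \<Rightarrow> nat \<Rightarrow> (nat \<Rightarrow> real) \<Rightarrow> real" where
  "BH_threshold \<alpha> n s =
     Sup {t \<in> {0..1}. t / \<alpha> \<le> max (real (card {j \<in> {..<n}. s j \<le> t})) 1 / real n}"

definition BH_rejected :: "real \<Rightarrow> nat \<Rightarrow> (nat \<Rightarrow> real) \<Rightarrow> nat set" where
  "BH_rejected \<alpha> n s = {i \<in> {..<n}. s i \<le> BH_threshold \<alpha> n s}"


section \<open>Error rate and power\<close>

text \<open>Here \<open>D \<omega>\<close> is the (random) set of indices of rejected nulls, so that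
  $R$ = \<open>card (D \<omega>)\<close> and $V$ = \<open>card {i \<in> D \<omega>. \<not> \<theta> i \<omega>}\<close>.\<close>

definition pFDR :: "'w measure \<Rightarrow> (nat \<Rightarrow> 'w \<Rightarrow> bool) \<Rightarrow> ('w \<Rightarrow> nat set) \<Rightarrow> real" where
  "pFDR M \<theta> D =
     (\<integral>\<omega>. real (card {i \<in> D \<omega>. \<not> \<theta> i \<omega>}) / real (card (D \<omega>))
        \<partial>uniform_measure M {\<omega> \<in> space M. card (D \<omega>) > 0})"

definition testing_power ::
  "'w measure \<Rightarrow> (nat \<Rightarrow> 'w \<Rightarrow> bool) \<Rightarrow> nat \<Rightarrow> ('w \<Rightarrow> nat set) \<Rightarrow> real" where
  "testing_power M \<theta> n D =
     (\<integral>\<omega>. (real (card (D \<omega>)) - real (card {i \<in> D \<omega>. \<not> \<theta> i \<omega>}))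
            / max (real n - real (card {i \<in> {..<n}. \<not> \<theta> i \<omega>})) 1 \<partial>M)"

text \<open>The argument \<open>q n \<alpha>\<close> is the pFDR on a sample of size \<open>n\<close> at control parameter \<open>\<alpha>\<close>. A level is
  attained asymptotically if it is the limit of \<open>q n \<alpha>\<close> for some \<open>\<alpha>\<close>. The infimum is taken in
  \<^typ>\<open>ereal\<close>, so that a real value entails that some level is attained.\<close>

definition min_attainable_pFDR :: "(nat \<Rightarrow> real \<Rightarrow> real) \<Rightarrow> ereal" where
  "min_attainable_pFDR q =
     Inf {ereal L | L. \<exists>\<alpha>. 0 < \<alpha> \<and> \<alpha> < 1 \<and> (\<lambda>n. q n \<alpha>) \<longlonglongrightarrow> L}"


section \<open>The procedure with nested regions \<open>{x. \<nu> \<bullet> vpow x \<epsilon> \<le> u}\<close>\<close>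

definition h :: "real \<Rightarrow> real ^ 'k \<Rightarrow> real \<Rightarrow> real" where
  "h \<epsilon> \<nu> u = measure lborel {x \<in> cbox 0 1. \<nu> \<bullet> vpow x \<epsilon> \<le> u}"

definition V_vol :: "'k::finite itself \<Rightarrow> real \<Rightarrow> real" where
  "V_vol _ \<epsilon> = measure lborel {x :: real ^ 'k. x \<in> cbox 0 1 \<and> (\<Sum>k\<in>UNIV. x $ k powr \<epsilon>) \<le> 1}"

definition alpha_star :: "real \<Rightarrow> (real ^ 'k \<Rightarrow> real) \<Rightarrow> real" where
  "alpha_star a g = 1 / (1 - a + a * g 0)"

definition nu_rejected ::
  "(nat \<Rightarrow> 'w \<Rightarrow> real ^ 'k) \<Rightarrow> real \<Rightarrow> real ^ 'k \<Rightarrow> nat \<Rightarrow> real \<Rightarrow> 'w \<Rightarrow> nat set" where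
  "nu_rejected \<xi> \<epsilon> \<nu> n \<alpha> \<omega> = BH_rejected \<alpha> n (\<lambda>i. h \<epsilon> \<nu> (\<nu> \<bullet> vpow (\<xi> i \<omega>) \<epsilon>))"

text \<open>\<^const>\<open>lim\<close> is meaningful only where the sequence converges, so convergence has to be
  claimed separately wherever the value of \<open>lim_power\<close> is used.\<close>

definition lim_power ::
  "'w measure \<Rightarrow> (nat \<Rightarrow> 'w \<Rightarrow> bool) \<Rightarrow> (nat \<Rightarrow> 'w \<Rightarrow> real ^ 'k) \<Rightarrow> real \<Rightarrow> real ^ 'k \<Rightarrow> real \<Rightarrow> real"
where
  "lim_power M \<theta> \<xi> \<epsilon> \<nu> \<alpha> = lim (\<lambda>n. testing_power M \<theta> n (nu_rejected \<xi> \<epsilon> \<nu> n \<alpha>))"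

end

theory Submission
  imports Defs
begin

text \<open>Write \<open>\<phi> x\<close> for \<open>\<nu> \<bullet> vpow x \<epsilon>\<close> and \<open>D t\<close> for the region of the unit cube on which
  \<open>h \<epsilon> \<nu> (\<phi> x) \<le> t\<close>. Since \<open>h \<epsilon> \<nu>\<close> is the distribution function of \<open>\<phi>\<close> under the uniform law and is
  continuous, \<open>D t\<close> has volume \<open>t\<close>: scores of true nulls are uniform, while a score of a
  false null is at most \<open>t\<close> with probability \<open>F1 t\<close>, the integral of \<open>g\<close> over \<open>D t\<close>. So all scores
  have distribution function \<open>F t = (1 - a) * t + a * F1 t\<close>.

  The critical parameter is \<open>\<alpha>s = 1 / (1 - a + a * g 0)\<close>.

  \<^bold>\<open>No level below the critical one.\<close> Given its p-value \<open>x\<close>, a null is true with probability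
  \<open>(1 - a) / (1 - a + a * g x)\<close>, which is at least \<open>(1 - a) * \<alpha>s\<close> because \<open>g\<close> is maximal at the
  origin. The rejections depend on the p-values only, so conditioning on these shows that the pFDR
  is at least \<open>(1 - a) * \<alpha>s\<close> for every positive sample size and every control parameter
  (\<open>pFDR_lower_bound\<close>).

  \<^bold>\<open>Limits just above the critical parameter.\<close> By the law of large numbers the random threshold
  follows the points where \<open>F t = t / \<alpha>\<close>. If \<open>F\<close> passes from above to below the line
  \<open>t / \<alpha>\<close> at \<open>\<tau>\<close>, then the threshold tends to \<open>\<tau>\<close>, the pFDR tends to
  \<open>(1 - a) * \<tau> / F \<tau> = (1 - a) * \<alpha>\<close>, and the power tends to \<open>F1 \<tau>\<close>. The ratio \<open>F1 t / t\<close> is the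
  mean of \<open>g\<close> over \<open>D t\<close>; it tends to \<open>g 0\<close> as \<open>t\<close> decreases to \<open>0\<close>, so the slope of \<open>F\<close> there
  is \<open>1 / \<alpha>s\<close>. For an arbitrary \<open>\<alpha>\<close> the graph of \<open>F\<close> might merely touch the line, and the limits
  could fail to exist. Near \<open>\<alpha>s\<close> this is excluded, because the mean of \<open>g\<close> over \<open>D t\<close> is strictly
  decreasing for small \<open>t\<close> and stays away from \<open>g 0\<close> elsewhere. Hence all levels
  \<open>(1 - a) * \<alpha>\<close> with \<open>\<alpha>\<close> slightly above \<open>\<alpha>s\<close> are attained, and their infimum is the lower bound.

  \<^bold>\<open>Order of the power.\<close> For small \<open>t\<close> the region \<open>D t\<close> is \<open>{x. x \<ge> 0 \<and> \<phi> x \<le> u}\<close> with \<open>u\<close>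
  proportional to \<open>t powr (\<epsilon> / K)\<close>. By scaling and by the symmetry of the coordinates the integral
  of \<open>\<gamma> \<bullet> vpow x \<epsilon>\<close> over this set is known exactly, and the expansion of \<open>g\<close> at the origin gives
  \<open>F1 t / t = g 0 * (1 - L * t powr (\<epsilon> / K) + \<dots>)\<close> with an explicit constant \<open>L\<close>. Solving
  \<open>F \<tau> = \<tau> / \<alpha>\<close> gives the order of \<open>\<tau>\<close> as \<open>\<alpha>\<close> decreases to \<open>\<alpha>s\<close>, and \<open>F1 \<tau>\<close> is asymptotically
  \<open>g 0 * \<tau>\<close>. The expansion is proved for increments of \<open>F1\<close>
  (\<open>alt_cdf_increment\<close>): this one estimate yields both the asymptotics and the strict monotonicity.\<close>

section \<open>The step-up threshold\<close>

lemma card_le_mono: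
  "t \<le> t' \<Longrightarrow> card {j \<in> {..<n::nat}. (s j :: real) \<le> t} \<le> card {j \<in> {..<n}. s j \<le> t'}"
  by (rule card_mono) auto

lemma BH_threshold_upper:
  assumes "0 \<le> t" "t \<le> 1" "t / \<alpha> \<le> max (real (card {j \<in> {..<n}. s j \<le> t})) 1 / real n"
  shows "t \<le> BH_threshold \<alpha> n s"
  unfolding BH_threshold_def
  by (rule cSup_upper) (use assms in \<open>auto intro!: bdd_aboveI[of _ 1]\<close>)

lemma BH_threshold_le_1: "BH_threshold \<alpha> n s \<le> 1"
  unfolding BH_threshold_def by (rule cSup_least) (auto intro!: exI[of _ 0])

text \<open>The condition counts scores \<open>\<le> t\<close>, so the count is nondecreasing: every admissible \<open>t\<close> satisfies
  the bound with the count taken at the supremum, and so does the supremum.\<close>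

lemma BH_threshold_attained:
  assumes "0 < \<alpha>"
  shows "BH_threshold \<alpha> n s / \<alpha>
    \<le> max (real (card {j \<in> {..<n}. s j \<le> BH_threshold \<alpha> n s})) 1 / real n"
proof -
  let ?T = "BH_threshold \<alpha> n s"
  let ?c = "\<lambda>t. max (real (card {j \<in> {..<n}. s j \<le> t})) 1"
  have "t \<le> \<alpha> * (?c ?T / real n)"
    if t: "t \<in> {t \<in> {0..1}. t / \<alpha> \<le> ?c t / real n}" for t
  proof -
    have "t \<le> ?T" using t by (intro BH_threshold_upper) auto
    then have "?c t / real n \<le> ?c ?T / real n"
      by (intro divide_right_mono max.mono of_nat_mono card_le_mono) auto
    moreover have "t \<le> \<alpha> * (?c t / real n)" using t assms by (simp add: pos_divide_le_eq mult.commute)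
    ultimately show ?thesis using assms mult_left_mono[of _ _ \<alpha>] by (meson order_trans less_imp_le)
  qed
  then have "?T \<le> \<alpha> * (?c ?T / real n)"
    by (subst (1) BH_threshold_def, intro cSup_least) (auto intro!: exI[of _ 0])
  then show ?thesis using assms by (simp add: pos_divide_le_eq mult.commute)
qed

text \<open>The supremum equals \<open>\<alpha> * k / n\<close> for the largest admissible count \<open>k\<close>, which leaves finitely many
  candidates; this makes rejection a finite combination of events \<open>s j \<le> c\<close>. The maximum with \<open>1\<close>
  disappears because a rejected index is itself among the scores counted.\<close>

lemma BH_rejected_iff:
  assumes "0 < \<alpha>" "\<alpha> < 1"
  shows "i \<in> BH_rejected \<alpha> n s \<longleftrightarrow> i < n \<and>
    (\<exists>k \<in> {1..n}. s i \<le> \<alpha> * real k / real n \<and> k \<le> card {j \<in> {..<n}. s j \<le> \<alpha> * real k / real n})"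
proof (intro iffI)
  let ?T = "BH_threshold \<alpha> n s"
  let ?c = "\<lambda>t. card {j \<in> {..<n}. s j \<le> t}"
  assume i: "i \<in> BH_rejected \<alpha> n s"
  then have "i < n" "s i \<le> ?T" by (auto simp: BH_rejected_def)
  then have ne: "i \<in> {j \<in> {..<n}. s j \<le> ?T}" by auto
  define k where "k = ?c ?T"
  have "card {i} \<le> k" unfolding k_def using ne by (intro card_mono) auto
  then have k1: "1 \<le> k" by simp
  have kn: "k \<le> n" unfolding k_def using card_mono[of "{..<n}" "{j \<in> {..<n}. s j \<le> ?T}"] by auto
  have "?T / \<alpha> \<le> k / n" using BH_threshold_attained[OF assms(1), of n s] k1
    unfolding k_def[symmetric] by (simp add: max_absorb1)
  then have T: "?T \<le> \<alpha> * real k / real n" using assms by (simp add: pos_divide_le_eq mult.commute)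
  have "?c ?T \<le> ?c (\<alpha> * real k / real n)" using T by (rule card_le_mono)
  then have "k \<le> ?c (\<alpha> * real k / real n)" by (simp only: k_def)
  then show "i < n \<and> (\<exists>k \<in> {1..n}. s i \<le> \<alpha> * real k / real n \<and> k \<le> ?c (\<alpha> * real k / real n))"
    using T \<open>s i \<le> ?T\<close> k1 kn \<open>i < n\<close> by (intro conjI bexI[of _ k]) simp_all
next
  assume "i < n \<and> (\<exists>k \<in> {1..n}. s i \<le> \<alpha> * real k / real n \<and> k \<le> card {j \<in> {..<n}. s j \<le> \<alpha> * real k / real n})"
  then obtain k where k: "i < n" "k \<in> {1..n}" "s i \<le> \<alpha> * real k / real n"
    "k \<le> card {j \<in> {..<n}. s j \<le> \<alpha> * real k / real n}" by blast
  have "\<alpha> * real k / real n \<le> BH_threshold \<alpha> n s"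
  proof (rule BH_threshold_upper)
    have "\<alpha> * real k \<le> 1 * real n" using k(2) assms by (intro mult_mono) simp_all
    then show "\<alpha> * real k / real n \<le> 1" using k(1) by (simp add: divide_le_eq)
    show "\<alpha> * real k / real n / \<alpha> \<le> max (real (card {j \<in> {..<n}. s j \<le> \<alpha> * real k / real n})) 1 / real n"
      using k(4) assms by (simp add: divide_right_mono)
  qed (use assms in simp)
  then have "s i \<le> BH_threshold \<alpha> n s" using k(3) by linarith
  then show "i \<in> BH_rejected \<alpha> n s" using k(1) by (simp add: BH_rejected_def)
qed

text \<open>Monotonicity lets the moving point be enclosed between two fixed rationals. Convergence at
  rational points is all that is assumed, so that almost sure convergence of random functions
  involves only countably many null sets.\<close>

lemma mono_tendsto_at_moving_point:
  fixes c :: "nat \<Rightarrow> real \<Rightarrow> real"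
  assumes mono: "\<And>n. mono (c n)"
    and lim: "\<And>q. q \<in> \<rat> \<Longrightarrow> (\<lambda>n. c n q) \<longlonglongrightarrow> F q"
    and cont: "isCont F \<tau>" and T: "T \<longlonglongrightarrow> \<tau>"
  shows "(\<lambda>n. c n (T n)) \<longlonglongrightarrow> F \<tau>"
proof (rule order_tendstoI)
  fix b assume "F \<tau> < b"
  then have "eventually (\<lambda>x. F x < b) (at_right \<tau>)"
    using cont by (metis continuous_within filterlim_at_split order_tendstoD(2))
  then obtain d where d: "d > \<tau>" "\<And>x. \<tau> < x \<Longrightarrow> x < d \<Longrightarrow> F x < b"
    by (auto simp: eventually_at_right[of \<tau> "\<tau> + 1"])
  obtain q where q: "q \<in> \<rat>" "\<tau> < q" "q < d" using Rats_dense_in_real[OF d(1)] by auto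
  have "eventually (\<lambda>n. c n q < b) sequentially" using lim[OF q(1)] d(2)[OF q(2,3)] by (rule order_tendstoD)
  moreover have "eventually (\<lambda>n. T n < q) sequentially" using T q(2) by (rule order_tendstoD)
  ultimately show "eventually (\<lambda>n. c n (T n) < b) sequentially"
  proof eventually_elim
    case (elim n)
    then show ?case using monoD[OF mono[of n], of "T n" q] by simp
  qed
next
  fix b assume "b < F \<tau>"
  then have "eventually (\<lambda>x. b < F x) (at_left \<tau>)"
    using cont by (metis continuous_within filterlim_at_split order_tendstoD(1))
  then obtain d where d: "d < \<tau>" "\<And>x. d < x \<Longrightarrow> x < \<tau> \<Longrightarrow> b < F x"
    by (auto simp: eventually_at_left[of "\<tau> - 1" \<tau>])
  obtain q where q: "q \<in> \<rat>" "d < q" "q < \<tau>" using Rats_dense_in_real[OF d(1)] by auto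
  have "eventually (\<lambda>n. b < c n q) sequentially" using lim[OF q(1)] d(2)[OF q(2,3)] by (rule order_tendstoD)
  moreover have "eventually (\<lambda>n. q < T n) sequentially" using T q(3) by (rule order_tendstoD)
  ultimately show "eventually (\<lambda>n. b < c n (T n)) sequentially"
  proof eventually_elim
    case (elim n)
    then show ?case using monoD[OF mono[of n], of q "T n"] by simp
  qed
qed

lemma mono_frequency: "mono (\<lambda>t. real (card {j \<in> {..<n::nat}. (s j :: real) \<le> t \<and> P j}) / real n)"
  by (auto intro!: monoI divide_right_mono card_mono)

text \<open>Each rational point just below \<open>\<tau>\<close> is eventually admissible. Conversely, the threshold is itself
  admissible, so a limit \<open>\<sigma> > \<tau>\<close> of a subsequence would satisfy \<open>\<sigma> / \<alpha> \<le> F \<sigma>\<close>.\<close>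

lemma BH_threshold_tendsto:
  assumes \<alpha>: "0 < \<alpha>"
    and freq: "\<And>q. q \<in> \<rat> \<Longrightarrow> (\<lambda>n. real (card {j \<in> {..<n}. s j \<le> q}) / real n) \<longlonglongrightarrow> F q"
    and cont: "\<And>t. isCont F t"
    and \<tau>: "0 < \<tau>" "\<tau> \<le> 1"
    and above: "\<And>t. 0 < t \<Longrightarrow> t < \<tau> \<Longrightarrow> t / \<alpha> < F t"
    and below: "\<And>t. \<tau> < t \<Longrightarrow> t \<le> 1 \<Longrightarrow> F t < t / \<alpha>"
  shows "(\<lambda>n. BH_threshold \<alpha> n s) \<longlonglongrightarrow> \<tau>"
proof (rule order_tendstoI)
  fix b assume "b < \<tau>"
  then have "max b 0 < \<tau>" using \<tau> by simp
  then obtain q where q: "q \<in> \<rat>" "max b 0 < q" "q < \<tau>" using Rats_dense_in_real by blast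
  have "eventually (\<lambda>n. q / \<alpha> < real (card {j \<in> {..<n}. s j \<le> q}) / real n) sequentially"
    using freq[OF q(1)] above[of q] q by (intro order_tendstoD) auto
  then show "eventually (\<lambda>n. b < BH_threshold \<alpha> n s) sequentially"
  proof eventually_elim
    case (elim n)
    have "q / \<alpha> \<le> max (real (card {j \<in> {..<n}. s j \<le> q})) 1 / real n"
      using elim by (smt (verit) divide_right_mono max.cobounded1 of_nat_0_le_iff)
    then have "q \<le> BH_threshold \<alpha> n s" using q \<tau> by (intro BH_threshold_upper) auto
    then show ?case using q by simp
  qed
next
  fix b assume b: "\<tau> < b"
  show "eventually (\<lambda>n. BH_threshold \<alpha> n s < b) sequentially"
  proof (rule ccontr)
    assume "\<not> ?thesis"
    then have "\<exists>\<^sub>\<infinity>n. b \<le> BH_threshold \<alpha> n s" by (simp add: frequently_def cofinite_eq_sequentially not_le)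
    then have "infinite {n. b \<le> BH_threshold \<alpha> n s}" by (simp add: INFM_iff_infinite)
    then obtain r :: "nat \<Rightarrow> nat" where r: "strict_mono r" "\<And>n. b \<le> BH_threshold \<alpha> (r n) s"
      using infinite_enumerate[of "{n. b \<le> BH_threshold \<alpha> n s}"] by auto
    have "\<forall>n. BH_threshold \<alpha> (r n) s \<in> {b..1}" using r(2) BH_threshold_le_1 by auto
    then obtain \<sigma> r' where \<sigma>: "\<sigma> \<in> {b..1}" "strict_mono r'"
      "((\<lambda>n. BH_threshold \<alpha> (r n) s) \<circ> r') \<longlonglongrightarrow> \<sigma>"
      using compact_Icc[of b "1::real", THEN compact_imp_seq_compact, THEN seq_compactE] by metis
    define m where "m = r \<circ> r'"
    have m: "strict_mono m" unfolding m_def using r(1) \<sigma>(2) by (rule strict_mono_o)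
    let ?c = "\<lambda>n. real (card {j \<in> {..<m n}. s j \<le> BH_threshold \<alpha> (m n) s})"
    have T: "(\<lambda>n. BH_threshold \<alpha> (m n) s) \<longlonglongrightarrow> \<sigma>" using \<sigma>(3) by (simp add: m_def o_def)
    have "(\<lambda>n. ?c n / real (m n)) \<longlonglongrightarrow> F \<sigma>"
    proof (rule mono_tendsto_at_moving_point[OF _ _ cont T,
          where c = "\<lambda>n t. real (card {j \<in> {..<m n}. s j \<le> t}) / real (m n)"])
      show "mono (\<lambda>t. real (card {j \<in> {..<m n}. s j \<le> t}) / real (m n))" for n
        using mono_frequency[of "m n" s "\<lambda>_. True"] by simp
      show "(\<lambda>n. real (card {j \<in> {..<m n}. s j \<le> q}) / real (m n)) \<longlonglongrightarrow> F q" if "q \<in> \<rat>" for q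
        using LIMSEQ_subseq_LIMSEQ[OF freq[OF that] m] by (simp add: o_def)
    qed
    moreover have "(\<lambda>n. 1 / real (m n)) \<longlonglongrightarrow> 0"
      using LIMSEQ_subseq_LIMSEQ[OF lim_inverse_n' m] by (simp add: o_def inverse_eq_divide)
    ultimately have "(\<lambda>n. max (?c n / real (m n)) (1 / real (m n)))
        \<longlonglongrightarrow> max (F \<sigma>) 0" by (rule tendsto_max)
    moreover have "(\<lambda>n. BH_threshold \<alpha> (m n) s / \<alpha>) \<longlonglongrightarrow> \<sigma> / \<alpha>" using T \<alpha> by (intro tendsto_intros) auto
    moreover have "\<forall>n. BH_threshold \<alpha> (m n) s / \<alpha> \<le> max (?c n / real (m n)) (1 / real (m n))"
      using BH_threshold_attained[OF \<alpha>] by (simp add: max_divide_distrib_right)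
    ultimately have "\<sigma> / \<alpha> \<le> max (F \<sigma>) 0" by (intro LIMSEQ_le) auto
    moreover have "0 < \<sigma> / \<alpha>" using \<sigma>(1) b \<tau> \<alpha> by simp
    ultimately show False using below[of \<sigma>] \<sigma>(1) b by simp
  qed
qed

lemma BH_rejected_cong:
  assumes "\<And>j. j < n \<Longrightarrow> s j = s' j"
  shows "BH_rejected \<alpha> n s = BH_rejected \<alpha> n s'"
proof -
  have "{j \<in> {..<n}. s j \<le> t} = {j \<in> {..<n}. s' j \<le> t}" for t using assms by auto
  then have "BH_threshold \<alpha> n s = BH_threshold \<alpha> n s'" by (simp only: BH_threshold_def)
  then show ?thesis using assms by (auto simp: BH_rejected_def)
qed

lemma BH_rejected_subset: "BH_rejected \<alpha> n s \<subseteq> {..<n}"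
  by (auto simp: BH_rejected_def)

lemma finite_BH_rejected [simp]: "finite (BH_rejected \<alpha> n s)"
  by (rule finite_subset[OF BH_rejected_subset]) simp

lemma real_card_Collect_less: "real (card {j \<in> {..<n::nat}. P j}) = (\<Sum>j<n. if P j then 1 else 0)"
  by (simp add: sum.If_cases Int_def)

lemma borel_measurable_card_Collect [measurable (raw)]:
  assumes [measurable]: "\<And>j. Measurable.pred M (P j)"
  shows "(\<lambda>\<omega>. real (card {j \<in> {..<n::nat}. P j \<omega>})) \<in> borel_measurable M"
  unfolding real_card_Collect_less by measurable

lemma pred_BH_rejected:
  assumes \<alpha>: "0 < \<alpha>" "\<alpha> < 1" and [measurable]: "\<And>j. (\<lambda>\<omega>. s j \<omega>) \<in> borel_measurable M"
  shows "Measurable.pred M (\<lambda>\<omega>. i \<in> BH_rejected \<alpha> n (\<lambda>j. s j \<omega>))"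
proof -
  have "Measurable.pred M (\<lambda>\<omega>. i < n \<and> (\<exists>k \<in> {1..n}. s i \<omega> \<le> \<alpha> * real k / real n \<and>
      real k \<le> real (card {j \<in> {..<n}. s j \<omega> \<le> \<alpha> * real k / real n})))"
    by measurable
  then show ?thesis unfolding BH_rejected_iff[OF \<alpha>] by simp
qed

section \<open>Strong law for event frequencies\<close>

text \<open>Hoeffding's inequality makes the deviation probabilities summable, and the Borel--Cantelli lemma
  applies.\<close>

lemma (in prob_space) event_frequency_AE:
  assumes indep: "indep_vars (\<lambda>_. N) X UNIV"
    and B [measurable]: "B \<in> sets N"
    and p: "\<And>i. prob {\<omega> \<in> space M. X i \<omega> \<in> B} = p"
  shows "AE \<omega> in M. (\<lambda>n. real (card {i \<in> {..<n::nat}. X i \<omega> \<in> B}) / real n) \<longlonglongrightarrow> p"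
proof -
  let ?c = "\<lambda>n \<omega>. real (card {i \<in> {..<n}. X i \<omega> \<in> B})"
  have X [measurable]: "random_variable N (X i)" for i using indep by (auto simp: indep_vars_def)
  define Y :: "nat \<Rightarrow> 'a \<Rightarrow> real" where "Y = (\<lambda>i \<omega>. indicator B (X i \<omega>))"
  have Y [measurable]: "random_variable borel (Y i)" for i unfolding Y_def by measurable
  have indepY: "indep_vars (\<lambda>_. borel) Y UNIV"
    unfolding Y_def by (rule indep_vars_compose2[OF indep]) simp
  have EY: "expectation (Y i) = p" for i
  proof -
    have "expectation (Y i) = expectation (indicator {\<omega> \<in> space M. X i \<omega> \<in> B})"
      by (intro Bochner_Integration.integral_cong) (auto simp: Y_def indicator_def)
    also have "\<dots> = prob {\<omega> \<in> space M. X i \<omega> \<in> B}" by simp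
    finally show ?thesis by (simp add: p)
  qed
  have sumY: "(\<Sum>i<n. Y i \<omega>) = ?c n \<omega>" for n \<omega>
    unfolding Y_def indicator_def by (simp add: sum.If_cases Int_def)
  \<comment> \<open>Deviations by at least \<open>1 / Suc m\<close>: countably many tolerances suffice.\<close>
  define bad where "bad = (\<lambda>m n. {\<omega> \<in> space M. \<bar>(\<Sum>i<n. Y i \<omega>) - real n * p\<bar> \<ge> real n / Suc m})"
  have bad [measurable]: "bad m n \<in> events" for m n unfolding bad_def by measurable
  have bound: "prob (bad m n) \<le> 2 * exp (- 2 / (Suc m)\<^sup>2) ^ n" for m n
  proof (cases "n = 0")
    case True then show ?thesis using order_trans[OF prob_le_1, of 2 "bad m 0"] by simp
  next
    case False
    have ind: "indep_vars (\<lambda>_. borel) Y {..<n}" using indepY by (rule indep_vars_subset) simp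
    have rng: "AE \<omega> in M. Y i \<omega> \<in> {0..1}" for i by (simp add: Y_def indicator_def)
    have mean: "real n * p = (\<Sum>i<n. expectation (Y i))" by (simp add: EY)
    interpret H: indep_interval_bounded_random_variables M "{..<n}" Y "\<lambda>_. 0" "\<lambda>_. 1"
      by unfold_locales (rule finite_lessThan ind rng)+
    interpret H: Hoeffding_ineq M "{..<n}" Y "\<lambda>_. 0" "\<lambda>_. 1" "real n * p"
      by unfold_locales (rule eq_reflection[OF mean])
    have "prob (bad m n) \<le> 2 * exp (- 2 * (real n / Suc m)\<^sup>2 / real n)"
      unfolding bad_def using H.Hoeffding_ineq_abs_ge[of "real n / Suc m"] False by simp
    also have "- 2 * (real n / Suc m)\<^sup>2 / real n = real n * (- 2 / (Suc m)\<^sup>2)"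
      using False unfolding of_nat_power power_divide by (simp only: power2_eq_square times_divide_eq_right times_divide_eq_left) simp
    finally show ?thesis by (simp only: exp_of_nat_mult)
  qed
  have "AE \<omega> in M. eventually (\<lambda>n. \<omega> \<in> space M - bad m n) sequentially" for m
  proof (rule borel_cantelli_AE1)
    have "summable (\<lambda>n. 2 * exp (- 2 / (Suc m)\<^sup>2 :: real) ^ n)"
      by (intro summable_mult summable_geometric) simp
    then show "summable (\<lambda>n. prob (bad m n))"
      by (rule summable_comparison_test') (use bound in auto)
  qed (auto simp: emeasure_eq_measure)
  then have "AE \<omega> in M. \<forall>m. eventually (\<lambda>n. \<omega> \<in> space M - bad m n) sequentially"
    by (simp add: AE_all_countable)
  then show ?thesis
  proof eventually_elim
    case (elim \<omega>)
    show ?case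
    proof (rule LIMSEQ_I)
      fix e :: real assume "e > 0"
      then obtain m where m: "inverse (real (Suc m)) < e" using reals_Archimedean by blast
      have "eventually (\<lambda>n. \<omega> \<in> space M - bad m n \<and> n > 0) sequentially"
        using elim eventually_gt_at_top by (intro eventually_conj) auto
      then obtain n0 where n0: "\<And>n. n \<ge> n0 \<Longrightarrow> \<omega> \<in> space M - bad m n \<and> n > 0"
        by (auto simp: eventually_sequentially)
      show "\<exists>no. \<forall>n\<ge>no. norm (?c n \<omega> / real n - p) < e"
      proof (intro exI allI impI)
        fix n assume n: "n0 \<le> n"
        have "\<bar>?c n \<omega> - real n * p\<bar> < real n / Suc m" "n > 0"
          using n0[OF n] by (auto simp: bad_def sumY)
        moreover have "?c n \<omega> / real n - p
            = (?c n \<omega> - real n * p) / real n"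
          using \<open>n > 0\<close> by (simp add: diff_divide_distrib)
        ultimately have "\<bar>?c n \<omega> / real n - p\<bar> < (real n / Suc m) / real n"
          using divide_strict_right_mono[of _ _ "real n"] by (simp only: abs_divide abs_of_nat of_nat_0_less_iff)
        then have "\<bar>?c n \<omega> / real n - p\<bar> < inverse (Suc m)"
          using \<open>n > 0\<close> by (simp add: inverse_eq_divide del: of_nat_Suc)
        then show "norm (?c n \<omega> / real n - p) < e" using m by simp
      qed
    qed
  qed
qed

section \<open>Volumes and moments of power simplices\<close>

lemma Basis_vec_real: "(Basis :: (real ^ 'k) set) = range (\<lambda>k. axis k 1)"
  by (auto simp: Basis_vec_def)

lemma prod_Basis_vec: "(\<Prod>b\<in>(Basis :: (real ^ 'k) set). f b) = (\<Prod>k\<in>UNIV. f (axis k 1))"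
  unfolding Basis_vec_real by (subst prod.reindex) (auto simp: inj_on_def axis_eq_axis)

lemma sum_Basis_vec: "(\<Sum>b\<in>(Basis :: (real ^ 'k) set). f b) = (\<Sum>k\<in>UNIV. f (axis k 1))"
  unfolding Basis_vec_real by (subst sum.reindex) (auto simp: inj_on_def axis_eq_axis)

lemma emeasure_cube: "emeasure lborel (cbox 0 (1 :: real ^ 'k)) = 1"
  by (simp add: emeasure_lborel_cbox_eq Basis_vec_real inner_axis prod_Basis_vec[unfolded Basis_vec_real])

lemma borel_measurable_inner_vpow [measurable]:
  "(\<lambda>x :: real ^ 'k. \<nu> \<bullet> vpow x \<epsilon>) \<in> borel_measurable borel"
  unfolding vpow_def inner_vec_def by simp

lemma borel_measurable_vec_lambda:
  assumes "\<And>k. f k \<in> borel_measurable M"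
  shows "(\<lambda>x. (\<chi> k. f k x) :: real ^ 'k) \<in> borel_measurable M"
  unfolding borel_measurable_euclidean_space[where 'c = "real ^ 'k"]
  using assms by (auto simp: Basis_vec_real inner_axis)

lemma nn_integral_lborel_vec_scale:
  fixes c :: "real ^ 'k"
  assumes c: "\<And>k. 0 < c $ k" and f [measurable]: "f \<in> borel_measurable borel"
  shows "(\<integral>\<^sup>+x. f x \<partial>lborel) = ennreal (\<Prod>k\<in>UNIV. c $ k) * (\<integral>\<^sup>+x. f (\<chi> k. c $ k * x $ k) \<partial>lborel)"
proof -
  have T: "(\<lambda>x. 0 + (\<Sum>j\<in>Basis. (c \<bullet> j * (x \<bullet> j)) *\<^sub>R j)) = (\<lambda>x :: real ^ 'k. \<chi> k. c $ k * x $ k)"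
  proof
    fix x :: "real ^ 'k"
    have "(\<Sum>j\<in>Basis. (c \<bullet> j * (x \<bullet> j)) *\<^sub>R j) = (\<Sum>k\<in>UNIV. (c $ k * x $ k) *\<^sub>R axis k 1)"
      unfolding sum_Basis_vec by (simp add: inner_axis)
    also have "\<dots> = (\<chi> k. c $ k * x $ k)"
      by (simp add: vec_eq_iff axis_def if_distrib[of "(*) _"] cong: if_cong)
    finally show "0 + (\<Sum>j\<in>Basis. (c \<bullet> j * (x \<bullet> j)) *\<^sub>R j) = (\<chi> k. c $ k * x $ k)" by simp
  qed
  have [measurable]: "(\<lambda>x :: real ^ 'k. (\<chi> k. c $ k * x $ k) :: real ^ 'k) \<in> borel_measurable borel"
    by (intro borel_measurable_vec_lambda) simp
  have nz: "c \<bullet> j \<noteq> 0" if "j \<in> Basis" for j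
    using that c by (auto simp: Basis_vec_real inner_axis order.strict_iff_order)
  have P: "(\<Prod>j\<in>Basis. \<bar>c \<bullet> j\<bar>) = (\<Prod>k\<in>UNIV. c $ k)"
    unfolding prod_Basis_vec by (simp add: inner_axis abs_of_pos c)
  let ?D = "density (distr lborel borel (\<lambda>x :: real ^ 'k. \<chi> k. c $ k * x $ k)) (\<lambda>_. ennreal (\<Prod>k\<in>UNIV. c $ k))"
  have "lborel = ?D"
    using lborel_affine_euclidean[of "\<lambda>j. c \<bullet> j" "0 :: real ^ 'k"] nz unfolding T P by simp
  then have "(\<integral>\<^sup>+x. f x \<partial>lborel) = (\<integral>\<^sup>+x. f x \<partial>?D)"
    by simp
  also have "\<dots> = ennreal (\<Prod>k\<in>UNIV. c $ k) * (\<integral>\<^sup>+x. f (\<chi> k. c $ k * x $ k) \<partial>lborel)"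
    by (simp add: nn_integral_density nn_integral_distr nn_integral_cmult)
  finally show ?thesis .
qed

text \<open>Lebesgue measure and its image under a permutation of the coordinates both give a box the product
  of its side lengths.\<close>

lemma nn_integral_lborel_vec_permute:
  fixes \<sigma> :: "'k::finite \<Rightarrow> 'k" and f :: "real ^ 'k \<Rightarrow> ennreal"
  assumes \<sigma>: "bij \<sigma>" and f [measurable]: "f \<in> borel_measurable borel"
  shows "(\<integral>\<^sup>+x. f (\<chi> k. x $ \<sigma> k) \<partial>lborel) = (\<integral>\<^sup>+x. f x \<partial>lborel)"
proof -
  have [measurable]: "(\<lambda>x :: real ^ 'k. (\<chi> k. x $ \<sigma> k) :: real ^ 'k) \<in> borel_measurable borel"
    by (intro borel_measurable_vec_lambda) simp
  have "lborel = distr lborel borel (\<lambda>x :: real ^ 'k. \<chi> k. x $ \<sigma> k)"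
  proof (rule lborel_eqI)
    fix l u :: "real ^ 'k" assume le: "\<And>b. b \<in> Basis \<Longrightarrow> l \<bullet> b \<le> u \<bullet> b"
    have lu: "l $ k \<le> u $ k" for k using le[of "axis k 1"] by (simp add: inner_axis Basis_vec_real)
    have "(\<lambda>x. \<chi> k. x $ \<sigma> k) -` box l u = box (\<chi> k. l $ inv \<sigma> k) (\<chi> k. u $ inv \<sigma> k)"
      unfolding set_eq_iff vimage_eq mem_box_cart using \<sigma>
      by (auto simp: bij_inv_eq_iff) (metis \<sigma> bij_inv_eq_iff)+
    moreover have "\<forall>b\<in>Basis. (\<chi> k. l $ inv \<sigma> k) \<bullet> b \<le> (\<chi> k. u $ inv \<sigma> k) \<bullet> b"
      using lu by (auto simp: Basis_vec_real inner_axis)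
    ultimately have "emeasure (distr lborel borel (\<lambda>x. \<chi> k. x $ \<sigma> k)) (box l u)
        = (\<Prod>k\<in>UNIV. u $ inv \<sigma> k - l $ inv \<sigma> k)"
      by (simp add: emeasure_distr emeasure_lborel_box_eq prod_Basis_vec inner_axis)
    also have "\<dots> = (\<Prod>k\<in>UNIV. u $ k - l $ k)"
      using \<sigma> by (intro arg_cong[of _ _ ennreal] prod.reindex_bij_betw[of "inv \<sigma>"] bij_imp_bij_inv)
    finally show "emeasure (distr lborel borel (\<lambda>x. \<chi> k. x $ \<sigma> k)) (box l u) = (\<Prod>b\<in>Basis. (u - l) \<bullet> b)"
      by (simp add: prod_Basis_vec inner_axis)
  qed simp
  then have "(\<integral>\<^sup>+x. f x \<partial>lborel) = (\<integral>\<^sup>+x. f x \<partial>distr lborel borel (\<lambda>x :: real ^ 'k. \<chi> k. x $ \<sigma> k))"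
    by simp
  then show ?thesis by (simp add: nn_integral_distr)
qed

text \<open>In contrast to its trace on the unit cube, the sublevel set in the whole orthant scales exactly
  in the level \<open>u\<close>.\<close>

definition power_simplex :: "real \<Rightarrow> real ^ 'k \<Rightarrow> real \<Rightarrow> (real ^ 'k) set" where
  "power_simplex \<epsilon> \<nu> u = {x. (\<forall>k. 0 \<le> x $ k) \<and> \<nu> \<bullet> vpow x \<epsilon> \<le> u}"

lemma inner_vpow: "\<nu> \<bullet> vpow x \<epsilon> = (\<Sum>k\<in>UNIV. \<nu> $ k * x $ k powr \<epsilon>)"
  by (simp add: inner_vec_def vpow_def)

lemma power_simplex_measurable [measurable]: "power_simplex \<epsilon> \<nu> u \<in> sets borel"
  unfolding power_simplex_def by measurable

lemma inner_vpow_nonneg: "(\<And>k. 0 \<le> \<nu> $ k) \<Longrightarrow> 0 \<le> \<nu> \<bullet> vpow x \<epsilon>"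
  by (auto simp: inner_vpow intro!: sum_nonneg)

lemma component_le_inner_vpow:
  assumes "\<And>k. 0 \<le> \<nu> $ k"
  shows "\<nu> $ k * x $ k powr \<epsilon> \<le> \<nu> \<bullet> vpow x \<epsilon>"
  unfolding inner_vpow by (rule member_le_sum) (use assms in auto)

lemma inner_vpow_le_sum:
  fixes \<nu> :: "real ^ 'k"
  assumes \<epsilon>: "0 < \<epsilon>" and \<nu>: "\<And>k. 0 < \<nu> $ k" and x: "x \<in> cbox 0 1"
  shows "\<nu> \<bullet> vpow x \<epsilon> \<le> (\<Sum>k\<in>UNIV. \<nu> $ k)"
  unfolding inner_vpow using \<epsilon> x
  by (intro sum_mono mult_left_le[OF _ less_imp_le[OF \<nu>]] powr_le1) (auto simp: mem_box_cart)

lemma power_simplex_subset_cube: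
  assumes \<epsilon>: "0 < \<epsilon>" and \<nu>: "\<And>k. 0 < \<nu> $ k" and u: "\<And>k. u \<le> \<nu> $ k"
  shows "power_simplex \<epsilon> \<nu> u \<subseteq> cbox 0 1"
proof
  fix x assume x: "x \<in> power_simplex \<epsilon> \<nu> u"
  have "x $ k \<le> 1" for k
  proof (rule ccontr)
    assume "\<not> x $ k \<le> 1"
    then have "1 < x $ k powr \<epsilon>" using \<epsilon> by (simp add: gr_one_powr)
    then have "\<nu> $ k < \<nu> $ k * x $ k powr \<epsilon>" using \<nu>[of k] by simp
    also have "\<dots> \<le> \<nu> \<bullet> vpow x \<epsilon>" using \<nu> by (intro component_le_inner_vpow less_imp_le)
    also have "\<dots> \<le> u" using x by (simp add: power_simplex_def)
    finally show False using u[of k] by simp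
  qed
  then show "x \<in> cbox 0 1" using x by (auto simp: mem_box_cart power_simplex_def)
qed

lemma power_simplex_scale:
  assumes \<epsilon>: "0 < \<epsilon>" and \<nu>: "\<And>k. 0 < \<nu> $ k" and u: "0 < u"
  shows "(\<chi> k. (u / \<nu> $ k) powr (1 / \<epsilon>) * x $ k) \<in> power_simplex \<epsilon> \<nu> u \<longleftrightarrow> x \<in> power_simplex \<epsilon> 1 1"
proof -
  have c: "0 < (u / \<nu> $ k) powr (1 / \<epsilon>)" for k using \<nu>[of k] u by simp
  have "\<nu> \<bullet> vpow (\<chi> k. (u / \<nu> $ k) powr (1 / \<epsilon>) * x $ k) \<epsilon> = u * (1 \<bullet> vpow x \<epsilon>)"
    if "\<forall>k. 0 \<le> x $ k"
  proof -
    have "\<nu> $ k * ((u / \<nu> $ k) powr (1 / \<epsilon>) * x $ k) powr \<epsilon> = u * x $ k powr \<epsilon>" for k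
    proof -
      have "((u / \<nu> $ k) powr (1 / \<epsilon>) * x $ k) powr \<epsilon> = u / \<nu> $ k * x $ k powr \<epsilon>"
        using that c[of k] \<epsilon> \<nu>[of k] u by (subst powr_mult) (auto simp: powr_powr)
      then show ?thesis using \<nu>[of k] by simp
    qed
    then show ?thesis by (simp add: inner_vpow sum_distrib_left)
  qed
  then show ?thesis using c u
    by (auto simp: power_simplex_def zero_le_mult_iff not_le[symmetric] dest: less_imp_le)
qed

lemma power_simplex_0:
  fixes \<nu> :: "real ^ 'k"
  assumes \<nu>: "\<And>k. 0 < \<nu> $ k"
  shows "power_simplex \<epsilon> \<nu> 0 = {0}"
proof -
  have "x = 0" if "x \<in> power_simplex \<epsilon> \<nu> 0" for x
  proof -
    have "x $ k = 0" for k
    proof -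
      have "\<nu> $ k * x $ k powr \<epsilon> \<le> 0"
        using component_le_inner_vpow[of \<nu> k x \<epsilon>] that \<nu> by (fastforce simp: power_simplex_def less_imp_le)
      then show ?thesis using \<nu>[of k] by (simp add: mult_le_0_iff)
    qed
    then show ?thesis by (simp add: vec_eq_iff)
  qed
  then show ?thesis by (auto simp: power_simplex_def inner_vpow)
qed

lemma V_vol_power_simplex:
  assumes "0 < \<epsilon>"
  shows "emeasure lborel (power_simplex \<epsilon> (1 :: real ^ 'k) 1) = ennreal (V_vol TYPE('k) \<epsilon>)"
proof -
  have sub: "power_simplex \<epsilon> (1 :: real ^ 'k) 1 \<subseteq> cbox 0 1"
    using assms by (intro power_simplex_subset_cube) auto
  then have "power_simplex \<epsilon> (1 :: real ^ 'k) 1 = {x \<in> cbox 0 1. (\<Sum>k\<in>UNIV. x $ k powr \<epsilon>) \<le> 1}"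
    by (auto simp: power_simplex_def inner_vpow mem_box_cart)
  moreover have "emeasure lborel (power_simplex \<epsilon> (1 :: real ^ 'k) 1) < \<infinity>"
    using emeasure_mono[OF sub, of lborel] emeasure_lborel_cbox_finite[of "0 :: real ^ 'k" 1] by (simp add: order_le_less_trans)
  ultimately show ?thesis by (simp add: V_vol_def emeasure_eq_ennreal_measure)
qed

text \<open>Stretching the coordinate \<open>k\<close> by \<open>(u / \<nu> $ k) powr (1 / \<epsilon>)\<close> maps the unit simplex onto this one.\<close>

lemma nn_integral_power_simplex:
  fixes \<nu> :: "real ^ 'k" and f :: "real ^ 'k \<Rightarrow> ennreal"
  assumes \<epsilon>: "0 < \<epsilon>" and \<nu>: "\<And>k. 0 < \<nu> $ k" and u: "0 < u" and f [measurable]: "f \<in> borel_measurable borel"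
  shows "(\<integral>\<^sup>+x. indicator (power_simplex \<epsilon> \<nu> u) x * f x \<partial>lborel) =
    ennreal (\<Prod>k\<in>UNIV. (u / \<nu> $ k) powr (1 / \<epsilon>)) *
    (\<integral>\<^sup>+x. indicator (power_simplex \<epsilon> 1 1) x * f (\<chi> k. (u / \<nu> $ k) powr (1 / \<epsilon>) * x $ k) \<partial>lborel)"
proof -
  define c :: "real ^ 'k" where "c = (\<chi> k. (u / \<nu> $ k) powr (1 / \<epsilon>))"
  have "0 < c $ k" for k using \<nu>[of k] u by (simp add: c_def)
  moreover have "(\<lambda>x. indicator (power_simplex \<epsilon> \<nu> u) x * f x) \<in> borel_measurable borel" by measurable
  ultimately have "(\<integral>\<^sup>+x. indicator (power_simplex \<epsilon> \<nu> u) x * f x \<partial>lborel) = ennreal (\<Prod>k\<in>UNIV. c $ k) *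
    (\<integral>\<^sup>+x. indicator (power_simplex \<epsilon> \<nu> u) (\<chi> k. c $ k * x $ k) * f (\<chi> k. c $ k * x $ k) \<partial>lborel)"
    by (rule nn_integral_lborel_vec_scale)
  also have "(\<lambda>x. indicator (power_simplex \<epsilon> \<nu> u) (\<chi> k. c $ k * x $ k)) = (indicator (power_simplex \<epsilon> 1 1) :: _ \<Rightarrow> ennreal)"
    using power_simplex_scale[OF \<epsilon> \<nu> u] by (auto simp: c_def indicator_def fun_eq_iff)
  finally show ?thesis by (simp add: c_def fun_eq_iff)
qed

text \<open>The volume of the simplex of level \<open>1\<close>.\<close>

definition simplex_const :: "real \<Rightarrow> real ^ 'k \<Rightarrow> real" where
  "simplex_const \<epsilon> \<nu> = V_vol TYPE('k) \<epsilon> * (\<Prod>k\<in>UNIV. \<nu> $ k powr (- 1 / \<epsilon>))"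

lemma simplex_scale_prod:
  fixes \<nu> :: "real ^ 'k"
  assumes \<nu>: "\<And>k. 0 < \<nu> $ k" and u: "0 < u"
  shows "(\<Prod>k\<in>UNIV. (u / \<nu> $ k) powr (1 / \<epsilon>)) * V_vol TYPE('k) \<epsilon> = simplex_const \<epsilon> \<nu> * u powr (real CARD('k) / \<epsilon>)"
proof -
  have "(\<Prod>k\<in>UNIV. (u / \<nu> $ k) powr (1 / \<epsilon>)) = (\<Prod>k\<in>UNIV. u powr (1 / \<epsilon>) * \<nu> $ k powr (- 1 / \<epsilon>))"
    using less_imp_le[OF \<nu>] u by (intro prod.cong) (auto simp: powr_divide powr_minus_divide minus_divide_left[symmetric])
  also have "\<dots> = u powr (real CARD('k) / \<epsilon>) * (\<Prod>k\<in>UNIV. \<nu> $ k powr (- 1 / \<epsilon>))"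
    using u by (simp add: prod.distrib powr_powr flip: powr_realpow)
  finally show ?thesis by (simp add: simplex_const_def)
qed

lemma V_vol_nonneg: "0 \<le> V_vol TYPE('k::finite) \<epsilon>"
  by (simp add: V_vol_def)

lemma simplex_const_nonneg: "0 \<le> simplex_const \<epsilon> \<nu>"
  by (auto simp: simplex_const_def V_vol_nonneg intro!: mult_nonneg_nonneg prod_nonneg)

lemma emeasure_power_simplex:
  fixes \<nu> :: "real ^ 'k"
  assumes \<epsilon>: "0 < \<epsilon>" and \<nu>: "\<And>k. 0 < \<nu> $ k" and u: "0 \<le> u"
  shows "emeasure lborel (power_simplex \<epsilon> \<nu> u) = ennreal (simplex_const \<epsilon> \<nu> * u powr (real CARD('k) / \<epsilon>))"
proof (cases "u = 0")
  case True then show ?thesis using \<nu> by (simp add: power_simplex_0)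
next
  case False
  then have u: "0 < u" using u by simp
  have "emeasure lborel (power_simplex \<epsilon> \<nu> u) = ennreal (\<Prod>k\<in>UNIV. (u / \<nu> $ k) powr (1 / \<epsilon>)) * ennreal (V_vol TYPE('k) \<epsilon>)"
    using nn_integral_power_simplex[OF \<epsilon> \<nu> u, of "\<lambda>_. 1"] \<epsilon> by (simp add: V_vol_power_simplex)
  then show ?thesis
    unfolding simplex_scale_prod[OF \<nu> u, symmetric] by (simp add: ennreal_mult V_vol_nonneg prod_nonneg)
qed

lemma measure_power_simplex:
  fixes \<nu> :: "real ^ 'k"
  assumes \<epsilon>: "0 < \<epsilon>" and \<nu>: "\<And>k. 0 < \<nu> $ k" and u: "0 \<le> u"
  shows "measure lborel (power_simplex \<epsilon> \<nu> u) = simplex_const \<epsilon> \<nu> * u powr (real CARD('k) / \<epsilon>)"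
  using emeasure_power_simplex[OF assms] by (simp add: measure_def simplex_const_nonneg)

text \<open>At the level \<open>\<Sum>k. \<nu> $ k\<close> the simplex contains the unit cube.\<close>

lemma simplex_const_pos:
  fixes \<nu> :: "real ^ 'k"
  assumes \<epsilon>: "0 < \<epsilon>" and \<nu>: "\<And>k. 0 < \<nu> $ k"
  shows "0 < simplex_const \<epsilon> \<nu>"
proof -
  define u where "u = (\<Sum>k\<in>UNIV. \<nu> $ k)"
  have u: "0 \<le> u" using less_imp_le[OF \<nu>] by (simp add: u_def sum_nonneg)
  have "cbox 0 1 \<subseteq> power_simplex \<epsilon> \<nu> u"
    using inner_vpow_le_sum[OF \<epsilon> \<nu>] by (auto simp: power_simplex_def mem_box_cart u_def)
  then have "emeasure lborel (cbox 0 (1 :: real ^ 'k)) \<le> emeasure lborel (power_simplex \<epsilon> \<nu> u)"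
    by (intro emeasure_mono) auto
  then have "simplex_const \<epsilon> \<nu> \<noteq> 0" using emeasure_power_simplex[OF \<epsilon> \<nu> u] emeasure_cube[where 'k = 'k] by auto
  then show ?thesis using simplex_const_nonneg[of \<epsilon> \<nu>] by simp
qed

text \<open>Layer cake: for \<open>x\<close> in the unit simplex, \<open>1 - 1 \<bullet> vpow x \<epsilon>\<close> is the length of the interval of
  levels \<open>s \<le> 1\<close> whose simplex contains \<open>x\<close>. The simplex of level \<open>s\<close> has volume proportional to
  \<open>s powr (K / \<epsilon>)\<close>, which is integrated over \<open>s\<close>.\<close>

lemma nn_integral_simplex_gap:
  assumes \<epsilon>: "0 < \<epsilon>"
  shows "(\<integral>\<^sup>+x. indicator (power_simplex \<epsilon> (1 :: real ^ 'k) 1) x * ennreal (1 - 1 \<bullet> vpow x \<epsilon>) \<partial>lborel) =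
    ennreal (V_vol TYPE('k) \<epsilon> * \<epsilon> / (real CARD('k) + \<epsilon>))"
proof -
  let ?V = "V_vol TYPE('k) \<epsilon>" and ?p = "real CARD('k) / \<epsilon>"
  define A :: "((real ^ 'k) \<times> real) set" where
    "A = {p. (\<forall>k. 0 \<le> fst p $ k) \<and> 1 \<bullet> vpow (fst p) \<epsilon> \<le> snd p \<and> 0 \<le> snd p \<and> snd p \<le> 1}"
  have A [measurable]: "A \<in> sets (lborel \<Otimes>\<^sub>M lborel)"
  proof -
    have "{p \<in> space (lborel \<Otimes>\<^sub>M lborel). (\<forall>k. 0 \<le> (fst p :: real ^ 'k) $ k) \<and> 1 \<bullet> vpow (fst p) \<epsilon> \<le> snd p \<and> 0 \<le> snd p \<and> snd p \<le> 1}
        \<in> sets (lborel \<Otimes>\<^sub>M lborel)" by measurable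
    then show ?thesis by (simp add: A_def space_pair_measure)
  qed
  have "(\<integral>\<^sup>+s. indicator A (x, s) \<partial>lborel) = indicator (power_simplex \<epsilon> 1 1) x * ennreal (1 - 1 \<bullet> vpow x \<epsilon>)" for x
  proof (cases "x \<in> power_simplex \<epsilon> 1 1")
    case True
    have "0 \<le> 1 \<bullet> vpow x \<epsilon>" by (intro inner_vpow_nonneg) simp
    then have "(\<lambda>s. indicator A (x, s) :: ennreal) = indicator {1 \<bullet> vpow x \<epsilon>..1}"
      using True by (auto simp: A_def power_simplex_def indicator_def fun_eq_iff)
    then show ?thesis using True by (simp add: power_simplex_def)
  next
    case False
    then have "(\<lambda>s. indicator A (x, s) :: ennreal) = (\<lambda>_. 0)"
      by (auto simp: A_def power_simplex_def indicator_def fun_eq_iff)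
    then show ?thesis using False by simp
  qed
  then have "(\<integral>\<^sup>+x. indicator (power_simplex \<epsilon> (1 :: real ^ 'k) 1) x * ennreal (1 - 1 \<bullet> vpow x \<epsilon>) \<partial>lborel)
    = (\<integral>\<^sup>+x. (\<integral>\<^sup>+s. indicator A (x, s) \<partial>lborel) \<partial>lborel)" by simp
  also have "\<dots> = (\<integral>\<^sup>+s. (\<integral>\<^sup>+x. indicator A (x, s) \<partial>lborel) \<partial>lborel)"
    by (rule lborel_pair.Fubini'[symmetric]) simp
  also have "\<dots> = (\<integral>\<^sup>+s. ennreal (?V * (if s \<in> {0..1} then s powr ?p else 0)) \<partial>lborel)"
  proof (rule nn_integral_cong)
    fix s :: real
    show "(\<integral>\<^sup>+x. indicator A (x, s) \<partial>lborel) = ennreal (?V * (if s \<in> {0..1} then s powr ?p else 0))"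
    proof (cases "s \<in> {0..1}")
      case True
      then have "(\<lambda>x. indicator A (x, s) :: ennreal) = indicator (power_simplex \<epsilon> 1 s)"
        by (auto simp: A_def power_simplex_def indicator_def fun_eq_iff)
      then have "(\<integral>\<^sup>+x. indicator A (x, s) \<partial>lborel) = emeasure lborel (power_simplex \<epsilon> (1 :: real ^ 'k) s)" by simp
      then show ?thesis using True \<epsilon> by (simp add: emeasure_power_simplex simplex_const_def)
    next
      case False
      then have "(\<lambda>x. indicator A (x, s) :: ennreal) = (\<lambda>_. 0)"
        by (auto simp: A_def indicator_def fun_eq_iff)
      then show ?thesis using False by auto
    qed
  qed
  also have "\<dots> = ennreal (?V * (1 / (?p + 1)))"
  proof (rule nn_integral_has_integral_lborel)
    have "((\<lambda>s. s powr ?p) has_integral (1 powr (?p + 1) / (?p + 1))) {0..1}"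
      using \<epsilon> by (intro has_integral_powr_from_0) (auto intro: less_le_trans[of _ 0])
    then have "((\<lambda>s. if s \<in> {0..1} then s powr ?p else 0) has_integral (1 / (?p + 1))) UNIV"
      by (simp only: has_integral_restrict_UNIV powr_one_eq_one)
    then show "((\<lambda>s. ?V * (if s \<in> {0..1} then s powr ?p else 0)) has_integral (?V * (1 / (?p + 1)))) UNIV"
      by (rule has_integral_mult_right)
  qed (auto simp: V_vol_nonneg)
  also have "?V * (1 / (?p + 1)) = ?V * \<epsilon> / (real CARD('k) + \<epsilon>)"
    using \<epsilon> by (simp add: field_simps)
  finally show ?thesis .
qed

text \<open>All coordinates have the same moment by symmetry, and by \<open>nn_integral_simplex_gap\<close> they add up to
  \<open>V - V * \<epsilon> / (K + \<epsilon>)\<close>.\<close>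

lemma nn_integral_unit_simplex_component:
  assumes \<epsilon>: "0 < \<epsilon>"
  shows "(\<integral>\<^sup>+x. indicator (power_simplex \<epsilon> (1 :: real ^ 'k) 1) x * ennreal (x $ k powr \<epsilon>) \<partial>lborel) =
    ennreal (V_vol TYPE('k) \<epsilon> / (real CARD('k) + \<epsilon>))"
proof -
  let ?V = "V_vol TYPE('k) \<epsilon>" and ?K = "real CARD('k)" and ?\<Delta> = "power_simplex \<epsilon> (1 :: real ^ 'k) 1"
  define J where "J = (\<lambda>k. \<integral>\<^sup>+x. indicator ?\<Delta> x * ennreal (x $ k powr \<epsilon>) \<partial>lborel)"
  have sym: "J l = J k" for l
  proof -
    define \<sigma> where "\<sigma> = Transposition.transpose k l"
    have \<sigma>: "bij \<sigma>" by (simp add: \<sigma>_def)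
    have inv: "(\<chi> i. x $ \<sigma> i) \<in> ?\<Delta> \<longleftrightarrow> x \<in> ?\<Delta>" for x
    proof -
      have "(\<Sum>i\<in>UNIV. x $ \<sigma> i powr \<epsilon>) = (\<Sum>i\<in>UNIV. x $ i powr \<epsilon>)"
        using \<sigma> by (rule sum.reindex_bij_betw)
      moreover have "(\<forall>i. 0 \<le> x $ \<sigma> i) \<longleftrightarrow> (\<forall>i. 0 \<le> x $ i)"
        using \<sigma> by (metis bij_pointE)
      ultimately show ?thesis by (simp add: power_simplex_def inner_vpow)
    qed
    have "J k = (\<integral>\<^sup>+x. indicator ?\<Delta> (\<chi> i. x $ \<sigma> i) * ennreal ((\<chi> i. x $ \<sigma> i) $ k powr \<epsilon>) \<partial>lborel)"
      unfolding J_def by (rule nn_integral_lborel_vec_permute[OF \<sigma>, symmetric]) measurable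
    also have "\<dots> = J l" unfolding J_def
      by (intro nn_integral_cong) (simp add: indicator_def inv, simp add: \<sigma>_def)
    finally show ?thesis by simp
  qed
  have "J k \<le> (\<integral>\<^sup>+x. indicator ?\<Delta> x \<partial>lborel)"
    unfolding J_def
  proof (rule nn_integral_mono)
    fix x
    show "indicator ?\<Delta> x * ennreal (x $ k powr \<epsilon>) \<le> indicator ?\<Delta> x"
      using component_le_inner_vpow[of 1 k x \<epsilon>] by (auto simp: power_simplex_def indicator_def)
  qed
  then have fin: "J k \<noteq> \<infinity>" using V_vol_power_simplex[OF \<epsilon>, where 'k = 'k] by (auto simp: top_unique)
  define j where "j = enn2real (J k)"
  have Jj: "J k = ennreal j" "0 \<le> j" using fin by (auto simp: j_def less_top)
  have "?V = (\<integral>\<^sup>+x. indicator ?\<Delta> x \<partial>lborel)" using V_vol_power_simplex[OF \<epsilon>, where 'k = 'k] by simp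
  also have "\<dots> = (\<integral>\<^sup>+x. (\<Sum>l\<in>UNIV. indicator ?\<Delta> x * ennreal (x $ l powr \<epsilon>)) + indicator ?\<Delta> x * ennreal (1 - 1 \<bullet> vpow x \<epsilon>) \<partial>lborel)"
  proof (rule nn_integral_cong)
    fix x
    have "x \<in> ?\<Delta> \<Longrightarrow> (\<Sum>l\<in>UNIV. ennreal (x $ l powr \<epsilon>)) + ennreal (1 - 1 \<bullet> vpow x \<epsilon>) = 1"
      by (subst sum_ennreal) (auto simp: power_simplex_def inner_vpow sum_nonneg simp flip: ennreal_plus)
    then show "indicator ?\<Delta> x = (\<Sum>l\<in>UNIV. indicator ?\<Delta> x * ennreal (x $ l powr \<epsilon>)) + indicator ?\<Delta> x * ennreal (1 - 1 \<bullet> vpow x \<epsilon>)"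
      by (auto simp: indicator_def)
  qed
  also have "\<dots> = (\<Sum>l\<in>UNIV. J l) + ennreal (?V * \<epsilon> / (?K + \<epsilon>))"
  proof -
    have "(\<integral>\<^sup>+x. (\<Sum>l\<in>UNIV. indicator ?\<Delta> x * ennreal (x $ l powr \<epsilon>)) \<partial>lborel) = (\<Sum>l\<in>UNIV. J l)"
      unfolding J_def by (rule nn_integral_sum) measurable
    then show ?thesis
      unfolding nn_integral_simplex_gap[OF \<epsilon>, symmetric] by (subst nn_integral_add) simp_all
  qed
  also have "(\<Sum>l\<in>UNIV. J l) = ennreal (?K * j)"
    using sym Jj by (simp add: ennreal_mult ennreal_of_nat_eq_real_of_nat)
  also have "\<dots> + ennreal (?V * \<epsilon> / (?K + \<epsilon>)) = ennreal (?K * j + ?V * \<epsilon> / (?K + \<epsilon>))"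
    using Jj \<epsilon> by (intro ennreal_plus[symmetric]) (auto simp: V_vol_nonneg)
  finally have "?V = ?K * j + ?V * \<epsilon> / (?K + \<epsilon>)"
    using Jj \<epsilon> by (subst (asm) ennreal_inj) (auto simp: V_vol_nonneg)
  then have "?K * ?V = ?K * (j * (?K + \<epsilon>))" using \<epsilon> by (simp add: field_simps)
  then have "?V = j * (?K + \<epsilon>)" by simp
  then have "j = ?V / (?K + \<epsilon>)" using \<epsilon> by (simp add: field_simps)
  then show ?thesis using Jj by (simp add: J_def)
qed

text \<open>The value is exact for every level, so that subtracting it for two levels gives the integral over
  a thin shell without any error term.\<close>

lemma has_bochner_integral_power_simplex:
  fixes \<nu> \<gamma> :: "real ^ 'k"
  assumes \<epsilon>: "0 < \<epsilon>" and \<nu>: "\<And>k. 0 < \<nu> $ k" and u: "0 \<le> u"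
  shows "has_bochner_integral lborel (\<lambda>x. indicator (power_simplex \<epsilon> \<nu> u) x * (\<gamma> \<bullet> vpow x \<epsilon>))
    (measure lborel (power_simplex \<epsilon> \<nu> u) * u * (\<Sum>k\<in>UNIV. \<gamma> $ k / \<nu> $ k) / (real CARD('k) + \<epsilon>))"
proof (cases "u = 0")
  case True
  have "(\<lambda>x. indicator (power_simplex \<epsilon> \<nu> u) x * (\<gamma> \<bullet> vpow x \<epsilon>)) = (\<lambda>_. 0)"
    using \<nu> True by (auto simp: power_simplex_0 indicator_def inner_vpow)
  then show ?thesis using True by (simp add: has_bochner_integral_zero)
next
  case False
  then have u: "0 < u" using u by simp
  let ?K = "real CARD('k)" and ?W = "measure lborel (power_simplex \<epsilon> \<nu> u)"
  let ?P = "\<Prod>k\<in>UNIV. (u / \<nu> $ k) powr (1 / \<epsilon>)"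
  let ?z = "\<lambda>x k. ((\<chi> k. (u / \<nu> $ k) powr (1 / \<epsilon>) * x $ k) :: real ^ 'k) $ k powr \<epsilon>"
  let ?Q = "power_simplex \<epsilon> \<nu> u"
  have W: "?W = ?P * V_vol TYPE('k) \<epsilon>"
    using measure_power_simplex[OF \<epsilon> \<nu>] u simplex_scale_prod[OF \<nu> u, of \<epsilon>] by simp
  have "has_bochner_integral lborel (\<lambda>x. indicator (?Q) x * x $ k powr \<epsilon>)
      (?W * (u / \<nu> $ k) / (?K + \<epsilon>))" for k
  proof (rule has_bochner_integral_nn_integral)
    have "(\<integral>\<^sup>+x. ennreal (indicator (?Q) x * x $ k powr \<epsilon>) \<partial>lborel)
        = (\<integral>\<^sup>+x. indicator (?Q) x * ennreal (x $ k powr \<epsilon>) \<partial>lborel)"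
      by (intro nn_integral_cong) (simp add: indicator_def)
    also have "\<dots> = ennreal ?P * (\<integral>\<^sup>+x. indicator (power_simplex \<epsilon> 1 1) x *
        ennreal (?z x k) \<partial>lborel)"
      by (rule nn_integral_power_simplex[OF \<epsilon> \<nu> u]) measurable
    also have "(\<integral>\<^sup>+x. indicator (power_simplex \<epsilon> 1 1) x *
        ennreal (?z x k) \<partial>lborel)
        = (\<integral>\<^sup>+x. ennreal (u / \<nu> $ k) * (indicator (power_simplex \<epsilon> (1 :: real ^ 'k) 1) x * ennreal (x $ k powr \<epsilon>)) \<partial>lborel)"
    proof (rule nn_integral_cong)
      fix x :: "real ^ 'k"
      have "ennreal (((u / \<nu> $ k) powr (1 / \<epsilon>) * x $ k) powr \<epsilon>) = ennreal (u / \<nu> $ k) * ennreal (x $ k powr \<epsilon>)"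
        if "0 \<le> x $ k"
      proof -
        have "((u / \<nu> $ k) powr (1 / \<epsilon>) * x $ k) powr \<epsilon> = u / \<nu> $ k * x $ k powr \<epsilon>"
          using that \<epsilon> \<nu>[of k] u by (subst powr_mult) (auto simp: powr_powr)
        then show ?thesis using \<nu>[of k] u by (simp only: ennreal_mult' divide_nonneg_pos less_imp_le)
      qed
      then show "indicator (power_simplex \<epsilon> 1 1) x *
        ennreal (?z x k)
        = ennreal (u / \<nu> $ k) * (indicator (power_simplex \<epsilon> 1 1) x * ennreal (x $ k powr \<epsilon>))"
        by (simp add: indicator_def power_simplex_def)
    qed
    also have "\<dots> = ennreal (u / \<nu> $ k) * ennreal (V_vol TYPE('k) \<epsilon> / (?K + \<epsilon>))"
      by (simp add: nn_integral_cmult nn_integral_unit_simplex_component[OF \<epsilon>])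
    also have "ennreal ?P * \<dots> = ennreal (?P * (u / \<nu> $ k * (V_vol TYPE('k) \<epsilon> / (?K + \<epsilon>))))"
      using \<epsilon> \<nu>[of k] u by (simp add: V_vol_nonneg flip: ennreal_mult'')
    also have "?P * (u / \<nu> $ k * (V_vol TYPE('k) \<epsilon> / (?K + \<epsilon>))) = ?W * (u / \<nu> $ k) / (?K + \<epsilon>)"
      by (simp add: W)
    finally show "(\<integral>\<^sup>+x. ennreal (indicator (?Q) x * x $ k powr \<epsilon>) \<partial>lborel) = \<dots>" .
    show "0 \<le> ?W * (u / \<nu> $ k) / (?K + \<epsilon>)" using \<epsilon> \<nu>[of k] u by simp
    have "(\<lambda>x :: real ^ 'k. indicator (?Q) x * x $ k powr \<epsilon>) \<in> borel_measurable borel"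
      by measurable
    then show "(\<lambda>x :: real ^ 'k. indicator (?Q) x * x $ k powr \<epsilon>) \<in> borel_measurable lborel"
      by simp
  qed (simp add: indicator_def)
  then have "has_bochner_integral lborel (\<lambda>x. \<Sum>k\<in>UNIV. \<gamma> $ k * (indicator (?Q) x * x $ k powr \<epsilon>))
      (\<Sum>k\<in>UNIV. \<gamma> $ k * (?W * (u / \<nu> $ k) / (?K + \<epsilon>)))"
    by (intro has_bochner_integral_sum has_bochner_integral_mult_right)
  moreover have "(\<lambda>x. \<Sum>k\<in>UNIV. \<gamma> $ k * (indicator (?Q) x * x $ k powr \<epsilon>))
      = (\<lambda>x. indicator (?Q) x * (\<gamma> \<bullet> vpow x \<epsilon>))"
    by (simp add: fun_eq_iff inner_vpow sum_distrib_left mult_ac)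
  moreover have "(\<Sum>k\<in>UNIV. \<gamma> $ k * (?W * (u / \<nu> $ k) / (?K + \<epsilon>)))
      = ?W * u * (\<Sum>k\<in>UNIV. \<gamma> $ k / \<nu> $ k) / (?K + \<epsilon>)"
    by (simp add: sum_distrib_left sum_divide_distrib mult_ac)
  ultimately show ?thesis by simp
qed

section \<open>The volume function and the rejection regions\<close>

lemma fmeasurable_cube_Int: "A \<in> sets borel \<Longrightarrow> cbox 0 (1 :: real ^ 'k) \<inter> A \<in> fmeasurable lborel"
  by (rule fmeasurable_Int_fmeasurable) (auto simp: fmeasurable_def emeasure_cube)

lemma fmeasurable_cube_Collect:
  assumes [measurable]: "P \<in> measurable borel (count_space UNIV)"
  shows "{x \<in> cbox 0 (1 :: real ^ 'k). P x} \<in> fmeasurable lborel"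
proof -
  have "Collect P \<in> sets borel" using assms by (rule pred_Collect_borel)
  then show ?thesis using fmeasurable_cube_Int[of "Collect P"] by (simp add: Int_def)
qed

lemma sublevel_fmeasurable: "{x \<in> cbox 0 (1 :: real ^ 'k). \<nu> \<bullet> vpow x \<epsilon> \<le> u} \<in> fmeasurable lborel"
  by (rule fmeasurable_cube_Collect) measurable

lemma h_mono: "u \<le> v \<Longrightarrow> h \<epsilon> \<nu> u \<le> h \<epsilon> \<nu> v"
  unfolding h_def by (rule measure_mono_fmeasurable[OF _ fmeasurableD[OF sublevel_fmeasurable] sublevel_fmeasurable]) auto

lemma power_simplex_neg:
  assumes "\<And>k. 0 < \<nu> $ k" "u < 0"
  shows "power_simplex \<epsilon> \<nu> u = {}"
proof -
  have "0 \<le> \<nu> \<bullet> vpow x \<epsilon>" for x using assms(1) by (intro inner_vpow_nonneg less_imp_le)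
  then have "\<not> \<nu> \<bullet> vpow x \<epsilon> \<le> u" for x using assms(2) by (meson not_le less_le_trans)
  then show ?thesis by (simp add: power_simplex_def)
qed

lemma power_simplex_fmeasurable:
  fixes \<nu> :: "real ^ 'k"
  assumes \<epsilon>: "0 < \<epsilon>" and \<nu>: "\<And>k. 0 < \<nu> $ k"
  shows "power_simplex \<epsilon> \<nu> u \<in> fmeasurable lborel"
proof (cases "u < 0")
  case True then show ?thesis using power_simplex_neg[OF \<nu>] by simp
next
  case False
  then show ?thesis using emeasure_power_simplex[OF \<epsilon> \<nu>, of u] by (simp add: fmeasurable_def)
qed

text \<open>A shell of the cube is contained in a shell of the orthant, whose volume is an explicit
  continuous function of its two levels.\<close>

lemma h_diff_le:
  fixes \<nu> :: "real ^ 'k"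
  assumes \<epsilon>: "0 < \<epsilon>" and \<nu>: "\<And>k. 0 < \<nu> $ k" and uv: "u \<le> v"
  shows "h \<epsilon> \<nu> v - h \<epsilon> \<nu> u
    \<le> simplex_const \<epsilon> \<nu> * max 0 v powr (real CARD('k) / \<epsilon>) - simplex_const \<epsilon> \<nu> * max 0 u powr (real CARD('k) / \<epsilon>)"
proof -
  let ?H = "\<lambda>u. {x \<in> cbox 0 (1 :: real ^ 'k). \<nu> \<bullet> vpow x \<epsilon> \<le> u}"
  let ?Q = "\<lambda>u. power_simplex \<epsilon> \<nu> u"
  have H: "?H u \<in> fmeasurable lborel" for u by (rule sublevel_fmeasurable)
  have Q: "?Q u \<in> fmeasurable lborel" for u by (rule power_simplex_fmeasurable[OF \<epsilon> \<nu>])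
  have subH: "?H u \<subseteq> ?H v" and subQ: "?Q u \<subseteq> ?Q v" using uv by (auto simp: power_simplex_def)
  have "h \<epsilon> \<nu> v - h \<epsilon> \<nu> u = measure lborel (?H v - ?H u)"
    unfolding h_def by (rule measurable_measure_Diff[OF H fmeasurableD[OF H] subH, symmetric])
  also have "\<dots> \<le> measure lborel (?Q v - ?Q u)"
    by (rule measure_mono_fmeasurable)
      (auto simp: power_simplex_def[symmetric] intro!: fmeasurable.Diff fmeasurableD sets.Diff H Q, auto simp: power_simplex_def mem_box_cart)
  also have "\<dots> = measure lborel (?Q v) - measure lborel (?Q u)"
    by (rule measurable_measure_Diff[OF Q fmeasurableD[OF Q] subQ])
  finally have le: "h \<epsilon> \<nu> v - h \<epsilon> \<nu> u \<le> measure lborel (?Q v) - measure lborel (?Q u)" .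
  have vol: "measure lborel (?Q u) = simplex_const \<epsilon> \<nu> * max 0 u powr (real CARD('k) / \<epsilon>)" for u
    using measure_power_simplex[OF \<epsilon> \<nu>, of u] power_simplex_neg[OF \<nu>, of u \<epsilon>] by (cases "u < 0") simp_all
  show ?thesis using le unfolding vol .
qed

lemma isCont_h:
  fixes \<nu> :: "real ^ 'k"
  assumes \<epsilon>: "0 < \<epsilon>" and \<nu>: "\<And>k. 0 < \<nu> $ k"
  shows "isCont (h \<epsilon> \<nu>) u"
proof -
  define w where "w = (\<lambda>u. simplex_const \<epsilon> \<nu> * max 0 u powr (real CARD('k) / \<epsilon>))"
  have "isCont w u" unfolding w_def using \<epsilon>
    by (auto simp: isCont_def intro!: tendsto_intros tendsto_powr')
  then have "((\<lambda>v. \<bar>w v - w u\<bar>) \<longlongrightarrow> 0) (at u)"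
    by (simp add: isCont_def LIM_zero tendsto_rabs_zero)
  moreover have "\<bar>h \<epsilon> \<nu> v - h \<epsilon> \<nu> u\<bar> \<le> \<bar>w v - w u\<bar>" for v
  proof -
    have D: "0 \<le> h \<epsilon> \<nu> v - h \<epsilon> \<nu> u \<and> h \<epsilon> \<nu> v - h \<epsilon> \<nu> u \<le> w v - w u" if "u \<le> v" for u v
      using h_diff_le[OF \<epsilon> \<nu> that] h_mono[OF that, of \<epsilon> \<nu>] by (simp add: w_def)
    show ?thesis using D[of u v] D[of v u] by linarith
  qed
  ultimately have "((\<lambda>v. h \<epsilon> \<nu> v - h \<epsilon> \<nu> u) \<longlongrightarrow> 0) (at u)"
    by (elim Lim_null_comparison[rotated]) (simp add: eventuallyI)
  then show ?thesis by (simp add: isCont_def LIM_zero_iff)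
qed

lemma borel_measurable_h [measurable]: "h \<epsilon> \<nu> \<in> borel_measurable borel"
  by (rule borel_measurable_mono) (simp add: monoI h_mono)

lemma h_neg:
  assumes "\<And>k. 0 < \<nu> $ k" "u < 0"
  shows "h \<epsilon> \<nu> u = 0"
proof -
  have "0 \<le> \<nu> \<bullet> vpow x \<epsilon>" for x using assms(1) by (intro inner_vpow_nonneg less_imp_le)
  then have "{x \<in> cbox 0 1. \<nu> \<bullet> vpow x \<epsilon> \<le> u} = {}" using assms(2) by (auto simp: not_le intro: less_le_trans)
  then show ?thesis unfolding h_def by (metis measure_empty)
qed

lemma h_small:
  fixes \<nu> :: "real ^ 'k"
  assumes \<epsilon>: "0 < \<epsilon>" and \<nu>: "\<And>k. 0 < \<nu> $ k" and u: "0 \<le> u" "\<And>k. u \<le> \<nu> $ k"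
  shows "h \<epsilon> \<nu> u = simplex_const \<epsilon> \<nu> * u powr (real CARD('k) / \<epsilon>)"
proof -
  have "{x \<in> cbox 0 1. \<nu> \<bullet> vpow x \<epsilon> \<le> u} = power_simplex \<epsilon> \<nu> u"
    using power_simplex_subset_cube[OF \<epsilon> \<nu> u(2)] by (auto simp: power_simplex_def mem_box_cart)
  then show ?thesis unfolding h_def using measure_power_simplex[OF \<epsilon> \<nu> u(1)] by metis
qed

lemma h_sum:
  fixes \<nu> :: "real ^ 'k"
  assumes \<epsilon>: "0 < \<epsilon>" and \<nu>: "\<And>k. 0 < \<nu> $ k"
  shows "h \<epsilon> \<nu> (\<Sum>k\<in>UNIV. \<nu> $ k) = 1"
proof -
  have "{x \<in> cbox 0 1. \<nu> \<bullet> vpow x \<epsilon> \<le> (\<Sum>k\<in>UNIV. \<nu> $ k)} = cbox 0 1"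
    using inner_vpow_le_sum[OF \<epsilon> \<nu>] by auto
  then show ?thesis unfolding h_def using emeasure_cube[where 'k = 'k] by (simp add: measure_def)
qed

lemma h_le_1:
  fixes \<nu> :: "real ^ 'k"
  shows "h \<epsilon> \<nu> u \<le> 1"
proof -
  have "h \<epsilon> \<nu> u \<le> measure lborel (cbox 0 1 :: (real ^ 'k) set)"
    unfolding h_def
    by (rule measure_mono_fmeasurable)
      (use fmeasurableD[OF sublevel_fmeasurable, of \<nu> \<epsilon> u] in \<open>auto simp: fmeasurable_def emeasure_cube\<close>)
  then show ?thesis using emeasure_cube[where 'k = 'k] by (simp add: measure_def)
qed

text \<open>The probability integral transform for the uniform law on the cube. The function \<open>h \<epsilon> \<nu>\<close> is
  nondecreasing and continuous, so the condition \<open>h \<epsilon> \<nu> u \<le> t\<close> amounts to \<open>u \<le> s\<close> for the largest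
  \<open>s\<close> with \<open>h \<epsilon> \<nu> s = t\<close>.\<close>

lemma measure_h_le:
  fixes \<nu> :: "real ^ 'k"
  assumes \<epsilon>: "0 < \<epsilon>" and \<nu>: "\<And>k. 0 < \<nu> $ k" and t: "0 \<le> t" "t \<le> 1"
  shows "measure lborel {x \<in> cbox 0 1. h \<epsilon> \<nu> (\<nu> \<bullet> vpow x \<epsilon>) \<le> t} = t"
proof (cases "t = 1")
  case True
  then have "{x \<in> cbox 0 1. h \<epsilon> \<nu> (\<nu> \<bullet> vpow x \<epsilon>) \<le> t} = cbox 0 1" using h_le_1[of \<epsilon> \<nu>] by blast
  then show ?thesis using True emeasure_cube[where 'k = 'k] by (simp add: measure_def)
next
  case False
  define S where "S = {u. h \<epsilon> \<nu> u \<le> t}"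
  define s where "s = Sup S"
  have "h \<epsilon> \<nu> (-1) \<le> t" using h_neg[OF \<nu>, of "-1" \<epsilon>] t by simp
  then have ne: "-1 \<in> S" by (simp add: S_def)
  have bdd: "bdd_above S"
  proof (rule bdd_aboveI)
    fix u assume "u \<in> S"
    then have "h \<epsilon> \<nu> u < 1" using False t by (simp add: S_def)
    then have "h \<epsilon> \<nu> u < h \<epsilon> \<nu> (\<Sum>k\<in>UNIV. \<nu> $ k)" unfolding h_sum[OF \<epsilon> \<nu>] .
    then show "u \<le> (\<Sum>k\<in>UNIV. \<nu> $ k)" using h_mono[of "\<Sum>k\<in>UNIV. \<nu> $ k" u \<epsilon> \<nu>] by linarith
  qed
  have cl: "closed S" unfolding S_def
    using isCont_h[OF \<epsilon> \<nu>] by (intro closed_Collect_le continuous_at_imp_continuous_on) simp_all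
  have sS: "s \<in> S" unfolding s_def using closed_contains_Sup[OF _ bdd cl] ne by auto
  have iff: "h \<epsilon> \<nu> u \<le> t \<longleftrightarrow> u \<le> s" for u
  proof
    assume "h \<epsilon> \<nu> u \<le> t" then show "u \<le> s" unfolding s_def using bdd by (intro cSup_upper) (auto simp: S_def)
  next
    assume "u \<le> s" then show "h \<epsilon> \<nu> u \<le> t" using sS h_mono[of u s \<epsilon> \<nu>] by (simp add: S_def)
  qed
  have "t \<le> h \<epsilon> \<nu> s"
  proof (rule tendsto_lowerbound)
    show "(h \<epsilon> \<nu> \<longlongrightarrow> h \<epsilon> \<nu> s) (at_right s)"
      using isCont_h[OF \<epsilon> \<nu>] by (simp add: isCont_def filterlim_at_split)
    show "eventually (\<lambda>u. t \<le> h \<epsilon> \<nu> u) (at_right s)"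
      using eventually_at_right_less[of s]
    proof eventually_elim
      case (elim u)
      then have "\<not> h \<epsilon> \<nu> u \<le> t" unfolding iff by simp
      then show ?case by simp
    qed
  qed simp
  then have "h \<epsilon> \<nu> s = t" using sS by (simp add: S_def)
  then show ?thesis unfolding iff by (simp only: h_def)
qed

definition h_region :: "real \<Rightarrow> real ^ 'k \<Rightarrow> real \<Rightarrow> (real ^ 'k) set" where
  "h_region \<epsilon> \<nu> t = {x \<in> cbox 0 1. h \<epsilon> \<nu> (\<nu> \<bullet> vpow x \<epsilon>) \<le> t}"

lemma h_region_fmeasurable: "h_region \<epsilon> \<nu> t \<in> fmeasurable lborel"
  unfolding h_region_def by (rule fmeasurable_cube_Collect) measurable

lemma h_region_measurable [measurable]: "h_region \<epsilon> \<nu> t \<in> sets borel"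
  using fmeasurableD[OF h_region_fmeasurable] by simp

lemma h_region_mono: "s \<le> t \<Longrightarrow> h_region \<epsilon> \<nu> s \<subseteq> h_region \<epsilon> \<nu> t"
  by (auto simp: h_region_def)

lemma h_region_subset: "h_region \<epsilon> \<nu> t \<subseteq> cbox 0 1"
  by (auto simp: h_region_def)

text \<open>The level at which the simplex has volume \<open>t\<close>.\<close>

definition simplex_level :: "real \<Rightarrow> real ^ 'k \<Rightarrow> real \<Rightarrow> real" where
  "simplex_level \<epsilon> \<nu> t = simplex_const \<epsilon> \<nu> powr (- \<epsilon> / real CARD('k)) * t powr (\<epsilon> / real CARD('k))"

lemma ex_lower_bound_components:
  fixes \<nu> :: "real ^ 'k"
  assumes "\<And>k. 0 < \<nu> $ k"
  obtains m where "0 < m" "\<And>k. m \<le> \<nu> $ k"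
proof
  show "0 < Min (range (($) \<nu>))" using assms by (subst Min_gr_iff) auto
qed (simp add: Min_le)

text \<open>As long as \<open>u\<close> is at most the smallest weight, the simplex of level \<open>u\<close> lies in the cube. There
  \<open>h \<epsilon> \<nu>\<close> is an explicit power, which can be inverted.\<close>

lemma h_region_small:
  fixes \<nu> :: "real ^ 'k"
  assumes \<epsilon>: "0 < \<epsilon>" and \<nu>: "\<And>k. 0 < \<nu> $ k"
  obtains t0 where "0 < t0" "\<And>t. 0 \<le> t \<Longrightarrow> t \<le> t0 \<Longrightarrow> h_region \<epsilon> \<nu> t = power_simplex \<epsilon> \<nu> (simplex_level \<epsilon> \<nu> t)"
proof -
  obtain m where m: "0 < m" "\<And>k. m \<le> \<nu> $ k" using ex_lower_bound_components \<nu> by blast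
  let ?p = "real CARD('k) / \<epsilon>" and ?c = "simplex_const \<epsilon> \<nu>"
  have p: "0 < ?p" using \<epsilon> by simp
  have c: "0 < ?c" by (rule simplex_const_pos[OF \<epsilon> \<nu>])
  have level: "?c * simplex_level \<epsilon> \<nu> t powr ?p = t" if "0 \<le> t" for t
  proof -
    have "simplex_level \<epsilon> \<nu> t powr ?p = ?c powr - 1 * t powr 1"
      unfolding simplex_level_def using \<epsilon> that c by (subst powr_mult) (auto simp: powr_powr)
    then show ?thesis using c that by (simp add: powr_minus)
  qed
  show thesis
  proof
    show "0 < ?c * (m / 2) powr ?p" using c m by simp
    fix t assume t: "0 \<le> t" "t \<le> ?c * (m / 2) powr ?p"
    let ?u = "simplex_level \<epsilon> \<nu> t"
    have u0: "0 \<le> ?u" by (simp add: simplex_level_def)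
    have "?u powr ?p \<le> (m / 2) powr ?p" using t level[OF t(1)] c by (metis mult_le_cancel_left_pos)
    then have "?u \<le> m / 2" using p m u0 powr_less_mono2[OF p, of "m / 2" ?u] by force
    then have um: "?u < m" using m by simp
    have hsmall: "h \<epsilon> \<nu> v = ?c * v powr ?p" if "0 \<le> v" "v \<le> m" for v
      using h_small[OF \<epsilon> \<nu> that(1)] that(2) m(2) order_trans by blast
    have hu: "h \<epsilon> \<nu> ?u = t" using hsmall[OF u0] um level[OF t(1)] by simp
    have iff: "h \<epsilon> \<nu> v \<le> t \<longleftrightarrow> v \<le> ?u" for v
    proof
      assume le: "h \<epsilon> \<nu> v \<le> t"
      show "v \<le> ?u"
      proof (rule ccontr)
        assume "\<not> v \<le> ?u"
        then have "?u < min v m" using um by simp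
        moreover have "h \<epsilon> \<nu> (min v m) \<le> t" using h_mono[of "min v m" v \<epsilon> \<nu>] le by simp
        ultimately have "?c * (min v m) powr ?p \<le> ?c * ?u powr ?p"
          using hsmall[of "min v m"] u0 level[OF t(1)] by simp
        then have "(min v m) powr ?p \<le> ?u powr ?p" using c by (simp only: mult_le_cancel_left_pos)
        then show False using powr_less_mono2[OF p u0 \<open>?u < min v m\<close>] by simp
      qed
    next
      assume "v \<le> ?u" then show "h \<epsilon> \<nu> v \<le> t" using h_mono[of v ?u \<epsilon> \<nu>] hu by simp
    qed
    have "power_simplex \<epsilon> \<nu> ?u \<subseteq> cbox 0 1"
    proof (rule power_simplex_subset_cube[OF \<epsilon> \<nu>])
      show "?u \<le> \<nu> $ k" for k using um m(2)[of k] by linarith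
    qed
    then show "h_region \<epsilon> \<nu> t = power_simplex \<epsilon> \<nu> ?u"
      unfolding h_region_def iff by (auto simp: power_simplex_def mem_box_cart)
  qed
qed

section \<open>Score distribution under the alternative\<close>

text \<open>The distribution function of the scores of false nulls.\<close>

definition alt_cdf :: "(real ^ 'k \<Rightarrow> real) \<Rightarrow> real \<Rightarrow> real ^ 'k \<Rightarrow> real \<Rightarrow> real" where
  "alt_cdf g \<epsilon> \<nu> t = (\<integral>x. indicator (h_region \<epsilon> \<nu> t) x * g x \<partial>lborel)"

lemma integrable_indicator_times_continuous:
  fixes g :: "real ^ 'k \<Rightarrow> real"
  assumes "continuous_on (cbox 0 1) g" and [measurable]: "A \<in> sets borel" and "A \<subseteq> cbox 0 1"
  shows "integrable lborel (\<lambda>x. indicator A x * g x)"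
proof -
  have "integrable lborel (\<lambda>x. indicator (cbox 0 1) x *\<^sub>R g x)"
    by (rule borel_integrable_compact) (use assms in auto)
  then have "integrable lborel (\<lambda>x. indicator A x *\<^sub>R (indicator (cbox 0 1) x *\<^sub>R g x))"
    by (rule integrable_mult_indicator[rotated]) simp
  moreover have "(\<lambda>x. indicator A x *\<^sub>R (indicator (cbox 0 1) x *\<^sub>R g x)) = (\<lambda>x. indicator A x * g x)"
    using assms(3) by (auto simp: indicator_def fun_eq_iff)
  ultimately show ?thesis by simp
qed

lemma standing_assumptionsD:
  assumes "standing_assumptions g \<epsilon> \<gamma> r"
  shows "\<And>x. x \<in> cbox 0 1 \<Longrightarrow> 0 \<le> g x" "(g has_integral 1) (cbox 0 1)" "continuous_on (cbox 0 1) g"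
    "\<And>x. x \<in> cbox 0 1 \<Longrightarrow> x \<noteq> 0 \<Longrightarrow> g x < g 0" "0 < \<epsilon>" "\<And>k. 0 < \<gamma> $ k"
    "\<And>x. x \<in> cbox 0 1 \<Longrightarrow> g x = g 0 * (1 - \<gamma> \<bullet> vpow x \<epsilon> + r x)"
    "r \<in> o[at 0 within cbox 0 1](\<lambda>x. norm x powr \<epsilon>)"
  using assms unfolding standing_assumptions_def by blast+

lemma density_le_max:
  assumes "standing_assumptions g \<epsilon> \<gamma> r" "x \<in> cbox 0 1"
  shows "g x \<le> g 0"
  using standing_assumptionsD(4)[OF assms] by (cases "x = 0") (simp, simp only: less_imp_le not_False_eq_True)

lemma alt_cdf_diff:
  assumes S: "standing_assumptions g \<epsilon> \<gamma> r" and \<nu>: "\<And>k. 0 < \<nu> $ k"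
    and st: "0 \<le> s" "s \<le> t" "t \<le> 1"
  shows "0 \<le> alt_cdf g \<epsilon> \<nu> t - alt_cdf g \<epsilon> \<nu> s" "alt_cdf g \<epsilon> \<nu> t - alt_cdf g \<epsilon> \<nu> s \<le> g 0 * (t - s)"
proof -
  let ?F = "alt_cdf g \<epsilon> \<nu>"
  note \<epsilon> = standing_assumptionsD(5)[OF S] and cont = standing_assumptionsD(3)[OF S]
  let ?D = "h_region \<epsilon> \<nu>"
  have int: "integrable lborel (\<lambda>x. indicator (?D t) x * g x)" for t
    by (intro integrable_indicator_times_continuous cont h_region_subset) simp
  have int1: "integrable lborel (\<lambda>x. indicator (?D t) x * g 0)" for t
    using h_region_fmeasurable[of \<epsilon> \<nu> t] by (auto simp: fmeasurable_def)
  have vol: "(\<integral>x. indicator (?D t) x * g 0 \<partial>lborel) = t * g 0" if "0 \<le> t" "t \<le> 1" for t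
    using measure_h_le[OF \<epsilon> \<nu> that] by (simp add: h_region_def)
  have eq: "?F t - ?F s = (\<integral>x. indicator (?D t) x * g x - indicator (?D s) x * g x \<partial>lborel)"
    unfolding alt_cdf_def using int by simp
  have ineq: "0 \<le> indicator (?D t) x * g x - indicator (?D s) x * g x"
    "indicator (?D t) x * g x - indicator (?D s) x * g x \<le> indicator (?D t) x * g 0 - indicator (?D s) x * g 0" for x
    using h_region_mono[OF st(2), of \<epsilon> \<nu>] density_le_max[OF S, of x] standing_assumptionsD(1)[OF S, of x] h_region_subset[of \<epsilon> \<nu> t]
    by (auto simp: indicator_def)
  show "0 \<le> ?F t - ?F s"
    unfolding eq by (intro integral_nonneg_AE AE_I2 ineq)
  have "?F t - ?F s \<le> (\<integral>x. indicator (?D t) x * g 0 - indicator (?D s) x * g 0 \<partial>lborel)"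
    unfolding eq by (intro integral_mono ineq Bochner_Integration.integrable_diff int int1)
  also have "\<dots> = (\<integral>x. indicator (?D t) x * g 0 \<partial>lborel) - (\<integral>x. indicator (?D s) x * g 0 \<partial>lborel)"
    by (rule Bochner_Integration.integral_diff[OF int1 int1])
  also have "\<dots> = g 0 * (t - s)" unfolding vol[OF order_trans[OF st(1,2)] st(3)] vol[OF st(1) order_trans[OF st(2,3)]] by (simp add: algebra_simps)
  finally show "?F t - ?F s \<le> g 0 * (t - s)" .
qed

lemma alt_cdf_0:
  assumes S: "standing_assumptions g \<epsilon> \<gamma> r" and \<nu>: "\<And>k. 0 < \<nu> $ k"
  shows "alt_cdf g \<epsilon> \<nu> 0 = 0"
proof -
  note \<epsilon> = standing_assumptionsD(5)[OF S]
  have "measure lborel (h_region \<epsilon> \<nu> 0) = 0" using measure_h_le[OF \<epsilon> \<nu>, of 0] by (simp add: h_region_def)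
  then have "emeasure lborel (h_region \<epsilon> \<nu> 0) = 0"
    using h_region_fmeasurable[of \<epsilon> \<nu> 0] by (simp add: emeasure_eq_measure2)
  then have "AE x in lborel. x \<notin> h_region \<epsilon> \<nu> 0" by (intro AE_not_in) (auto simp: null_sets_def)
  then have "AE x in lborel. indicator (h_region \<epsilon> \<nu> 0) x * g x = 0" by eventually_elim (simp add: indicator_def)
  then show ?thesis unfolding alt_cdf_def by (rule integral_eq_zero_AE)
qed

lemma alt_cdf_1:
  assumes S: "standing_assumptions g \<epsilon> \<gamma> r"
  shows "alt_cdf g \<epsilon> \<nu> 1 = 1"
proof -
  have "h_region \<epsilon> \<nu> 1 = cbox 0 1" by (auto simp: h_region_def h_le_1)
  moreover have "set_integrable lborel (cbox 0 1) g"
    using integrable_indicator_times_continuous[OF standing_assumptionsD(3)[OF S], of "cbox 0 1"]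
    by (simp add: set_integrable_def)
  then have "(\<integral>x\<in>cbox 0 1. g x \<partial>lborel) = integral (cbox 0 1) g"
    by (rule set_borel_integral_eq_integral)
  moreover have "integral (cbox 0 1) g = 1" using standing_assumptionsD(2)[OF S] by (rule integral_unique)
  ultimately show ?thesis by (simp add: alt_cdf_def set_lebesgue_integral_def)
qed

text \<open>On the cube \<open>norm x powr \<epsilon>\<close> is bounded by a multiple of \<open>\<nu> \<bullet> vpow x \<epsilon>\<close>, so the remainder of the
  expansion is small relative to \<open>\<nu> \<bullet> vpow x \<epsilon>\<close>, and \<open>x\<close> is small when \<open>\<nu> \<bullet> vpow x \<epsilon>\<close> is.\<close>

lemma density_expansion:
  fixes \<nu> :: "real ^ 'k"
  assumes S: "standing_assumptions g \<epsilon> \<gamma> r" and \<nu>: "\<And>k. 0 < \<nu> $ k" and \<eta>: "0 < \<eta>"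
  obtains \<delta> where "0 < \<delta>"
    "\<And>x. x \<in> cbox 0 1 \<Longrightarrow> \<nu> \<bullet> vpow x \<epsilon> \<le> \<delta> \<Longrightarrow> \<bar>g x - g 0 * (1 - \<gamma> \<bullet> vpow x \<epsilon>)\<bar> \<le> \<eta> * (\<nu> \<bullet> vpow x \<epsilon>)"
proof -
  let ?p = "\<lambda>x. \<nu> \<bullet> vpow x \<epsilon>"
  note \<epsilon> = standing_assumptionsD(5)[OF S]
  obtain m where m: "0 < m" "\<And>k. m \<le> \<nu> $ k" using ex_lower_bound_components \<nu> by blast
  let ?K = "real CARD('k)"
  have g0: "0 \<le> g 0" using standing_assumptionsD(1)[OF S, of 0] by (simp add: mem_box_cart)
  \<comment> \<open>\<open>g 0 + 1\<close> in place of \<open>g 0\<close> only keeps the denominator positive.\<close>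
  define c where "c = \<eta> * m / ((g 0 + 1) * ?K powr \<epsilon>)"
  have c: "0 < c" using \<eta> m g0 by (simp add: c_def)
  have "eventually (\<lambda>x. norm (r x) \<le> c * norm (norm x powr \<epsilon>)) (at 0 within cbox 0 1)"
    using standing_assumptionsD(8)[OF S] c by (rule landau_o.smallD)
  then obtain d where d: "0 < d" "\<And>x. x \<in> cbox 0 1 \<Longrightarrow> x \<noteq> 0 \<Longrightarrow> dist x 0 < d \<Longrightarrow> norm (r x) \<le> c * norm (norm x powr \<epsilon>)"
    unfolding eventually_at by blast
  have norm_le: "norm x powr \<epsilon> \<le> ?K powr \<epsilon> * ((?p x) / m)" if x: "x \<in> cbox 0 1" for x
  proof -
    let ?s = "(?p x) / m"
    have s0: "0 \<le> ?s" using m \<nu> by (intro divide_nonneg_pos inner_vpow_nonneg less_imp_le)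
    have root: "(?s powr (1 / \<epsilon>)) powr \<epsilon> = ?s"
      unfolding powr_powr using \<epsilon> powr_one[OF s0] by simp
    have "\<bar>x $ k\<bar> \<le> ?s powr (1 / \<epsilon>)" for k
    proof -
      have xk: "0 \<le> x $ k" using x by (simp add: mem_box_cart)
      have "m * x $ k powr \<epsilon> \<le> \<nu> $ k * x $ k powr \<epsilon>" using m(2) by (intro mult_right_mono) auto
      also have "\<dots> \<le> ?p x" using \<nu> by (intro component_le_inner_vpow less_imp_le)
      finally have "x $ k powr \<epsilon> \<le> ?s" using m(1) by (simp add: pos_le_divide_eq mult.commute)
      then have "(x $ k powr \<epsilon>) powr (1 / \<epsilon>) \<le> ?s powr (1 / \<epsilon>)" using \<epsilon> by (intro powr_mono2) auto
      then show ?thesis using xk \<epsilon> by (simp add: powr_powr)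
    qed
    then have "(\<Sum>k\<in>UNIV. \<bar>x $ k\<bar>) \<le> ?K * ?s powr (1 / \<epsilon>)"
      using sum_bounded_above[of UNIV "\<lambda>k. \<bar>x $ k\<bar>"] by simp
    then have "norm x \<le> ?K * ?s powr (1 / \<epsilon>)" using norm_le_l1_cart[of x] by linarith
    then have "norm x powr \<epsilon> \<le> (?K * ?s powr (1 / \<epsilon>)) powr \<epsilon>" using \<epsilon> by (intro powr_mono2) auto
    also have "\<dots> = ?K powr \<epsilon> * (?s powr (1 / \<epsilon>)) powr \<epsilon>" by (simp add: powr_mult)
    also have "\<dots> = ?K powr \<epsilon> * ?s" by (simp only: root)
    finally show ?thesis .
  qed
  define \<delta> where "\<delta> = m * (d / 2) powr \<epsilon> / ?K powr \<epsilon>"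
  show thesis
  proof
    show "0 < \<delta>" using m d by (simp add: \<delta>_def)
    fix x assume x: "x \<in> cbox 0 1" "?p x \<le> \<delta>"
    show "\<bar>g x - g 0 * (1 - \<gamma> \<bullet> vpow x \<epsilon>)\<bar> \<le> \<eta> * (?p x)"
    proof (cases "x = 0")
      case True then show ?thesis by (simp add: inner_vpow)
    next
      case False
      have "norm x powr \<epsilon> \<le> ?K powr \<epsilon> * (\<delta> / m)"
        using norm_le[OF x(1)] x(2) m(1) by (smt (verit) divide_right_mono mult_left_mono powr_ge_zero)
      also have "\<dots> = (d / 2) powr \<epsilon>" using m by (simp add: \<delta>_def)
      finally have "norm x \<le> d / 2" using \<epsilon> d(1) powr_less_mono2[of \<epsilon> "d / 2" "norm x"] by force
      then have "\<bar>r x\<bar> \<le> c * norm x powr \<epsilon>" using d(2)[OF x(1) False] d(1) by simp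
      also have "\<dots> \<le> c * (?K powr \<epsilon> * ((?p x) / m))"
        using norm_le[OF x(1)] c by (intro mult_left_mono) auto
      also have "\<dots> = \<eta> * (?p x) / (g 0 + 1)" using m by (simp add: c_def)
      finally have "g 0 * \<bar>r x\<bar> \<le> g 0 * (\<eta> * (?p x) / (g 0 + 1))" using g0 by (rule mult_left_mono)
      also have "\<dots> = g 0 / (g 0 + 1) * (\<eta> * (?p x))" by simp
      also have "\<dots> \<le> 1 * (\<eta> * (?p x))"
        using g0 \<eta> \<nu> by (intro mult_right_mono mult_nonneg_nonneg inner_vpow_nonneg less_imp_le) auto
      finally have "g 0 * \<bar>r x\<bar> \<le> \<eta> * (?p x)" by simp
      moreover have "\<bar>g x - g 0 * (1 - \<gamma> \<bullet> vpow x \<epsilon>)\<bar> = g 0 * \<bar>r x\<bar>"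
        using g0 unfolding standing_assumptionsD(7)[OF S x(1)] by (simp add: algebra_simps abs_mult)
      ultimately show ?thesis by simp
    qed
  qed
qed

text \<open>The constant \<open>L\<close> for which the mean of \<open>g\<close> over the region of volume \<open>t\<close> is
  \<open>g 0 * (1 - L * t powr (\<epsilon> / K))\<close> to first order.\<close>

definition loss_const :: "real \<Rightarrow> real ^ 'k \<Rightarrow> real ^ 'k \<Rightarrow> real" where
  "loss_const \<epsilon> \<gamma> \<nu> = simplex_const \<epsilon> \<nu> powr (- \<epsilon> / real CARD('k)) * (\<Sum>k\<in>UNIV. \<gamma> $ k / \<nu> $ k) / (real CARD('k) + \<epsilon>)"

text \<open>An expansion of \<open>alt_cdf\<close> at \<open>0\<close> alone would not control how its mean value varies between two
  nearby points. Here the error is proportional to \<open>t - s\<close>: the expansion of \<open>g\<close> is integrated over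
  the shell between the regions of volumes \<open>s\<close> and \<open>t\<close>, on which \<open>\<nu> \<bullet> vpow x \<epsilon>\<close> is at most the level
  belonging to \<open>t\<close>.\<close>

lemma alt_cdf_increment:
  fixes \<nu> :: "real ^ 'k"
  assumes S: "standing_assumptions g \<epsilon> \<gamma> r" and \<nu>: "\<And>k. 0 < \<nu> $ k" and \<eta>: "0 < \<eta>"
  defines "\<beta> \<equiv> \<epsilon> / real CARD('k)"
  obtains t0 where "0 < t0" "t0 \<le> 1"
    "\<And>s t. 0 \<le> s \<Longrightarrow> s \<le> t \<Longrightarrow> t \<le> t0 \<Longrightarrow>
      \<bar>alt_cdf g \<epsilon> \<nu> t - alt_cdf g \<epsilon> \<nu> s
        - g 0 * ((t - s) - loss_const \<epsilon> \<gamma> \<nu> * (t powr (1 + \<beta>) - s powr (1 + \<beta>)))\<bar> \<le> \<eta> * t powr \<beta> * (t - s)"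
proof -
  let ?L = "loss_const \<epsilon> \<gamma> \<nu>"
  let ?F = "alt_cdf g \<epsilon> \<nu>"
  note \<epsilon> = standing_assumptionsD(5)[OF S] and cont = standing_assumptionsD(3)[OF S]
  let ?K = "real CARD('k)" and ?D = "h_region \<epsilon> \<nu>"
  define \<kappa> where "\<kappa> = simplex_const \<epsilon> \<nu> powr (- \<epsilon> / ?K)"
  have \<kappa>: "0 < \<kappa>" using simplex_const_pos[OF \<epsilon> \<nu>] by (simp add: \<kappa>_def)
  have \<beta>: "0 < \<beta>" using \<epsilon> by (simp add: \<beta>_def)
  have level: "simplex_level \<epsilon> \<nu> t = \<kappa> * t powr \<beta>" for t by (simp add: simplex_level_def \<kappa>_def \<beta>_def)
  obtain \<delta> where \<delta>: "0 < \<delta>" "\<And>x. x \<in> cbox 0 1 \<Longrightarrow> \<nu> \<bullet> vpow x \<epsilon> \<le> \<delta> \<Longrightarrow>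
      \<bar>g x - g 0 * (1 - \<gamma> \<bullet> vpow x \<epsilon>)\<bar> \<le> \<eta> / \<kappa> * (\<nu> \<bullet> vpow x \<epsilon>)"
    using density_expansion[OF S \<nu>, of "\<eta> / \<kappa>"] \<eta> \<kappa> by auto
  obtain t1 where t1: "0 < t1" "\<And>t. 0 \<le> t \<Longrightarrow> t \<le> t1 \<Longrightarrow> ?D t = power_simplex \<epsilon> \<nu> (simplex_level \<epsilon> \<nu> t)"
    using h_region_small[OF \<epsilon> \<nu>] by blast
  \<comment> \<open>The last term ensures that the level \<open>\<kappa> * t powr \<beta>\<close> is at most \<open>\<delta>\<close>.\<close>
  define t0 where "t0 = min (min 1 t1) ((\<delta> / \<kappa>) powr (1 / \<beta>))"
  show thesis
  proof
    show "0 < t0" using t1 \<delta> \<kappa> by (simp add: t0_def)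
    show "t0 \<le> 1" by (simp add: t0_def)
    fix s t assume st: "0 \<le> s" "s \<le> t" "t \<le> t0"
    have tt1: "t \<le> t1" "t \<le> 1" "s \<le> t1" "s \<le> 1" "0 \<le> t" using st by (auto simp: t0_def)
    have "t powr \<beta> \<le> ((\<delta> / \<kappa>) powr (1 / \<beta>)) powr \<beta>" using st \<beta> by (intro powr_mono2) (auto simp: t0_def)
    then have "t powr \<beta> \<le> \<delta> / \<kappa>" using \<beta> \<delta> \<kappa> by (simp add: powr_powr)
    then have u\<delta>: "\<kappa> * t powr \<beta> \<le> \<delta>" using \<kappa> by (simp add: pos_le_divide_eq mult.commute)
    have vol: "measure lborel (?D q) = q" if "0 \<le> q" "q \<le> t1" "q \<le> 1" for q
      using measure_h_le[OF \<epsilon> \<nu> that(1,3)] by (simp add: h_region_def)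
    have indic: "has_bochner_integral lborel (indicator (?D q)) q" if "0 \<le> q" "q \<le> t1" "q \<le> 1" for q
      using has_bochner_integral_real_indicator[of "?D q" lborel] h_region_fmeasurable[of \<epsilon> \<nu> q] vol[OF that]
      by (simp add: fmeasurable_def)
    define f where "f = (\<lambda>q x. indicator (?D q) x * (g x - g 0 * (1 - \<gamma> \<bullet> vpow x \<epsilon>)))"
    have I: "has_bochner_integral lborel (f q) (?F q - g 0 * (q - ?L * q powr (1 + \<beta>)))"
      if q: "0 \<le> q" "q \<le> t1" "q \<le> 1" for q
    proof -
      have "has_bochner_integral lborel (\<lambda>x. indicator (?D q) x * g x) (?F q)"
        unfolding alt_cdf_def
        by (intro has_bochner_integral_integrable integrable_indicator_times_continuous cont h_region_subset) simp
      moreover note indic[OF q]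
      moreover have "has_bochner_integral lborel (\<lambda>x. indicator (?D q) x * (\<gamma> \<bullet> vpow x \<epsilon>))
          (?L * q powr (1 + \<beta>))"
      proof -
        have "q * (\<kappa> * q powr \<beta>) * (\<Sum>k\<in>UNIV. \<gamma> $ k / \<nu> $ k) / (?K + \<epsilon>) = ?L * q powr (1 + \<beta>)"
          using q(1) by (simp add: loss_const_def \<kappa>_def powr_add)
        moreover have "0 \<le> \<kappa> * q powr \<beta>" using \<kappa> by simp
        ultimately show ?thesis
          using has_bochner_integral_power_simplex[OF \<epsilon> \<nu>, of "\<kappa> * q powr \<beta>" \<gamma>] vol[OF q]
          unfolding t1(2)[OF q(1,2)] level by simp
      qed
      ultimately have "has_bochner_integral lborel (\<lambda>x. indicator (?D q) x * g x -
          g 0 * (indicator (?D q) x - indicator (?D q) x * (\<gamma> \<bullet> vpow x \<epsilon>)))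
          (?F q - g 0 * (q - ?L * q powr (1 + \<beta>)))"
        by (intro has_bochner_integral_diff has_bochner_integral_mult_right)
      moreover have "(\<lambda>x. indicator (?D q) x * g x -
          g 0 * (indicator (?D q) x - indicator (?D q) x * (\<gamma> \<bullet> vpow x \<epsilon>))) = f q"
        by (simp add: f_def fun_eq_iff algebra_simps)
      ultimately show ?thesis by simp
    qed
    have It: "has_bochner_integral lborel (f t) (?F t - g 0 * (t - ?L * t powr (1 + \<beta>)))"
      and Is: "has_bochner_integral lborel (f s) (?F s - g 0 * (s - ?L * s powr (1 + \<beta>)))"
      using st tt1 by (auto intro: I)
    have ft: "integrable lborel (f t)" and fs: "integrable lborel (f s)"
      using It Is by (simp_all only: has_bochner_integral_iff)
    have Ind: "has_bochner_integral lborel (\<lambda>x. \<eta> * t powr \<beta> * (indicator (?D t) x - indicator (?D s) x)) (\<eta> * t powr \<beta> * (t - s))"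
      using st tt1 by (intro has_bochner_integral_mult_right has_bochner_integral_diff indic) auto
    have bound: "\<bar>f t x - f s x\<bar> \<le> \<eta> * t powr \<beta> * (indicator (?D t) x - indicator (?D s) x)" for x
    proof (cases "x \<in> ?D t - ?D s")
      case True
      then have x: "x \<in> cbox 0 1" "\<nu> \<bullet> vpow x \<epsilon> \<le> \<kappa> * t powr \<beta>"
        using t1(2)[OF tt1(5,1)] h_region_subset[of \<epsilon> \<nu> t] by (auto simp: level power_simplex_def)
      have "\<bar>g x - g 0 * (1 - \<gamma> \<bullet> vpow x \<epsilon>)\<bar> \<le> \<eta> / \<kappa> * (\<nu> \<bullet> vpow x \<epsilon>)" using x u\<delta> by (intro \<delta>(2)) auto
      also have "\<dots> \<le> \<eta> / \<kappa> * (\<kappa> * t powr \<beta>)" using x(2) \<eta> \<kappa> by (intro mult_left_mono) auto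
      also have "\<dots> = \<eta> * t powr \<beta>" using \<kappa> by simp
      finally show ?thesis using True by (simp add: f_def)
    next
      case False
      then have "x \<in> ?D t \<longleftrightarrow> x \<in> ?D s" using h_region_mono[OF st(2), of \<epsilon> \<nu>] by blast
      then show ?thesis by (simp add: f_def indicator_def)
    qed
    have "\<bar>\<integral>x. f t x - f s x \<partial>lborel\<bar> \<le> (\<integral>x. \<bar>f t x - f s x\<bar> \<partial>lborel)" by (rule integral_abs_bound)
    also have "\<dots> \<le> (\<integral>x. \<eta> * t powr \<beta> * (indicator (?D t) x - indicator (?D s) x) \<partial>lborel)"
      using Ind ft fs by (intro integral_mono bound) (auto simp: has_bochner_integral_iff simp del: integrable_mult_right_iff)
    also have "\<dots> = \<eta> * t powr \<beta> * (t - s)" using Ind by (rule has_bochner_integral_integral_eq)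
    finally show "\<bar>?F t - ?F s
        - g 0 * ((t - s) - ?L * (t powr (1 + \<beta>) - s powr (1 + \<beta>)))\<bar> \<le> \<eta> * t powr \<beta> * (t - s)"
      using has_bochner_integral_integral_eq[OF has_bochner_integral_diff[OF It Is]] by (simp add: algebra_simps)
  qed
qed

section \<open>Crossing the rejection line near the critical level\<close>

text \<open>With \<open>x = s / t\<close> this is \<open>x powr \<beta> \<le> x\<close> when \<open>\<beta> \<ge> 1\<close>, and concavity of \<open>x powr \<beta>\<close> (Young's
  inequality) when \<open>\<beta> < 1\<close>.\<close>

lemma powr_diff_lower:
  fixes s t \<beta> :: real
  assumes st: "0 < s" "s < t" and \<beta>: "0 < \<beta>"
  shows "min 1 \<beta> * (t powr \<beta> * ((t - s) / t)) \<le> t powr \<beta> - s powr \<beta>"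
proof -
  define x where "x = s / t"
  have x: "0 < x" "x < 1" using st by (auto simp: x_def)
  have "x powr \<beta> \<le> 1 - min 1 \<beta> * (1 - x)"
  proof (cases "1 \<le> \<beta>")
    case True
    then have "x powr \<beta> \<le> x powr 1" using x by (intro powr_mono') auto
    then show ?thesis using True x by simp
  next
    case False
    have "x powr \<beta> * 1 powr (1 - \<beta>) \<le> \<beta> * x + (1 - \<beta>) * 1"
      using False \<beta> x by (intro Youngs_inequality_0) auto
    then show ?thesis using False by (simp add: algebra_simps)
  qed
  then have "min 1 \<beta> * (1 - x) \<le> 1 - x powr \<beta>" by simp
  then have "t powr \<beta> * (min 1 \<beta> * (1 - x)) \<le> t powr \<beta> * (1 - x powr \<beta>)" by (rule mult_left_mono) simp
  moreover have "t powr \<beta> * x powr \<beta> = s powr \<beta>" using st by (simp add: x_def powr_divide)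
  moreover have "1 - x = (t - s) / t" using st by (simp add: x_def diff_divide_distrib)
  ultimately show ?thesis by (simp add: algebra_simps)
qed

text \<open>The strict inequalities on both sides of \<open>\<tau>\<close> exclude that \<open>F\<close> only touches the line of slope
  \<open>1 / \<alpha>\<close>, or meets it again later. They are what makes the empirical crossing point converge.\<close>

definition crosses_at :: "(real \<Rightarrow> real) \<Rightarrow> real \<Rightarrow> real \<Rightarrow> bool" where
  "crosses_at F \<alpha> \<tau> \<longleftrightarrow> 0 < \<tau> \<and> \<tau> < 1 \<and> F \<tau> = \<tau> / \<alpha> \<and>
     (\<forall>t. 0 < t \<longrightarrow> t < \<tau> \<longrightarrow> t / \<alpha> < F t) \<and> (\<forall>t. \<tau> < t \<longrightarrow> t \<le> 1 \<longrightarrow> F t < t / \<alpha>)"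

text \<open>What is needed of \<open>alt_cdf\<close> to locate the crossing: its density is at most \<open>g0\<close>, and it loses
  \<open>g0 * L * t powr (1 + \<beta>)\<close> against the line \<open>g0 * t\<close> near the origin, with control of increments.\<close>

locale concentrated_cdf =
  fixes F1 :: "real \<Rightarrow> real" and g0 L \<beta> :: real
  assumes L: "0 < L" and \<beta>: "0 < \<beta>"
    and F1_0: "F1 0 = 0" and F1_1: "F1 1 = 1"
    and F1_mono: "\<And>s t. 0 \<le> s \<Longrightarrow> s \<le> t \<Longrightarrow> t \<le> 1 \<Longrightarrow> 0 \<le> F1 t - F1 s"
    and F1_lipschitz: "\<And>s t. 0 \<le> s \<Longrightarrow> s \<le> t \<Longrightarrow> t \<le> 1 \<Longrightarrow> F1 t - F1 s \<le> g0 * (t - s)"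
    and increment: "\<And>\<eta>. 0 < \<eta> \<Longrightarrow> \<exists>t0. 0 < t0 \<and> t0 \<le> 1 \<and> (\<forall>s t. 0 \<le> s \<longrightarrow> s \<le> t \<longrightarrow> t \<le> t0 \<longrightarrow>
      \<bar>F1 t - F1 s - g0 * ((t - s) - L * (t powr (1 + \<beta>) - s powr (1 + \<beta>)))\<bar> \<le> \<eta> * t powr \<beta> * (t - s))"
begin

text \<open>How far the mean density over the region of volume \<open>t\<close> stays below its maximum. The equation
  \<open>(1 - a) * t + a * F1 t = t / \<alpha>\<close> prescribes the value of \<open>deficit t\<close>.\<close>

definition deficit :: "real \<Rightarrow> real" where
  "deficit t = g0 - F1 t / t"

lemma g0_pos: "0 < g0"
  using F1_lipschitz[of 0 1] F1_0 F1_1 by simp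

text \<open>The main term \<open>g0 * L * t powr \<beta>\<close> increases by at least a fixed multiple of
  \<open>t powr \<beta> * (t - s) / t\<close>, and the increment estimate bounds the change of the error term by a smaller
  multiple of the same quantity.\<close>

lemma deficit_strict_mono:
  obtains t0 where "0 < t0" "t0 \<le> 1" "\<And>s t. 0 < s \<Longrightarrow> s < t \<Longrightarrow> t \<le> t0 \<Longrightarrow> deficit s < deficit t"
proof -
  define \<mu> where "\<mu> = min 1 \<beta>"
  have \<mu>: "0 < \<mu>" using \<beta> by (simp add: \<mu>_def)
  \<comment> \<open>The error will enter twice, so a quarter of the main coefficient leaves a strict inequality.\<close>
  define \<eta> where "\<eta> = g0 * L * \<mu> / 4"
  have \<eta>: "0 < \<eta>" using g0_pos L \<mu> by (simp add: \<eta>_def)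
  obtain t0 where t0: "0 < t0" "t0 \<le> 1" and inc: "\<And>s t. 0 \<le> s \<Longrightarrow> s \<le> t \<Longrightarrow> t \<le> t0 \<Longrightarrow>
      \<bar>F1 t - F1 s - g0 * ((t - s) - L * (t powr (1 + \<beta>) - s powr (1 + \<beta>)))\<bar> \<le> \<eta> * t powr \<beta> * (t - s)"
    using increment[OF \<eta>] by blast
  show thesis
  proof
    fix s t :: real assume st: "0 < s" "s < t" "t \<le> t0"
    define E where "E = (\<lambda>t. F1 t - g0 * (t - L * t powr (1 + \<beta>)))"
    have E1: "E t - E s \<le> \<eta> * t powr \<beta> * (t - s)"
      using inc[of s t] st by (simp add: E_def algebra_simps abs_le_iff)
    have E2: "- E s \<le> \<eta> * s powr \<beta> * s"
      using inc[of 0 s] st F1_0 \<beta> by (simp add: E_def algebra_simps abs_le_iff)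
    have quot: "F1 x / x = g0 - g0 * L * x powr \<beta> + E x / x" if "0 < x" for x
      using that by (simp add: E_def powr_add field_simps)
    have "(E t - E s) / t \<le> \<eta> * t powr \<beta> * (t - s) / t"
      using E1 st by (intro divide_right_mono) auto
    then have A: "(E t - E s) / t \<le> \<eta> * (t powr \<beta> * ((t - s) / t))" by simp
    have "- E s / s \<le> \<eta> * s powr \<beta>" unfolding pos_divide_le_eq[OF st(1)] by (rule E2)
    also have "\<dots> \<le> \<eta> * t powr \<beta>" using \<eta> st \<beta> by (intro mult_left_mono powr_mono2) auto
    finally have "- E s / s * ((t - s) / t) \<le> \<eta> * t powr \<beta> * ((t - s) / t)"
      using st by (intro mult_right_mono) auto
    then have B: "- E s / s * ((t - s) / t) \<le> \<eta> * (t powr \<beta> * ((t - s) / t))" by simp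
    have "E t / t - E s / s = (E t - E s) / t + (- E s / s * ((t - s) / t))"
      using st by (simp add: field_simps)
    then have "E t / t - E s / s \<le> 2 * \<eta> * (t powr \<beta> * ((t - s) / t))" using A B by simp
    moreover have "2 * \<eta> * (t powr \<beta> * ((t - s) / t)) < 4 * \<eta> * (t powr \<beta> * ((t - s) / t))"
      using \<eta> st by (intro mult_strict_right_mono) auto
    moreover have "4 * \<eta> * (t powr \<beta> * ((t - s) / t)) \<le> g0 * L * (t powr \<beta> - s powr \<beta>)"
    proof -
      have "g0 * L * (\<mu> * (t powr \<beta> * ((t - s) / t))) \<le> g0 * L * (t powr \<beta> - s powr \<beta>)"
        unfolding \<mu>_def using g0_pos L by (intro mult_left_mono powr_diff_lower st \<beta>) auto
      then show ?thesis by (simp add: \<eta>_def mult_ac)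
    qed
    ultimately show "deficit s < deficit t"
      unfolding deficit_def using quot[of s] quot[of t] st by (simp add: algebra_simps)
  qed (use t0 in auto)
qed

lemma deficit_nonneg: "0 < t \<Longrightarrow> t \<le> 1 \<Longrightarrow> 0 \<le> deficit t"
  using F1_lipschitz[of 0 t] F1_0 by (simp add: deficit_def pos_divide_le_eq)

text \<open>The gap between \<open>g0 * s\<close> and \<open>F1 s\<close> is positive at a small \<open>s\<close>, and it cannot shrink afterwards
  because \<open>F1\<close> grows at most at rate \<open>g0\<close>.\<close>

lemma deficit_gap:
  assumes "0 < \<delta>" "\<delta> \<le> 1"
  obtains d where "0 < d" "\<And>t. \<delta> \<le> t \<Longrightarrow> t \<le> 1 \<Longrightarrow> d \<le> deficit t"
proof -
  obtain t0 where t0: "0 < t0" "t0 \<le> 1" "\<And>s t. 0 < s \<Longrightarrow> s < t \<Longrightarrow> t \<le> t0 \<Longrightarrow> deficit s < deficit t"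
    using deficit_strict_mono by blast
  define s where "s = min \<delta> t0"
  have s: "0 < s" "s \<le> 1" "s \<le> \<delta>" "s \<le> t0" using assms t0 by (auto simp: s_def)
  have "0 < deficit s" using t0(3)[of "s / 2" s] deficit_nonneg[of "s / 2"] s by simp
  then have d: "0 < g0 * s - F1 s" using s by (simp add: deficit_def pos_divide_less_eq)
  show thesis
  proof
    show "0 < g0 * s - F1 s" by fact
    fix t assume t: "\<delta> \<le> t" "t \<le> 1"
    then have tpos: "0 < t" using assms by simp
    have "F1 t - F1 s \<le> g0 * (t - s)" using s t by (intro F1_lipschitz) auto
    then have "(g0 * s - F1 s) * 1 \<le> g0 * t - F1 t" by (simp add: algebra_simps)
    moreover have "(g0 * s - F1 s) * t \<le> (g0 * s - F1 s) * 1" using d t by (intro mult_left_mono) auto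
    ultimately have "(g0 * s - F1 s) * t \<le> g0 * t - F1 t" by linarith
    then have "g0 * s - F1 s \<le> (g0 * t - F1 t) / t" using tpos by (simp add: pos_le_divide_eq)
    also have "(g0 * t - F1 t) / t = deficit t" using tpos by (simp add: deficit_def diff_divide_distrib)
    finally show "g0 * s - F1 s \<le> deficit t" .
  qed
qed

lemma g0_gt_1: "1 < g0"
proof -
  obtain d where "0 < d" "\<And>t. 1 \<le> t \<Longrightarrow> t \<le> 1 \<Longrightarrow> d \<le> deficit t" using deficit_gap[of 1] by auto
  from this(1) this(2)[of 1] show ?thesis by (simp add: deficit_def F1_1)
qed

lemma continuous_F1: "continuous_on {0..1} F1"
proof (rule lipschitz_on_continuous_on)
  show "g0-lipschitz_on {0..1} F1"
  proof (rule lipschitz_onI)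
    fix x y :: real assume xy: "x \<in> {0..1}" "y \<in> {0..1}"
    show "dist (F1 x) (F1 y) \<le> g0 * dist x y"
      using F1_mono[of x y] F1_lipschitz[of x y] F1_mono[of y x] F1_lipschitz[of y x] xy
      by (cases "x \<le> y") (auto simp: dist_real_def abs_real_def algebra_simps)
  qed (use g0_pos in simp)
qed

lemma deficit_asymptotics: "((\<lambda>t. deficit t / t powr \<beta>) \<longlongrightarrow> g0 * L) (at_right 0)"
proof (rule tendstoI)
  fix e :: real assume e: "0 < e"
  obtain t0 where t0: "0 < t0" "t0 \<le> 1" and inc: "\<And>s t. 0 \<le> s \<Longrightarrow> s \<le> t \<Longrightarrow> t \<le> t0 \<Longrightarrow>
      \<bar>F1 t - F1 s - g0 * ((t - s) - L * (t powr (1 + \<beta>) - s powr (1 + \<beta>)))\<bar> \<le> e / 2 * t powr \<beta> * (t - s)"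
    using increment[of "e / 2"] e by auto
  have "eventually (\<lambda>t. t \<in> {0<..<t0}) (at_right 0)" using t0(1) by (rule eventually_at_right_real)
  then show "eventually (\<lambda>t. dist (deficit t / t powr \<beta>) (g0 * L) < e) (at_right 0)"
  proof eventually_elim
    case (elim t)
    then have t: "0 < t" "t \<le> t0" by auto
    define E where "E = F1 t - g0 * (t - L * t powr (1 + \<beta>))"
    have "\<bar>E\<bar> \<le> e / 2 * (t powr \<beta> * t)" using inc[of 0 t] t F1_0 \<beta> by (simp add: E_def)
    then have "\<bar>E\<bar> / (t powr \<beta> * t) \<le> e / 2" using t by (simp add: pos_divide_le_eq)
    then have "\<bar>E / (t powr \<beta> * t)\<bar> \<le> e / 2" using t by (simp add: abs_mult)
    moreover have eq: "deficit t / t powr \<beta> - g0 * L = - (E / (t powr \<beta> * t))"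
      using t by (simp add: deficit_def E_def powr_add field_simps)
    ultimately show ?case unfolding dist_real_def eq abs_minus_cancel using e by linarith
  qed
qed

lemma deficit_tendsto_0: "(deficit \<longlongrightarrow> 0) (at_right 0)"
proof -
  have "((\<lambda>t. deficit t / t powr \<beta> * t powr \<beta>) \<longlongrightarrow> g0 * L * 0) (at_right 0)"
    by (intro tendsto_mult deficit_asymptotics tendsto_zero_powrI[where b = \<beta>] tendsto_ident_at)
      (auto simp: \<beta> eventually_at_filter)
  then have "((\<lambda>t. deficit t / t powr \<beta> * t powr \<beta>) \<longlongrightarrow> 0) (at_right 0)" by simp
  then show ?thesis
    by (rule Lim_transform_eventually) (auto simp: eventually_at_filter)
qed

text \<open>For values \<open>y\<close> below the gap on \<open>[t0, 1]\<close>, only \<open>(0, t0)\<close> matters, where \<open>deficit\<close> is strictly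
  increasing and continuous.\<close>

lemma deficit_crossing:
  obtains y1 T where "0 < y1"
    "\<And>y. 0 < y \<Longrightarrow> y < y1 \<Longrightarrow> 0 < T y \<and> T y < 1 \<and> deficit (T y) = y \<and>
      (\<forall>t. 0 < t \<longrightarrow> t < T y \<longrightarrow> deficit t < y) \<and> (\<forall>t. T y < t \<longrightarrow> t \<le> 1 \<longrightarrow> y < deficit t)"
    "(T \<longlongrightarrow> 0) (at_right 0)"
proof -
  obtain t0 where t0: "0 < t0" "t0 \<le> 1" "\<And>s t. 0 < s \<Longrightarrow> s < t \<Longrightarrow> t \<le> t0 \<Longrightarrow> deficit s < deficit t"
    using deficit_strict_mono by blast
  obtain d where d: "0 < d" "\<And>t. t0 \<le> t \<Longrightarrow> t \<le> 1 \<Longrightarrow> d \<le> deficit t"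
    using deficit_gap[OF t0(1,2)] by blast
  define P where "P = (\<lambda>y \<tau>. 0 < \<tau> \<and> \<tau> < 1 \<and> deficit \<tau> = y \<and>
      (\<forall>t. 0 < t \<longrightarrow> t < \<tau> \<longrightarrow> deficit t < y) \<and> (\<forall>t. \<tau> < t \<longrightarrow> t \<le> 1 \<longrightarrow> y < deficit t))"
  have ex: "\<exists>\<tau>. P y \<tau>" if y: "0 < y" "y < d" for y
  proof -
    have "eventually (\<lambda>s. deficit s < y \<and> s \<in> {0<..<t0}) (at_right 0)"
      using order_tendstoD(2)[OF deficit_tendsto_0 y(1)] eventually_at_right_real[OF t0(1)] by (rule eventually_conj)
    then obtain s where s: "deficit s < y" "0 < s" "s < t0"
      using eventually_happens[of _ "at_right (0::real)"] by (auto simp: trivial_limit_at_right_real)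
    have "continuous_on {s..t0} deficit"
      unfolding deficit_def using s t0
      by (intro continuous_intros continuous_on_subset[OF continuous_F1]) auto
    moreover have "y \<le> deficit t0" using d(2)[of t0] y t0 by simp
    ultimately obtain \<tau> where \<tau>: "s \<le> \<tau>" "\<tau> \<le> t0" "deficit \<tau> = y"
      using IVT'[of deficit s y t0] s by auto
    have "\<tau> < t0" using \<tau> d(2)[of t0] y t0(2) by (cases "\<tau> = t0") auto
    moreover have "y < deficit t" if "\<tau> < t" "t \<le> 1" for t
      using t0(3)[of \<tau> t] d(2)[of t] that s \<tau> y by (cases "t \<le> t0") auto
    moreover have "deficit t < y" if "0 < t" "t < \<tau>" for t
      using t0(3)[of t \<tau>] that \<tau> by auto
    ultimately show ?thesis unfolding P_def using s \<tau> t0 by (intro exI[of _ \<tau>]) auto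
  qed
  then obtain T where T: "\<And>y. 0 < y \<Longrightarrow> y < d \<Longrightarrow> P y (T y)" by metis
  have "(T \<longlongrightarrow> 0) (at_right 0)"
  proof (rule tendstoI)
    fix e :: real assume e: "0 < e"
    define \<delta> where "\<delta> = min e t0 / 2"
    have \<delta>: "0 < \<delta>" "\<delta> < e" "\<delta> \<le> t0" using e t0 by (auto simp: \<delta>_def min_def)
    have "deficit (\<delta> / 2) < deficit \<delta>" by (intro t0(3)) (use \<delta> in auto)
    then have "0 < deficit \<delta>" using deficit_nonneg[of "\<delta> / 2"] \<delta> t0(2) by simp
    then have "0 < min d (deficit \<delta>)" using d by simp
    then have "eventually (\<lambda>y. y \<in> {0<..<min d (deficit \<delta>)}) (at_right 0)" by (rule eventually_at_right_real)
    then show "eventually (\<lambda>y. dist (T y) 0 < e) (at_right 0)"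
    proof eventually_elim
      case (elim y)
      then have "P y (T y)" by (intro T) auto
      then have "0 < T y" "T y \<le> \<delta>" using elim \<delta> unfolding P_def by (auto simp: not_less[symmetric])
      then show ?case using \<delta> by (simp add: dist_real_def)
    qed
  qed
  then show thesis using that[of d T] d(1) T unfolding P_def by blast
qed

text \<open>Since \<open>1 / \<alpha>s = 1 - a + a * g0\<close>, the crossing equation reads \<open>deficit \<tau> = y \<alpha>\<close> with
  \<open>y \<alpha> = (1 / \<alpha>s - 1 / \<alpha>) / a\<close>, and \<open>y \<alpha> / (\<alpha> - \<alpha>s)\<close> tends to \<open>1 / (a * \<alpha>s\<^sup>2)\<close>. Together with
  \<open>deficit \<tau> \<sim> g0 * L * \<tau> powr \<beta>\<close> and \<open>F1 \<tau> = (g0 - y \<alpha>) * \<tau>\<close> this gives the limit.\<close>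

lemma crossing_point:
  fixes a :: real
  assumes a: "0 < a" "a < 1"
  defines "\<alpha>s \<equiv> 1 / (1 - a + a * g0)"
  obtains \<tau> where
    "eventually (\<lambda>\<alpha>. crosses_at (\<lambda>t. (1 - a) * t + a * F1 t) \<alpha> (\<tau> \<alpha>)) (at_right \<alpha>s)"
    "((\<lambda>\<alpha>. F1 (\<tau> \<alpha>) / (\<alpha> - \<alpha>s) powr (1 / \<beta>)) \<longlongrightarrow> g0 * (1 / (a * \<alpha>s\<^sup>2 * g0 * L)) powr (1 / \<beta>)) (at_right \<alpha>s)"
proof -
  let ?F = "\<lambda>t. (1 - a) * t + a * F1 t"
  obtain y1 T where y1: "0 < y1" and
    T: "\<And>y. 0 < y \<Longrightarrow> y < y1 \<Longrightarrow> 0 < T y \<and> T y < 1 \<and> deficit (T y) = y \<and>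
      (\<forall>t. 0 < t \<longrightarrow> t < T y \<longrightarrow> deficit t < y) \<and> (\<forall>t. T y < t \<longrightarrow> t \<le> 1 \<longrightarrow> y < deficit t)" and
    T0: "(T \<longlongrightarrow> 0) (at_right 0)"
    using deficit_crossing by blast
  have den: "0 < 1 - a + a * g0" using a g0_pos by (simp add: add_pos_pos)
  then have \<alpha>s: "0 < \<alpha>s" by (simp add: \<alpha>s_def)
  have inv: "1 / \<alpha>s = 1 - a + a * g0" by (simp add: \<alpha>s_def)
  define y where "y = (\<lambda>\<alpha>. (1 / \<alpha>s - 1 / \<alpha>) / a)"
  have y_alt: "y \<alpha> / (\<alpha> - \<alpha>s) = 1 / (a * \<alpha>s * \<alpha>)" if "\<alpha>s < \<alpha>" for \<alpha>
  proof -
    have "y \<alpha> = (\<alpha> - \<alpha>s) / (a * \<alpha>s * \<alpha>)" using that \<alpha>s a by (simp add: y_def field_simps)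
    then show ?thesis using that by simp
  qed
  have y_pos: "0 < y \<alpha>" if "\<alpha>s < \<alpha>" for \<alpha>
    using that \<alpha>s a by (simp add: y_def frac_less2)
  have ev: "eventually (\<lambda>\<alpha>. \<alpha>s < \<alpha>) (at_right \<alpha>s)" by (rule eventually_at_right_less)
  have "(y \<longlongrightarrow> (1 / \<alpha>s - 1 / \<alpha>s) / a) (at_right \<alpha>s)"
    unfolding y_def using \<alpha>s a by (intro tendsto_intros) auto
  then have y0: "(y \<longlongrightarrow> 0) (at_right \<alpha>s)" by simp
  have y_lim: "filterlim y (at_right 0) (at_right \<alpha>s)"
  proof -
    have "eventually (\<lambda>\<alpha>. 0 < y \<alpha>) (at_right \<alpha>s)" using ev by eventually_elim (rule y_pos)
    then show ?thesis using y0 by (auto simp: filterlim_at elim: eventually_mono)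
  qed
  have y_small: "eventually (\<lambda>\<alpha>. 0 < y \<alpha> \<and> y \<alpha> < y1) (at_right \<alpha>s)"
    using order_tendstoD(2)[OF y0 y1] ev by eventually_elim (use y_pos in auto)
  have T_lim: "filterlim T (at_right 0) (at_right 0)"
  proof -
    have "eventually (\<lambda>y. y \<in> {0<..<y1}) (at_right 0)" using y1 by (rule eventually_at_right_real)
    then have "eventually (\<lambda>y. 0 < T y) (at_right 0)" by eventually_elim (use T in auto)
    then show ?thesis using T0 by (auto simp: filterlim_at elim: eventually_mono)
  qed
  have lin: "?F t = t * (1 / \<alpha> + a * (y \<alpha> - deficit t))" if "0 < t" for t \<alpha>
  proof -
    have e1: "1 / \<alpha> + a * y \<alpha> = 1 - a + a * g0" using a by (simp add: y_def inv)
    have e2: "t * deficit t = g0 * t - F1 t" using that by (simp add: deficit_def right_diff_distrib)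
    have "t * (1 / \<alpha> + a * (y \<alpha> - deficit t)) = t * (1 / \<alpha> + a * y \<alpha>) - a * (t * deficit t)"
      by (simp add: algebra_simps)
    also have "\<dots> = t * (1 - a + a * g0) - a * (g0 * t - F1 t)" by (simp only: e1 e2)
    also have "\<dots> = ?F t" by (simp add: algebra_simps)
    finally show ?thesis by simp
  qed
  show thesis
  proof
    show "eventually (\<lambda>\<alpha>. crosses_at (\<lambda>t. ?F t) \<alpha> (T (y \<alpha>))) (at_right \<alpha>s)"
      using y_small
    proof eventually_elim
      case (elim \<alpha>)
      then have *: "0 < T (y \<alpha>) \<and> T (y \<alpha>) < 1 \<and> deficit (T (y \<alpha>)) = y \<alpha> \<and>
        (\<forall>t. 0 < t \<longrightarrow> t < T (y \<alpha>) \<longrightarrow> deficit t < y \<alpha>) \<and> (\<forall>t. T (y \<alpha>) < t \<longrightarrow> t \<le> 1 \<longrightarrow> y \<alpha> < deficit t)"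
        by (intro T) auto
      have "t / \<alpha> < ?F t" if "0 < t" "deficit t < y \<alpha>" for t
      proof -
        have "t * (1 / \<alpha>) < t * (1 / \<alpha> + a * (y \<alpha> - deficit t))"
          using that a by (intro mult_strict_left_mono) auto
        then show ?thesis unfolding lin[OF that(1), of \<alpha>] by simp
      qed
      moreover have "?F t < t / \<alpha>" if "0 < t" "y \<alpha> < deficit t" for t
      proof -
        have "t * (1 / \<alpha> + a * (y \<alpha> - deficit t)) < t * (1 / \<alpha>)"
          using that a by (intro mult_strict_left_mono) (auto simp: mult_pos_neg)
        then show ?thesis unfolding lin[OF that(1), of \<alpha>] by simp
      qed
      moreover have "(1 - a) * T (y \<alpha>) + a * F1 (T (y \<alpha>)) = T (y \<alpha>) / \<alpha>"
        using * lin[of "T (y \<alpha>)" \<alpha>] by simp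
      ultimately show ?case using * unfolding crosses_at_def by (auto intro: less_trans)
    qed
  next
  let ?q = "\<lambda>\<alpha>. (y \<alpha> / T (y \<alpha>) powr \<beta>) / (y \<alpha> / (\<alpha> - \<alpha>s))"
  let ?l = "(g0 * L) / (1 / (a * \<alpha>s * \<alpha>s))"
    have "((\<lambda>\<alpha>. deficit (T (y \<alpha>)) / T (y \<alpha>) powr \<beta>) \<longlongrightarrow> g0 * L) (at_right \<alpha>s)"
      using filterlim_compose[OF filterlim_compose[OF deficit_asymptotics T_lim] y_lim] .
    then have "((\<lambda>\<alpha>. y \<alpha> / T (y \<alpha>) powr \<beta>) \<longlongrightarrow> g0 * L) (at_right \<alpha>s)"
      by (rule Lim_transform_eventually) (use y_small T in \<open>auto elim!: eventually_mono\<close>)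
    then have "(?q \<longlongrightarrow> ?l) (at_right \<alpha>s)"
    proof (rule tendsto_divide)
      have "((\<lambda>\<alpha>. 1 / (a * \<alpha>s * \<alpha>)) \<longlongrightarrow> 1 / (a * \<alpha>s * \<alpha>s)) (at_right \<alpha>s)"
        using \<alpha>s a by (intro tendsto_intros) auto
      then show "((\<lambda>\<alpha>. y \<alpha> / (\<alpha> - \<alpha>s)) \<longlongrightarrow> 1 / (a * \<alpha>s * \<alpha>s)) (at_right \<alpha>s)"
        by (rule Lim_transform_eventually) (use ev y_alt in \<open>auto elim!: eventually_mono\<close>)
    qed (use \<alpha>s a in auto)
    then have "((\<lambda>\<alpha>. ?q \<alpha> powr (- 1 / \<beta>))
        \<longlongrightarrow> ?l powr (- 1 / \<beta>)) (at_right \<alpha>s)"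
      using g0_pos L \<alpha>s a by (intro tendsto_powr tendsto_const) auto
    moreover have "((\<lambda>\<alpha>. g0 - y \<alpha>) \<longlongrightarrow> g0 - 0) (at_right \<alpha>s)" by (intro tendsto_intros y0)
    ultimately have lim: "((\<lambda>\<alpha>. (g0 - y \<alpha>) * ?q \<alpha> powr (- 1 / \<beta>))
        \<longlongrightarrow> (g0 - 0) * ?l powr (- 1 / \<beta>)) (at_right \<alpha>s)"
      by (rule tendsto_mult[rotated])
    have const: "(g0 - 0) * ?l powr (- 1 / \<beta>) = g0 * (1 / (a * \<alpha>s\<^sup>2 * g0 * L)) powr (1 / \<beta>)"
    proof -
      have eq: "?l = a * \<alpha>s\<^sup>2 * g0 * L" by (simp add: power2_eq_square mult_ac)
      have "0 < a * \<alpha>s\<^sup>2 * g0 * L" using g0_pos L \<alpha>s a by simp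
      then show ?thesis unfolding eq by (simp add: powr_minus_divide powr_divide less_imp_le)
    qed
    have "eventually (\<lambda>\<alpha>. (g0 - y \<alpha>) * ?q \<alpha> powr (- 1 / \<beta>)
        = F1 (T (y \<alpha>)) / (\<alpha> - \<alpha>s) powr (1 / \<beta>)) (at_right \<alpha>s)"
      using y_small ev
    proof eventually_elim
      case (elim \<alpha>)
      then have T\<alpha>: "0 < T (y \<alpha>)" "deficit (T (y \<alpha>)) = y \<alpha>" using T[of "y \<alpha>"] by auto
      have "?q \<alpha> = (\<alpha> - \<alpha>s) / T (y \<alpha>) powr \<beta>" using elim by simp
      moreover have "((\<alpha> - \<alpha>s) / T (y \<alpha>) powr \<beta>) powr (- 1 / \<beta>) = T (y \<alpha>) / (\<alpha> - \<alpha>s) powr (1 / \<beta>)"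
        using elim T\<alpha> \<beta> by (simp add: powr_divide powr_powr powr_minus_divide less_imp_le flip: minus_divide_left)
      moreover have "g0 - y \<alpha> = F1 (T (y \<alpha>)) / T (y \<alpha>)" using T\<alpha> by (simp add: deficit_def)
      ultimately show ?case using T\<alpha> by simp
    qed
    then show "((\<lambda>\<alpha>. F1 (T (y \<alpha>)) / (\<alpha> - \<alpha>s) powr (1 / \<beta>)) \<longlongrightarrow>
        g0 * (1 / (a * \<alpha>s\<^sup>2 * g0 * L)) powr (1 / \<beta>)) (at_right \<alpha>s)"
      by (rule Lim_transform_eventually[OF lim[unfolded const]])
  qed
qed

end

lemma alt_cdf_concentrated:
  fixes \<nu> :: "real ^ 'k"
  assumes S: "standing_assumptions g \<epsilon> \<gamma> r" and \<nu>: "\<And>k. 0 < \<nu> $ k"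
  shows "concentrated_cdf (alt_cdf g \<epsilon> \<nu>) (g 0) (loss_const \<epsilon> \<gamma> \<nu>) (\<epsilon> / real CARD('k))"
proof
  let ?b = "\<epsilon> / real CARD('k)"
  let ?F = "alt_cdf g \<epsilon> \<nu>"
  note \<epsilon> = standing_assumptionsD(5)[OF S]
  have "0 < (\<Sum>k\<in>UNIV. \<gamma> $ k / \<nu> $ k)"
    using standing_assumptionsD(6)[OF S] \<nu> by (intro sum_pos) auto
  then show "0 < loss_const \<epsilon> \<gamma> \<nu>"
    using simplex_const_pos[OF \<epsilon> \<nu>] \<epsilon> by (simp add: loss_const_def add_pos_pos)
  show "0 < ?b" using \<epsilon> by simp
  show "?F 0 = 0" by (rule alt_cdf_0[OF S \<nu>])
  show "?F 1 = 1" by (rule alt_cdf_1[OF S])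
  show "0 \<le> ?F t - ?F s" "?F t - ?F s \<le> g 0 * (t - s)"
    if "0 \<le> s" "s \<le> t" "t \<le> 1" for s t
    using alt_cdf_diff[OF S \<nu> that] by auto
  show "\<exists>t0. 0 < t0 \<and> t0 \<le> 1 \<and> (\<forall>s t. 0 \<le> s \<longrightarrow> s \<le> t \<longrightarrow> t \<le> t0 \<longrightarrow>
      \<bar>?F t - ?F s - g 0 * (t - s - loss_const \<epsilon> \<gamma> \<nu> *
        (t powr (1 + ?b) - s powr (1 + ?b)))\<bar>
      \<le> \<eta> * t powr (?b) * (t - s))" if "0 < \<eta>" for \<eta>
    by (rule alt_cdf_increment[OF S \<nu> that]) blast
qed

text \<open>The distribution function of the uniform law on \<open>[0, 1]\<close>. It extends formulas valid on the unit
  interval to the whole line, where the empirical distribution functions live.\<close>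

definition clamp01 :: "real \<Rightarrow> real" where
  "clamp01 q = max 0 (min 1 q)"

lemma h_nonneg: "0 \<le> h \<epsilon> \<nu> u"
  by (simp add: h_def)

lemma h_region_clamp: "0 \<le> q \<Longrightarrow> h_region \<epsilon> \<nu> q = h_region \<epsilon> \<nu> (clamp01 q)"
  using h_le_1[of \<epsilon> \<nu>] by (auto simp: h_region_def clamp01_def intro: order_trans)

lemma h_region_neg: "q < 0 \<Longrightarrow> h_region \<epsilon> \<nu> q = {}"
  using h_nonneg[of \<epsilon> \<nu>] by (auto simp: h_region_def not_le intro: less_le_trans)

lemma measure_h_region:
  assumes "0 < \<epsilon>" "\<And>k. 0 < \<nu> $ k"
  shows "measure lborel (h_region \<epsilon> \<nu> q) = clamp01 q"
proof (cases "q < 0")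
  case True then show ?thesis by (simp add: h_region_neg clamp01_def)
next
  case False
  have "0 \<le> clamp01 q" "clamp01 q \<le> 1" by (auto simp: clamp01_def)
  then have "measure lborel (h_region \<epsilon> \<nu> (clamp01 q)) = clamp01 q"
    using measure_h_le[OF assms] by (simp add: h_region_def)
  then show ?thesis using False h_region_clamp[of q \<epsilon> \<nu>] by simp
qed

lemma alt_cdf_clamp:
  assumes "standing_assumptions g \<epsilon> \<gamma> r" "\<And>k. 0 < \<nu> $ k"
  shows "alt_cdf g \<epsilon> \<nu> q = alt_cdf g \<epsilon> \<nu> (clamp01 q)"
proof (cases "q < 0")
  case True
  then have "alt_cdf g \<epsilon> \<nu> q = 0" by (simp add: alt_cdf_def h_region_neg)
  then show ?thesis using True alt_cdf_0[OF assms] by (simp add: clamp01_def)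
next
  case False then show ?thesis using h_region_clamp[of q \<epsilon> \<nu>] by (simp add: alt_cdf_def)
qed

section \<open>Laws in the random effects model\<close>

lemma emeasure_lborel_vec_prod:
  assumes [measurable]: "\<And>k. A k \<in> sets (borel :: real measure)"
  shows "emeasure lborel {x :: real ^ 'k. \<forall>k. x $ k \<in> A k} = (\<Prod>k\<in>UNIV. emeasure lborel (A k))"
proof -
  define f :: "real ^ 'k \<Rightarrow> real \<Rightarrow> ennreal" where "f = (\<lambda>b. indicator (A (SOME k. b = axis k 1)))"
  have some: "(SOME k. axis l (1 :: real) = axis k 1) = l" for l :: 'k
    by (rule some_equality) (auto simp: axis_eq_axis)
  have [measurable]: "{x :: real ^ 'k. \<forall>k. x $ k \<in> A k} \<in> sets borel" by measurable
  have "emeasure lborel {x :: real ^ 'k. \<forall>k. x $ k \<in> A k} = (\<integral>\<^sup>+x. indicator {x :: real ^ 'k. \<forall>k. x $ k \<in> A k} x \<partial>lborel)"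
    by simp
  also have "\<dots> = (\<integral>\<^sup>+x. (\<Prod>b\<in>Basis. f b (x \<bullet> b)) \<partial>lborel)"
  proof (rule nn_integral_cong)
    fix x :: "real ^ 'k"
    have "(\<Prod>b\<in>Basis. f b (x \<bullet> b)) = (\<Prod>k\<in>UNIV. indicator (A k) (x $ k))"
      by (simp add: prod_Basis_vec f_def some inner_axis)
    also have "\<dots> = indicator {x. \<forall>k. x $ k \<in> A k} x"
      by (auto simp: indicator_def)
    finally show "indicator {x. \<forall>k. x $ k \<in> A k} x = (\<Prod>b\<in>Basis. f b (x \<bullet> b))" by simp
  qed
  also have "\<dots> = (\<Prod>b\<in>Basis. \<integral>\<^sup>+x. f b x \<partial>lborel)"
    by (rule nn_integral_lborel_prod) (simp_all add: f_def)
  also have "\<dots> = (\<Prod>k\<in>UNIV. emeasure lborel (A k))"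
    by (simp add: prod_Basis_vec f_def some)
  finally show ?thesis .
qed

text \<open>The two laws agree on open boxes: there independence turns the first one into a product, and the
  second one is the volume of the part of the box inside the cube.\<close>

lemma (in prob_space) distr_indep_uniform_vec:
  fixes Y :: "'a \<Rightarrow> real ^ 'k"
  assumes indep: "indep_vars (\<lambda>_. borel) (\<lambda>k \<omega>. Y \<omega> $ k) UNIV"
    and unif: "\<And>k. distr M borel (\<lambda>\<omega>. Y \<omega> $ k) = uniform_measure lborel {0..1}"
    and Y [measurable]: "random_variable borel Y"
  shows "distr M borel Y = uniform_measure lborel (cbox 0 1)"
proof (rule measure_eqI_generator_eq)
  let ?E = "range (\<lambda>(a, b). box a b :: (real ^ 'k) set)"
  show "Int_stable ?E" by (auto simp: Int_stable_def box_Int_box)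
  show "?E \<subseteq> Pow UNIV" "sets (distr M borel Y) = sigma_sets UNIV ?E"
    "sets (uniform_measure lborel (cbox 0 1)) = sigma_sets UNIV ?E"
    by (simp_all add: borel_eq_box)
  let ?A = "\<lambda>n::nat. box (- (real n *\<^sub>R One)) (real n *\<^sub>R One) :: (real ^ 'k) set"
  show "range ?A \<subseteq> ?E" "(\<Union>i. ?A i) = UNIV" unfolding UN_box_eq_UNIV by auto
  interpret D: prob_space "distr M borel Y" by (rule prob_space_distr) simp
  show "emeasure (distr M borel Y) (?A i) \<noteq> \<infinity>" for i by simp
  fix S assume "S \<in> ?E"
  then obtain l u where S: "S = box l u" by auto
  have vi: "Y -` box l u \<inter> space M = (\<Inter>k\<in>UNIV. (\<lambda>\<omega>. Y \<omega> $ k) -` {l $ k<..<u $ k} \<inter> space M)"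
    by (auto simp: mem_box_cart)
  have "emeasure (distr M borel Y) (box l u) = ennreal (prob (Y -` box l u \<inter> space M))"
    by (simp add: emeasure_distr emeasure_eq_measure)
  also have "prob (Y -` box l u \<inter> space M) = (\<Prod>k\<in>UNIV. prob ((\<lambda>\<omega>. Y \<omega> $ k) -` {l $ k<..<u $ k} \<inter> space M))"
    unfolding vi by (rule indep_varsD_finite[OF indep]) auto
  also have "ennreal \<dots> = (\<Prod>k\<in>UNIV. emeasure (distr M borel (\<lambda>\<omega>. Y \<omega> $ k)) {l $ k<..<u $ k})"
  proof -
    have "(\<lambda>\<omega>. Y \<omega> $ k) \<in> borel_measurable M" for k
      by (rule measurable_compose[OF Y borel_measurable_nth])
    then have "emeasure (distr M borel (\<lambda>\<omega>. Y \<omega> $ k)) {l $ k<..<u $ k}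
        = ennreal (prob ((\<lambda>\<omega>. Y \<omega> $ k) -` {l $ k<..<u $ k} \<inter> space M))" for k
      by (subst emeasure_distr) (simp_all add: emeasure_eq_measure)
    then show ?thesis by (simp only: prod_ennreal measure_nonneg)
  qed
  also have "\<dots> = (\<Prod>k\<in>UNIV. emeasure lborel ({0..1} \<inter> {l $ k<..<u $ k}))"
    unfolding unif by (simp add: divide_ennreal_def)
  also have "\<dots> = emeasure lborel {x :: real ^ 'k. \<forall>k. x $ k \<in> {0..1} \<inter> {l $ k<..<u $ k}}"
    by (rule emeasure_lborel_vec_prod[symmetric]) simp
  also have "{x :: real ^ 'k. \<forall>k. x $ k \<in> {0..1} \<inter> {l $ k<..<u $ k}} = cbox 0 1 \<inter> box l u"
    by (auto simp: mem_box_cart)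
  also have "emeasure lborel (cbox 0 1 \<inter> box l u) = emeasure (uniform_measure lborel (cbox 0 1)) (box l u)"
    by (simp add: emeasure_cube divide_ennreal_def)
  finally show "emeasure (distr M borel Y) S = emeasure (uniform_measure lborel (cbox 0 1)) S"
    by (simp add: S)
qed

locale random_effects = prob_space M for M :: "'w measure" +
  fixes \<theta> :: "nat \<Rightarrow> 'w \<Rightarrow> bool" and \<xi> :: "nat \<Rightarrow> 'w \<Rightarrow> real ^ 'k" and a :: real and g :: "real ^ 'k \<Rightarrow> real"
  assumes model: "random_effects_model M \<theta> \<xi> a g"
begin

lemma a_bounds: "0 < a" "a < 1"
  using model unfolding random_effects_model_def by blast+

lemma indep_pairs: "indep_vars (\<lambda>_. count_space UNIV \<Otimes>\<^sub>M borel) (\<lambda>i \<omega>. (\<theta> i \<omega>, \<xi> i \<omega>)) UNIV"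
  using model unfolding random_effects_model_def by blast

lemma pair_measurable: "(\<lambda>\<omega>. (\<theta> i \<omega>, \<xi> i \<omega>)) \<in> measurable M (count_space UNIV \<Otimes>\<^sub>M borel)"
  using indep_pairs by (auto simp: indep_vars_def)

lemma measurable_theta [measurable]: "\<theta> i \<in> measurable M (count_space UNIV)"
  using measurable_compose[OF pair_measurable measurable_fst, of i] by simp

lemma measurable_xi [measurable]: "\<xi> i \<in> borel_measurable M"
  using measurable_compose[OF pair_measurable measurable_snd, of i] by simp

lemma xi_cube: "\<omega> \<in> space M \<Longrightarrow> \<xi> i \<omega> \<in> cbox 0 1"
  using model unfolding random_effects_model_def by blast

lemma prob_alt: "prob {\<omega> \<in> space M. \<theta> i \<omega>} = a"
  using model unfolding random_effects_model_def by blast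

lemma prob_null: "prob {\<omega> \<in> space M. \<not> \<theta> i \<omega>} = 1 - a"
  using prob_neg[of "\<theta> i"] prob_alt[of i] by simp

lemma null_law:
  assumes [measurable]: "B \<in> sets borel"
  shows "prob {\<omega> \<in> space M. \<not> \<theta> i \<omega> \<and> \<xi> i \<omega> \<in> B} = (1 - a) * measure lborel (cbox 0 1 \<inter> B)"
proof -
  let ?T = "{\<omega> \<in> space M. \<not> \<theta> i \<omega> \<and> \<xi> i \<omega> \<in> B}"
  let ?N = "{\<omega> \<in> space M. \<not> \<theta> i \<omega>}"
  define M0 where "M0 = uniform_measure M ?N"
  have N: "emeasure M ?N = ennreal (1 - a)" by (simp add: emeasure_eq_measure prob_null)
  interpret M0: prob_space M0
    unfolding M0_def by (rule prob_space_uniform_measure) (use N a_bounds in auto)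
  have "M0.indep_vars (\<lambda>_. borel) (\<lambda>k \<omega>. \<xi> i \<omega> $ k) UNIV"
    "\<And>k. distr M0 borel (\<lambda>\<omega>. \<xi> i \<omega> $ k) = uniform_measure lborel {0..1}"
    using model unfolding random_effects_model_def Let_def M0_def by blast+
  then have "distr M0 borel (\<xi> i) = uniform_measure lborel (cbox 0 1)"
    by (rule M0.distr_indep_uniform_vec) (simp add: M0_def)
  then have "emeasure (distr M0 borel (\<xi> i)) B = emeasure (uniform_measure lborel (cbox 0 1)) B" by simp
  then have "emeasure M0 (\<xi> i -` B \<inter> space M) = emeasure lborel (cbox 0 1 \<inter> B)"
    by (simp add: emeasure_distr M0_def emeasure_cube divide_ennreal_def)
  moreover have "emeasure M0 (\<xi> i -` B \<inter> space M) = emeasure M (?N \<inter> (\<xi> i -` B \<inter> space M)) / emeasure M ?N"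
    unfolding M0_def by (rule emeasure_uniform_measure) measurable
  moreover have "?N \<inter> (\<xi> i -` B \<inter> space M) = ?T" by auto
  ultimately have eq: "emeasure lborel (cbox 0 1 \<inter> B) = ennreal (prob ?T / (1 - a))"
    using a_bounds by (simp add: emeasure_eq_measure prob_null divide_ennreal)
  then have "measure lborel (cbox 0 1 \<inter> B) = prob ?T / (1 - a)"
    using a_bounds by (simp add: measure_def)
  then show ?thesis using a_bounds by (simp add: field_simps)
qed

lemma alt_law:
  assumes [measurable]: "B \<in> sets borel"
  shows "emeasure M {\<omega> \<in> space M. \<theta> i \<omega> \<and> \<xi> i \<omega> \<in> B} =
    ennreal a * (\<integral>\<^sup>+x. ennreal (indicator (cbox 0 1) x * g x) * indicator B x \<partial>lborel)"
proof -
  let ?F = "{\<omega> \<in> space M. \<theta> i \<omega> \<and> \<xi> i \<omega> \<in> B}"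
  let ?N = "{\<omega> \<in> space M. \<theta> i \<omega>}"
  have N: "emeasure M ?N = ennreal a" by (simp add: emeasure_eq_measure prob_alt)
  have D: "distributed (uniform_measure M ?N) lborel (\<xi> i) (\<lambda>x. ennreal (indicator (cbox 0 1) x * g x))"
    using model unfolding random_effects_model_def by blast
  have "emeasure (uniform_measure M ?N) (\<xi> i -` B \<inter> space (uniform_measure M ?N)) =
      (\<integral>\<^sup>+x. ennreal (indicator (cbox 0 1) x * g x) * indicator B x \<partial>lborel)"
    using D by (rule distributed_emeasure) simp
  moreover have "emeasure (uniform_measure M ?N) (\<xi> i -` B \<inter> space M) = emeasure M (?N \<inter> (\<xi> i -` B \<inter> space M)) / emeasure M ?N"
    by (rule emeasure_uniform_measure) measurable
  moreover have "?N \<inter> (\<xi> i -` B \<inter> space M) = ?F" by auto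
  ultimately have "(\<integral>\<^sup>+x. ennreal (indicator (cbox 0 1) x * g x) * indicator B x \<partial>lborel)
      = emeasure M ?F / ennreal a"
    by (simp add: N)
  then show ?thesis using a_bounds by (simp add: emeasure_eq_measure divide_ennreal flip: ennreal_mult)
qed

end

section \<open>A lower bound for the pFDR\<close>

context random_effects
begin

text \<open>This is the bound \<open>(1 - a) / (1 - a + a * g x) \<ge> (1 - a) * alpha_star a g\<close> on the posterior
  probability of a true null, integrated over \<open>x \<in> B\<close>. This avoids
  conditioning on an event of probability zero.\<close>

lemma null_prob_lower_bound:
  assumes g: "\<And>x. x \<in> cbox 0 1 \<Longrightarrow> 0 \<le> g x" "\<And>x. x \<in> cbox 0 1 \<Longrightarrow> g x \<le> g 0" and B [measurable]: "B \<in> sets borel"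
  shows "ennreal ((1 - a) * alpha_star a g) * emeasure M {\<omega> \<in> space M. \<xi> i \<omega> \<in> B}
    \<le> emeasure M {\<omega> \<in> space M. \<not> \<theta> i \<omega> \<and> \<xi> i \<omega> \<in> B}"
proof -
  let ?T = "{\<omega> \<in> space M. \<not> \<theta> i \<omega> \<and> \<xi> i \<omega> \<in> B}"
  let ?F = "{\<omega> \<in> space M. \<theta> i \<omega> \<and> \<xi> i \<omega> \<in> B}"
  let ?X = "{\<omega> \<in> space M. \<xi> i \<omega> \<in> B}"
  let ?v = "measure lborel (cbox 0 1 \<inter> B)"
  have g0: "0 \<le> g 0" using g(1)[of 0] by (simp add: mem_box_cart)
  have v: "emeasure lborel (cbox 0 1 \<inter> B) = ennreal ?v"
    using fmeasurable_cube_Int[OF B] by (intro emeasure_eq_measure2)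
  have den: "0 < 1 - a + a * g 0" using a_bounds g0 by (intro add_pos_nonneg) auto
  have "emeasure M ?F \<le> ennreal a * (\<integral>\<^sup>+x. ennreal (g 0) * indicator (cbox 0 1 \<inter> B) x \<partial>lborel)"
    unfolding alt_law[OF B] using g by (intro mult_left_mono nn_integral_mono) (auto simp: indicator_def intro: ennreal_leI)
  also have "\<dots> = ennreal (a * (g 0 * ?v))"
    using a_bounds g0 by (simp add: nn_integral_cmult_indicator v ennreal_mult)
  finally have alt: "prob ?F \<le> a * (g 0 * ?v)"
    using a_bounds g0 by (simp add: emeasure_eq_measure)
  have "?X = ?T \<union> ?F" by auto
  then have "prob ?X = prob ?T + prob ?F"
    by (simp only:) (rule finite_measure_Union, auto)
  also have "\<dots> \<le> (1 - a) * ?v + a * (g 0 * ?v)" using alt null_law[OF B, of i] by simp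
  also have "\<dots> = (1 - a + a * g 0) * ?v" by (simp add: algebra_simps)
  finally have "prob ?X / (1 - a + a * g 0) \<le> ?v" using den by (simp add: pos_divide_le_eq mult.commute)
  then have "(1 - a) * (prob ?X / (1 - a + a * g 0)) \<le> (1 - a) * ?v" using a_bounds by (intro mult_left_mono) auto
  then have "(1 - a) * alpha_star a g * prob ?X \<le> prob ?T"
    by (simp add: null_law[OF B] alpha_star_def)
  moreover have "0 \<le> (1 - a) * alpha_star a g" using a_bounds den by (simp add: alpha_star_def)
  ultimately show ?thesis by (simp add: emeasure_eq_measure ennreal_mult[symmetric])
qed

lemma nn_integral_null_lower_bound:
  assumes g: "\<And>x. x \<in> cbox 0 1 \<Longrightarrow> 0 \<le> g x" "\<And>x. x \<in> cbox 0 1 \<Longrightarrow> g x \<le> g 0"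
    and \<phi> [measurable]: "\<phi> \<in> borel_measurable borel"
  shows "ennreal ((1 - a) * alpha_star a g) * (\<integral>\<^sup>+\<omega>. \<phi> (\<xi> i \<omega>) \<partial>M)
    \<le> (\<integral>\<^sup>+\<omega>. (if \<theta> i \<omega> then 0 else \<phi> (\<xi> i \<omega>)) \<partial>M)"
proof -
  let ?N = "{\<omega> \<in> space M. \<not> \<theta> i \<omega>}" and ?c = "ennreal ((1 - a) * alpha_star a g)"
  define A1 where "A1 = scale_measure ?c (distr M borel (\<xi> i))"
  define A2 where "A2 = distr (density M (indicator ?N)) borel (\<xi> i)"
  have "A1 \<le> A2"
  proof (rule le_measure[THEN iffD2, OF _ ballI])
    show "sets A1 = sets A2" by (simp add: A1_def A2_def)
    fix B assume "B \<in> sets A1"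
    then have B [measurable]: "B \<in> sets borel" by (simp add: A1_def)
    have vim: "\<xi> i -` B \<inter> space M = {\<omega> \<in> space M. \<xi> i \<omega> \<in> B}" by auto
    have "emeasure A2 B = (\<integral>\<^sup>+\<omega>. indicator ?N \<omega> * indicator {\<omega> \<in> space M. \<xi> i \<omega> \<in> B} \<omega> \<partial>M)"
      unfolding A2_def by (simp add: emeasure_distr emeasure_density vim)
    also have "\<dots> = (\<integral>\<^sup>+\<omega>. indicator {\<omega> \<in> space M. \<not> \<theta> i \<omega> \<and> \<xi> i \<omega> \<in> B} \<omega> \<partial>M)"
      by (intro nn_integral_cong) (auto simp: indicator_def)
    also have "\<dots> = emeasure M {\<omega> \<in> space M. \<not> \<theta> i \<omega> \<and> \<xi> i \<omega> \<in> B}" by simp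
    finally show "emeasure A1 B \<le> emeasure A2 B"
      using null_prob_lower_bound[OF g B, of i] by (simp add: A1_def emeasure_distr vim)
  qed
  then have "nn_integral A1 \<phi> \<le> nn_integral A2 \<phi>"
    by (rule nn_integral_mono_measure[rotated]) (simp add: A1_def A2_def)
  moreover have "nn_integral A1 \<phi> = ?c * (\<integral>\<^sup>+\<omega>. \<phi> (\<xi> i \<omega>) \<partial>M)"
    unfolding A1_def by (simp add: nn_integral_scale_measure nn_integral_distr)
  moreover have "nn_integral A2 \<phi> = (\<integral>\<^sup>+\<omega>. indicator ?N \<omega> * \<phi> (\<xi> i \<omega>) \<partial>M)"
    unfolding A2_def by (simp add: nn_integral_density nn_integral_distr)
  moreover have "\<dots> = (\<integral>\<^sup>+\<omega>. (if \<theta> i \<omega> then 0 else \<phi> (\<xi> i \<omega>)) \<partial>M)"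
    by (intro nn_integral_cong) (auto simp: indicator_def)
  ultimately show ?thesis by simp
qed

text \<open>The weight may also depend on the data \<open>Z\<close> of the other tests: these are independent of the pair
  \<open>(\<theta> i, \<xi> i)\<close> and can be held fixed by Fubini's theorem.\<close>

lemma nn_integral_null_lower_bound_indep:
  fixes N :: "(nat \<Rightarrow> bool \<times> (real ^ 'k)) measure"
  assumes g: "\<And>x. x \<in> cbox 0 1 \<Longrightarrow> 0 \<le> g x" "\<And>x. x \<in> cbox 0 1 \<Longrightarrow> g x \<le> g 0"
    and ind: "indep_var (PiM {i} (\<lambda>_. count_space UNIV \<Otimes>\<^sub>M borel)) (\<lambda>\<omega>. restrict (\<lambda>j. (\<theta> j \<omega>, \<xi> j \<omega>)) {i}) N Z"
    and f [measurable]: "f \<in> borel_measurable (borel \<Otimes>\<^sub>M N)"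
  shows "ennreal ((1 - a) * alpha_star a g) * (\<integral>\<^sup>+\<omega>. f (\<xi> i \<omega>, Z \<omega>) \<partial>M)
    \<le> (\<integral>\<^sup>+\<omega>. (if \<theta> i \<omega> then 0 else f (\<xi> i \<omega>, Z \<omega>)) \<partial>M)"
proof -
  let ?P = "count_space (UNIV :: bool set) \<Otimes>\<^sub>M (borel :: (real ^ 'k) measure)"
  let ?S = "PiM {i} (\<lambda>_. ?P)"
  let ?X = "\<lambda>\<omega>. restrict (\<lambda>j. (\<theta> j \<omega>, \<xi> j \<omega>)) {i}" and ?c = "ennreal ((1 - a) * alpha_star a g)"
  have X [measurable]: "?X \<in> measurable M ?S" and Z [measurable]: "Z \<in> measurable M N"
    and joint: "distr M (?S \<Otimes>\<^sub>M N) (\<lambda>\<omega>. (?X \<omega>, Z \<omega>)) = distr M ?S ?X \<Otimes>\<^sub>M distr M N Z"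
    using ind by (simp_all add: indep_var_distribution_eq)
  interpret DX: prob_space "distr M ?S ?X" by (rule prob_space_distr) simp
  interpret DZ: prob_space "distr M N Z" by (rule prob_space_distr) simp
  interpret P: pair_sigma_finite "distr M ?S ?X" "distr M N Z" ..
  have fubini: "(\<integral>\<^sup>+\<omega>. F (?X \<omega>) (Z \<omega>) \<partial>M) = (\<integral>\<^sup>+z. (\<integral>\<^sup>+\<omega>. F (?X \<omega>) z \<partial>M) \<partial>distr M N Z)"
    if F [measurable]: "(\<lambda>p. F (fst p) (snd p)) \<in> borel_measurable (?S \<Otimes>\<^sub>M N)" for F
  proof -
    have Fz: "(\<lambda>x. F x z) \<in> borel_measurable ?S" if "z \<in> space N" for z
      using measurable_compose[OF measurable_Pair2'[OF that, where ?M1.0 = ?S] F] by simp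
    have "(\<integral>\<^sup>+\<omega>. F (?X \<omega>) (Z \<omega>) \<partial>M) = (\<integral>\<^sup>+p. F (fst p) (snd p) \<partial>distr M (?S \<Otimes>\<^sub>M N) (\<lambda>\<omega>. (?X \<omega>, Z \<omega>)))"
      by (subst nn_integral_distr) simp_all
    also have "\<dots> = (\<integral>\<^sup>+p. F (fst p) (snd p) \<partial>(distr M ?S ?X \<Otimes>\<^sub>M distr M N Z))" by (simp only: joint)
    also have "\<dots> = (\<integral>\<^sup>+z. (\<integral>\<^sup>+x. F x z \<partial>distr M ?S ?X) \<partial>distr M N Z)"
      by (subst P.nn_integral_snd[symmetric]) (simp_all cong: measurable_cong_sets)
    also have "\<dots> = (\<integral>\<^sup>+z. (\<integral>\<^sup>+\<omega>. F (?X \<omega>) z \<partial>M) \<partial>distr M N Z)"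
      by (intro nn_integral_cong nn_integral_distr) (auto intro: Fz)
    finally show ?thesis .
  qed
  have comp: "(\<lambda>p. fst p i) \<in> measurable (?S \<Otimes>\<^sub>M N) ?P"
    by (rule measurable_compose[OF measurable_fst measurable_component_singleton]) simp
  have [measurable]: "(\<lambda>p. fst (fst p i)) \<in> measurable (?S \<Otimes>\<^sub>M N) (count_space UNIV)"
    "(\<lambda>p. snd (fst p i)) \<in> measurable (?S \<Otimes>\<^sub>M N) borel"
    using measurable_compose[OF comp measurable_fst] measurable_compose[OF comp measurable_snd] by simp_all
  have 1: "(\<integral>\<^sup>+\<omega>. f (\<xi> i \<omega>, Z \<omega>) \<partial>M) = (\<integral>\<^sup>+z. (\<integral>\<^sup>+\<omega>. f (\<xi> i \<omega>, z) \<partial>M) \<partial>distr M N Z)"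
    using fubini[of "\<lambda>x z. f (snd (x i), z)"] by simp
  have 2: "(\<integral>\<^sup>+\<omega>. (if \<theta> i \<omega> then 0 else f (\<xi> i \<omega>, Z \<omega>)) \<partial>M)
      = (\<integral>\<^sup>+z. (\<integral>\<^sup>+\<omega>. (if \<theta> i \<omega> then 0 else f (\<xi> i \<omega>, z)) \<partial>M) \<partial>distr M N Z)"
    using fubini[of "\<lambda>x z. if fst (x i) then 0 else f (snd (x i), z)"] by (simp cong: if_cong)
  have meas: "(\<lambda>z. \<integral>\<^sup>+\<omega>. f (\<xi> i \<omega>, z) \<partial>M) \<in> borel_measurable (distr M N Z)"
    by simp
  have "?c * (\<integral>\<^sup>+\<omega>. f (\<xi> i \<omega>, Z \<omega>) \<partial>M) = (\<integral>\<^sup>+z. ?c * (\<integral>\<^sup>+\<omega>. f (\<xi> i \<omega>, z) \<partial>M) \<partial>distr M N Z)"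
    unfolding 1 by (rule nn_integral_cmult[OF meas, symmetric])
  also have "\<dots> \<le> (\<integral>\<^sup>+z. (\<integral>\<^sup>+\<omega>. (if \<theta> i \<omega> then 0 else f (\<xi> i \<omega>, z)) \<partial>M) \<partial>distr M N Z)"
  proof (rule nn_integral_mono)
    fix z assume "z \<in> space (distr M N Z)"
    then have "z \<in> space N" by simp
    then have "(\<lambda>x. f (x, z)) \<in> borel_measurable borel"
      using measurable_compose[OF measurable_Pair2' f] by simp
    then show "?c * (\<integral>\<^sup>+\<omega>. f (\<xi> i \<omega>, z) \<partial>M) \<le> (\<integral>\<^sup>+\<omega>. (if \<theta> i \<omega> then 0 else f (\<xi> i \<omega>, z)) \<partial>M)"
      using nn_integral_null_lower_bound[OF g, of "\<lambda>x. f (x, z)" i] by simp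
  qed
  finally show ?thesis unfolding 2 .
qed

definition score :: "real \<Rightarrow> real ^ 'k \<Rightarrow> nat \<Rightarrow> 'w \<Rightarrow> real" where
  "score \<epsilon> \<nu> i \<omega> = h \<epsilon> \<nu> (\<nu> \<bullet> vpow (\<xi> i \<omega>) \<epsilon>)"

lemma score_measurable [measurable]: "score \<epsilon> \<nu> i \<in> borel_measurable M"
  unfolding score_def by measurable

lemma nu_rejected_score: "nu_rejected \<xi> \<epsilon> \<nu> n \<alpha> \<omega> = BH_rejected \<alpha> n (\<lambda>i. score \<epsilon> \<nu> i \<omega>)"
  by (simp add: nu_rejected_def score_def)

lemma card_nu_rejected_measurable [measurable]:
  assumes "0 < \<alpha>" "\<alpha> < 1"
  shows "(\<lambda>\<omega>. real (card (nu_rejected \<xi> \<epsilon> \<nu> n \<alpha> \<omega>))) \<in> borel_measurable M"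
    "(\<lambda>\<omega>. real (card {i \<in> nu_rejected \<xi> \<epsilon> \<nu> n \<alpha> \<omega>. \<not> \<theta> i \<omega>})) \<in> borel_measurable M"
proof -
  have [measurable]: "Measurable.pred M (\<lambda>\<omega>. i \<in> BH_rejected \<alpha> n (\<lambda>j. score \<epsilon> \<nu> j \<omega>))" for i
    using assms by (intro pred_BH_rejected) measurable
  have eq: "nu_rejected \<xi> \<epsilon> \<nu> n \<alpha> \<omega> = {i \<in> {..<n}. i \<in> BH_rejected \<alpha> n (\<lambda>j. score \<epsilon> \<nu> j \<omega>)}"
    "{i \<in> nu_rejected \<xi> \<epsilon> \<nu> n \<alpha> \<omega>. \<not> \<theta> i \<omega>} = {i \<in> {..<n}. i \<in> BH_rejected \<alpha> n (\<lambda>j. score \<epsilon> \<nu> j \<omega>) \<and> \<not> \<theta> i \<omega>}" for \<omega>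
    using BH_rejected_subset by (auto simp: nu_rejected_score)
  show "(\<lambda>\<omega>. real (card (nu_rejected \<xi> \<epsilon> \<nu> n \<alpha> \<omega>))) \<in> borel_measurable M"
    unfolding eq by measurable
  show "(\<lambda>\<omega>. real (card {i \<in> nu_rejected \<xi> \<epsilon> \<nu> n \<alpha> \<omega>. \<not> \<theta> i \<omega>})) \<in> borel_measurable M"
    unfolding eq by measurable
qed

lemma finite_nu_rejected [simp]: "finite (nu_rejected \<xi> \<epsilon> \<nu> n \<alpha> \<omega>)"
  by (simp add: nu_rejected_score)

text \<open>A single score of at most \<open>\<alpha> / n\<close> already leads to a rejection.\<close>

lemma prob_rejection_pos:
  assumes \<epsilon>: "0 < \<epsilon>" and \<nu>: "\<And>k. 0 < \<nu> $ k" and \<alpha>: "0 < \<alpha>" "\<alpha> < 1" and n: "0 < n"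
  shows "0 < prob {\<omega> \<in> space M. 0 < card (nu_rejected \<xi> \<epsilon> \<nu> n \<alpha> \<omega>)}"
proof -
  let ?A = "{\<omega> \<in> space M. 0 < card (nu_rejected \<xi> \<epsilon> \<nu> n \<alpha> \<omega>)}"
  have \<alpha>n: "0 < \<alpha> / n" "\<alpha> / n \<le> 1" using \<alpha> n by (auto simp: divide_le_eq)
  have meas [measurable]: "?A \<in> events"
  proof -
    have "{\<omega> \<in> space M. 0 < real (card (nu_rejected \<xi> \<epsilon> \<nu> n \<alpha> \<omega>))} \<in> events"
      using card_nu_rejected_measurable(1)[OF \<alpha>] by measurable
    then show ?thesis by simp
  qed
  have "0 < (1 - a) * (\<alpha> / n)" using a_bounds \<alpha>n by (intro mult_pos_pos) auto
  also have "\<dots> = (1 - a) * measure lborel (cbox 0 1 \<inter> h_region \<epsilon> \<nu> (\<alpha> / n))"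
    using measure_h_le[OF \<epsilon> \<nu>, of "\<alpha> / n"] \<alpha>n h_region_subset[of \<epsilon> \<nu> "\<alpha> / n"] by (simp add: Int_absorb1 h_region_def[symmetric])
  also have "\<dots> = prob {\<omega> \<in> space M. \<not> \<theta> 0 \<omega> \<and> \<xi> 0 \<omega> \<in> h_region \<epsilon> \<nu> (\<alpha> / n)}"
    by (rule null_law[symmetric]) simp
  also have "\<dots> \<le> prob ?A"
  proof (rule finite_measure_mono)
    show "{\<omega> \<in> space M. \<not> \<theta> 0 \<omega> \<and> \<xi> 0 \<omega> \<in> h_region \<epsilon> \<nu> (\<alpha> / n)}
        \<subseteq> ?A"
    proof safe
      fix \<omega> assume "\<xi> 0 \<omega> \<in> h_region \<epsilon> \<nu> (\<alpha> / n)"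
      then have s0: "score \<epsilon> \<nu> 0 \<omega> \<le> \<alpha> * real 1 / real n" by (simp add: h_region_def score_def)
      have "card {0 :: nat} \<le> card {j \<in> {..<n}. score \<epsilon> \<nu> j \<omega> \<le> \<alpha> * real 1 / real n}"
        using s0 n by (intro card_mono) auto
      then have "0 \<in> nu_rejected \<xi> \<epsilon> \<nu> n \<alpha> \<omega>"
        unfolding nu_rejected_score BH_rejected_iff[OF \<alpha>] using s0 n by (intro conjI bexI[of _ 1]) auto
      then show "0 < card (nu_rejected \<xi> \<epsilon> \<nu> n \<alpha> \<omega>)" by (auto simp: card_gt_0_iff)
    qed
  qed (rule meas)
  finally show ?thesis .
qed

lemma integral_uniform_measure_eq:
  fixes f :: "'w \<Rightarrow> real"
  assumes [measurable]: "A \<in> events" "f \<in> borel_measurable M" and A: "0 < prob A"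
    and f: "\<And>\<omega>. 0 \<le> f \<omega>" "\<And>\<omega>. f \<omega> \<le> 1" "\<And>\<omega>. \<omega> \<in> space M \<Longrightarrow> \<omega> \<notin> A \<Longrightarrow> f \<omega> = 0"
  shows "(\<integral>\<omega>. f \<omega> \<partial>uniform_measure M A) = (\<integral>\<omega>. f \<omega> \<partial>M) / prob A"
proof -
  have "(\<integral>\<omega>. f \<omega> \<partial>uniform_measure M A) = enn2real (\<integral>\<^sup>+\<omega>. ennreal (f \<omega>) \<partial>uniform_measure M A)"
    by (rule integral_eq_nn_integral) (use f in auto)
  also have "(\<integral>\<^sup>+\<omega>. ennreal (f \<omega>) \<partial>uniform_measure M A) = (\<integral>\<^sup>+\<omega>. ennreal (f \<omega>) * indicator A \<omega> \<partial>M) / emeasure M A"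
    by (rule nn_integral_uniform_measure) simp_all
  also have "(\<integral>\<^sup>+\<omega>. ennreal (f \<omega>) * indicator A \<omega> \<partial>M) = (\<integral>\<^sup>+\<omega>. ennreal (f \<omega>) \<partial>M)"
    using f(3) by (intro nn_integral_cong) (auto simp: indicator_def)
  also have "\<dots> = ennreal (\<integral>\<omega>. f \<omega> \<partial>M)"
    using f by (intro nn_integral_eq_integral integrable_const_bound[where B = 1]) auto
  also have "ennreal (\<integral>\<omega>. f \<omega> \<partial>M) / emeasure M A = ennreal ((\<integral>\<omega>. f \<omega> \<partial>M) / prob A)"
    using A f by (simp add: emeasure_eq_measure divide_ennreal)
  finally show ?thesis using A f by simp
qed

lemma pFDR_eq:
  assumes \<epsilon>: "0 < \<epsilon>" and \<nu>: "\<And>k. 0 < \<nu> $ k" and \<alpha>: "0 < \<alpha>" "\<alpha> < 1" and n: "0 < n"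
  shows "pFDR M \<theta> (nu_rejected \<xi> \<epsilon> \<nu> n \<alpha>) =
    (\<integral>\<omega>. real (card {i \<in> nu_rejected \<xi> \<epsilon> \<nu> n \<alpha> \<omega>. \<not> \<theta> i \<omega>}) / real (card (nu_rejected \<xi> \<epsilon> \<nu> n \<alpha> \<omega>)) \<partial>M)
      / prob {\<omega> \<in> space M. 0 < card (nu_rejected \<xi> \<epsilon> \<nu> n \<alpha> \<omega>)}"
  unfolding pFDR_def
proof (rule integral_uniform_measure_eq)
  let ?V = "\<lambda>\<omega>. real (card {i \<in> nu_rejected \<xi> \<epsilon> \<nu> n \<alpha> \<omega>. \<not> \<theta> i \<omega>})"
  let ?R = "\<lambda>\<omega>. real (card (nu_rejected \<xi> \<epsilon> \<nu> n \<alpha> \<omega>))"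
  note [measurable] = card_nu_rejected_measurable[OF \<alpha>, of \<epsilon> \<nu> n]
  have "{\<omega> \<in> space M. 0 < ?R \<omega>} \<in> events" by measurable
  then show "{\<omega> \<in> space M. 0 < card (nu_rejected \<xi> \<epsilon> \<nu> n \<alpha> \<omega>)} \<in> events" by simp
  show "(\<lambda>\<omega>. ?V \<omega> / ?R \<omega>) \<in> borel_measurable M"
    by measurable
  have "card {i \<in> nu_rejected \<xi> \<epsilon> \<nu> n \<alpha> \<omega>. \<not> \<theta> i \<omega>} \<le> card (nu_rejected \<xi> \<epsilon> \<nu> n \<alpha> \<omega>)" for \<omega>
    by (rule card_mono) auto
  then show "?V \<omega> / ?R \<omega> \<le> 1" for \<omega>
    by (intro divide_le_eq_1[THEN iffD2]) auto
qed (use prob_rejection_pos[OF assms] in auto)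

text \<open>Give each rejected index the weight \<open>1 / R\<close>. The weights add up to \<open>1\<close> when \<open>R > 0\<close>, and those of
  the true nulls add up to \<open>V / R\<close>. Each weight is a function of all the p-values, so
  \<open>nn_integral_null_lower_bound_indep\<close> applies to every index separately.\<close>

lemma pFDR_lower_bound:
  assumes \<epsilon>: "0 < \<epsilon>" and \<nu>: "\<And>k. 0 < \<nu> $ k" and \<alpha>: "0 < \<alpha>" "\<alpha> < 1" and n: "0 < n"
    and g: "\<And>x. x \<in> cbox 0 1 \<Longrightarrow> 0 \<le> g x" "\<And>x. x \<in> cbox 0 1 \<Longrightarrow> g x \<le> g 0"
  shows "(1 - a) * alpha_star a g \<le> pFDR M \<theta> (nu_rejected \<xi> \<epsilon> \<nu> n \<alpha>)"
proof -
  let ?c = "(1 - a) * alpha_star a g"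
  let ?P = "count_space (UNIV :: bool set) \<Otimes>\<^sub>M (borel :: (real ^ 'k) measure)"
  define D where "D = (\<lambda>\<omega>. nu_rejected \<xi> \<epsilon> \<nu> n \<alpha> \<omega>)"
  define A where "A = {\<omega> \<in> space M. 0 < card (D \<omega>)}"
  note [measurable] = card_nu_rejected_measurable[OF \<alpha>, of \<epsilon> \<nu> n, folded D_def]
  have Dn: "D \<omega> \<subseteq> {..<n}" for \<omega> using BH_rejected_subset by (simp add: D_def nu_rejected_score)
  have finD: "finite (D \<omega>)" for \<omega> by (simp add: D_def)
  have "{\<omega> \<in> space M. 0 < real (card (D \<omega>))} \<in> events" by measurable
  then have A [measurable]: "A \<in> events" by (simp add: A_def)
  have A_pos: "0 < prob A" using prob_rejection_pos[OF \<epsilon> \<nu> \<alpha> n] by (simp add: A_def D_def)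
  have g0: "0 \<le> g 0" using g(1)[of 0] by (simp add: mem_box_cart)
  have c: "0 \<le> ?c" using a_bounds g0 by (auto simp: alpha_star_def intro!: add_nonneg_nonneg)
  define w where "w = (\<lambda>i \<omega>. if i \<in> D \<omega> then 1 / real (card (D \<omega>)) else 0)"
  have pred_D [measurable]: "Measurable.pred M (\<lambda>\<omega>. i \<in> D \<omega>)" for i
    unfolding D_def nu_rejected_score by (rule pred_BH_rejected[OF \<alpha>]) measurable
  have w_meas [measurable]: "w i \<in> borel_measurable M" for i unfolding w_def by measurable
  have w_nonneg: "0 \<le> w i \<omega>" for i \<omega> by (simp add: w_def)
  have key: "ennreal ?c * (\<integral>\<^sup>+\<omega>. ennreal (w i \<omega>) \<partial>M) \<le> (\<integral>\<^sup>+\<omega>. (if \<theta> i \<omega> then 0 else ennreal (w i \<omega>)) \<partial>M)"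
    if i: "i < n" for i
  proof -
    define J where "J = {..<n} - {i}"
    define Z where "Z = (\<lambda>\<omega>. restrict (\<lambda>j. (\<theta> j \<omega>, \<xi> j \<omega>)) J)"
    define N where "N = PiM J (\<lambda>_. ?P)"
    \<comment> \<open>The scores as functions of the p-value of test \<open>i\<close> and of the data of the other tests.\<close>
    define S where "S = (\<lambda>(x :: real ^ 'k, z :: nat \<Rightarrow> bool \<times> (real ^ 'k)) j.
      if j \<in> J then h \<epsilon> \<nu> (\<nu> \<bullet> vpow (snd (z j)) \<epsilon>) else h \<epsilon> \<nu> (\<nu> \<bullet> vpow x \<epsilon>))"
    define f where "f = (\<lambda>p. ennreal (if i \<in> BH_rejected \<alpha> n (S p) then 1 / real (card (BH_rejected \<alpha> n (S p))) else 0))"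
    have ind: "indep_var (PiM {i} (\<lambda>_. ?P)) (\<lambda>\<omega>. restrict (\<lambda>j. (\<theta> j \<omega>, \<xi> j \<omega>)) {i}) N Z"
      unfolding N_def Z_def by (rule indep_var_restrict[OF indep_pairs]) (auto simp: J_def)
    have S_meas [measurable]: "(\<lambda>p. S p j) \<in> borel_measurable (borel \<Otimes>\<^sub>M N)" for j
    proof (cases "j \<in> J")
      case True
      have "(\<lambda>p. snd p j) \<in> measurable (borel \<Otimes>\<^sub>M N) ?P"
        unfolding N_def by (rule measurable_compose[OF measurable_snd measurable_component_singleton[OF True]])
      then have [measurable]: "(\<lambda>p. snd (snd p j)) \<in> borel_measurable (borel \<Otimes>\<^sub>M N)"
        by (rule measurable_compose[OF _ measurable_snd])
      show ?thesis using True by (simp add: S_def case_prod_beta)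
    next
      case False
      then show ?thesis by (simp add: S_def case_prod_beta)
    qed
    have [measurable]: "Measurable.pred (borel \<Otimes>\<^sub>M N) (\<lambda>p. l \<in> BH_rejected \<alpha> n (S p))" for l
      using pred_BH_rejected[OF \<alpha>, of "\<lambda>j p. S p j" _ l n] S_meas by simp
    have card_eq: "BH_rejected \<alpha> n (S p) = {l \<in> {..<n}. l \<in> BH_rejected \<alpha> n (S p)}" for p
      using BH_rejected_subset by blast
    have [measurable]: "(\<lambda>p. real (card (BH_rejected \<alpha> n (S p)))) \<in> borel_measurable (borel \<Otimes>\<^sub>M N)"
      by (subst card_eq) measurable
    have f_meas: "f \<in> borel_measurable (borel \<Otimes>\<^sub>M N)" unfolding f_def by measurable
    have "BH_rejected \<alpha> n (S (\<xi> i \<omega>, Z \<omega>)) = D \<omega>" for \<omega>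
      unfolding D_def nu_rejected_score
      by (rule BH_rejected_cong) (auto simp: S_def Z_def J_def score_def)
    then have f_w: "f (\<xi> i \<omega>, Z \<omega>) = ennreal (w i \<omega>)" for \<omega> by (simp add: f_def w_def)
    show ?thesis
      using nn_integral_null_lower_bound_indep[OF g ind f_meas] by (simp only: f_w)
  qed
  have sum_w: "(\<Sum>i<n. w i \<omega>) = (if 0 < card (D \<omega>) then 1 else 0)" for \<omega>
  proof -
    have "(\<Sum>i<n. w i \<omega>) = (\<Sum>i\<in>{i \<in> {..<n}. i \<in> D \<omega>}. 1 / real (card (D \<omega>)))"
      unfolding w_def by (rule sum.inter_filter[symmetric]) simp
    also have "{i \<in> {..<n}. i \<in> D \<omega>} = D \<omega>" using Dn by auto
    finally show ?thesis by simp
  qed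
  have sum_null: "(\<Sum>i<n. if \<theta> i \<omega> then 0 else w i \<omega>) = real (card {i \<in> D \<omega>. \<not> \<theta> i \<omega>}) / real (card (D \<omega>))" for \<omega>
  proof -
    have "(\<Sum>i<n. if \<theta> i \<omega> then 0 else w i \<omega>) = (\<Sum>i\<in>{..<n}. if i \<in> D \<omega> \<and> \<not> \<theta> i \<omega> then 1 / real (card (D \<omega>)) else 0)"
      unfolding w_def by (intro sum.cong) auto
    also have "\<dots> = (\<Sum>i\<in>{i \<in> {..<n}. i \<in> D \<omega> \<and> \<not> \<theta> i \<omega>}. 1 / real (card (D \<omega>)))"
      by (rule sum.inter_filter[symmetric]) simp
    also have "{i \<in> {..<n}. i \<in> D \<omega> \<and> \<not> \<theta> i \<omega>} = {i \<in> D \<omega>. \<not> \<theta> i \<omega>}" using Dn by auto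
    finally show ?thesis by simp
  qed
  define q where "q = (\<lambda>\<omega>. real (card {i \<in> D \<omega>. \<not> \<theta> i \<omega>}) / real (card (D \<omega>)))"
  have q_meas [measurable]: "q \<in> borel_measurable M" unfolding q_def by measurable
  have q_bounds: "0 \<le> q \<omega>" "q \<omega> \<le> 1" for \<omega>
    using card_mono[of "D \<omega>" "{i \<in> D \<omega>. \<not> \<theta> i \<omega>}"] finD by (auto simp: q_def divide_le_eq_1)
  have "ennreal (?c * prob A) = ennreal ?c * (\<integral>\<^sup>+\<omega>. ennreal (\<Sum>i<n. w i \<omega>) \<partial>M)"
  proof -
    have "(\<integral>\<^sup>+\<omega>. ennreal (\<Sum>i<n. w i \<omega>) \<partial>M) = (\<integral>\<^sup>+\<omega>. indicator A \<omega> \<partial>M)"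
      by (intro nn_integral_cong) (simp add: sum_w A_def indicator_def)
    then show ?thesis using c by (simp add: emeasure_eq_measure ennreal_mult)
  qed
  also have "\<dots> = (\<Sum>i<n. ennreal ?c * (\<integral>\<^sup>+\<omega>. ennreal (w i \<omega>) \<partial>M))"
  proof -
    have "(\<integral>\<^sup>+\<omega>. ennreal (\<Sum>i<n. w i \<omega>) \<partial>M) = (\<integral>\<^sup>+\<omega>. (\<Sum>i<n. ennreal (w i \<omega>)) \<partial>M)"
      by (simp only: sum_ennreal w_nonneg)
    also have "\<dots> = (\<Sum>i<n. \<integral>\<^sup>+\<omega>. ennreal (w i \<omega>) \<partial>M)"
      by (rule nn_integral_sum) measurable
    finally show ?thesis by (simp only: sum_distrib_left)
  qed
  also have "\<dots> \<le> (\<Sum>i<n. \<integral>\<^sup>+\<omega>. (if \<theta> i \<omega> then 0 else ennreal (w i \<omega>)) \<partial>M)"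
    by (intro sum_mono key) simp
  also have "\<dots> = (\<integral>\<^sup>+\<omega>. (\<Sum>i<n. if \<theta> i \<omega> then 0 else ennreal (w i \<omega>)) \<partial>M)"
    by (rule nn_integral_sum[symmetric]) measurable
  also have "\<dots> = (\<integral>\<^sup>+\<omega>. ennreal (q \<omega>) \<partial>M)"
  proof (rule nn_integral_cong)
    fix \<omega>
    have "(\<Sum>i<n. if \<theta> i \<omega> then 0 else ennreal (w i \<omega>)) = (\<Sum>i<n. ennreal (if \<theta> i \<omega> then 0 else w i \<omega>))"
      by (intro sum.cong) auto
    also have "\<dots> = ennreal (\<Sum>i<n. if \<theta> i \<omega> then 0 else w i \<omega>)"
      by (rule sum_ennreal) (simp add: w_nonneg)
    finally show "(\<Sum>i<n. if \<theta> i \<omega> then 0 else ennreal (w i \<omega>)) = ennreal (q \<omega>)" by (simp only: sum_null q_def)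
  qed
  also have "\<dots> = ennreal (\<integral>\<omega>. q \<omega> \<partial>M)"
    using q_bounds by (intro nn_integral_eq_integral integrable_const_bound[where B = 1]) auto
  finally have "?c * prob A \<le> (\<integral>\<omega>. q \<omega> \<partial>M)"
    using q_bounds by (subst (asm) ennreal_le_iff) auto
  then have "?c \<le> (\<integral>\<omega>. q \<omega> \<partial>M) / prob A" using A_pos by (simp add: pos_le_divide_eq)
  then show ?thesis using pFDR_eq[OF \<epsilon> \<nu> \<alpha> n] by (simp add: q_def D_def A_def)
qed

end

section \<open>Limits of power and pFDR\<close>

context random_effects
begin

definition score_cdf :: "real \<Rightarrow> real ^ 'k \<Rightarrow> real \<Rightarrow> real" where
  "score_cdf \<epsilon> \<nu> q = (1 - a) * clamp01 q + a * alt_cdf g \<epsilon> \<nu> q"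

lemma prob_null_score:
  assumes "0 < \<epsilon>" "\<And>k. 0 < \<nu> $ k"
  shows "prob {\<omega> \<in> space M. \<not> \<theta> i \<omega> \<and> score \<epsilon> \<nu> i \<omega> \<le> q} = (1 - a) * clamp01 q"
proof -
  have "{\<omega> \<in> space M. \<not> \<theta> i \<omega> \<and> score \<epsilon> \<nu> i \<omega> \<le> q} = {\<omega> \<in> space M. \<not> \<theta> i \<omega> \<and> \<xi> i \<omega> \<in> h_region \<epsilon> \<nu> q}"
    using xi_cube by (auto simp: h_region_def score_def)
  then show ?thesis
    using null_law[of "h_region \<epsilon> \<nu> q" i] measure_h_region[OF assms] h_region_subset[of \<epsilon> \<nu> q]
    by (simp add: Int_absorb1)
qed

lemma prob_score:
  assumes S: "standing_assumptions g \<epsilon> \<gamma> r" and \<nu>: "\<And>k. 0 < \<nu> $ k"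
  shows "prob {\<omega> \<in> space M. score \<epsilon> \<nu> i \<omega> \<le> q} = score_cdf \<epsilon> \<nu> q"
proof -
  let ?T = "{\<omega> \<in> space M. \<not> \<theta> i \<omega> \<and> score \<epsilon> \<nu> i \<omega> \<le> q}"
  let ?F = "{\<omega> \<in> space M. \<theta> i \<omega> \<and> score \<epsilon> \<nu> i \<omega> \<le> q}"
  let ?X = "{\<omega> \<in> space M. score \<epsilon> \<nu> i \<omega> \<le> q}"
  note \<epsilon> = standing_assumptionsD(5)[OF S]
  have "?F = {\<omega> \<in> space M. \<theta> i \<omega> \<and> \<xi> i \<omega> \<in> h_region \<epsilon> \<nu> q}"
    using xi_cube by (auto simp: h_region_def score_def)
  then have "emeasure M ?F
      = ennreal a * (\<integral>\<^sup>+x. ennreal (indicator (cbox 0 1) x * g x) * indicator (h_region \<epsilon> \<nu> q) x \<partial>lborel)"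
    using alt_law[of "h_region \<epsilon> \<nu> q" i] by simp
  also have "(\<integral>\<^sup>+x. ennreal (indicator (cbox 0 1) x * g x) * indicator (h_region \<epsilon> \<nu> q) x \<partial>lborel)
      = (\<integral>\<^sup>+x. ennreal (indicator (h_region \<epsilon> \<nu> q) x * g x) \<partial>lborel)"
    using h_region_subset[of \<epsilon> \<nu> q] by (intro nn_integral_cong) (auto simp: indicator_def)
  also have "\<dots> = ennreal (alt_cdf g \<epsilon> \<nu> q)"
    unfolding alt_cdf_def
  proof (rule nn_integral_eq_integral)
    show "integrable lborel (\<lambda>x. indicator (h_region \<epsilon> \<nu> q) x * g x)"
      by (intro integrable_indicator_times_continuous h_region_subset standing_assumptionsD(3)[OF S]) simp
    show "AE x in lborel. 0 \<le> indicator (h_region \<epsilon> \<nu> q) x * g x"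
      using standing_assumptionsD(1)[OF S] h_region_subset[of \<epsilon> \<nu> q] by (auto simp: indicator_def)
  qed
  finally have "emeasure M ?F = ennreal a * ennreal (alt_cdf g \<epsilon> \<nu> q)" .
  moreover have F1: "0 \<le> alt_cdf g \<epsilon> \<nu> q"
    using alt_cdf_diff(1)[OF S \<nu>, of 0 "clamp01 q"] alt_cdf_0[OF S \<nu>] alt_cdf_clamp[OF S \<nu>, of q]
    by (simp add: clamp01_def)
  ultimately have alt: "prob ?F = a * alt_cdf g \<epsilon> \<nu> q"
    using a_bounds by (simp add: emeasure_eq_measure flip: ennreal_mult)
  have "?X =
      ?T \<union> ?F" by auto
  then have "prob ?X =
      prob ?T + prob ?F"
    by (simp only:) (rule finite_measure_Union, auto)
  then show ?thesis using alt prob_null_score[OF \<epsilon> \<nu>] by (simp add: score_cdf_def)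
qed

lemma isCont_clamp01: "isCont clamp01 q"
  unfolding clamp01_def[abs_def] isCont_def by (intro tendsto_intros)

lemma isCont_score_cdf:
  assumes S: "standing_assumptions g \<epsilon> \<gamma> r" and \<nu>: "\<And>k. 0 < \<nu> $ k"
  shows "isCont (score_cdf \<epsilon> \<nu>) q"
proof -
  interpret C: concentrated_cdf "alt_cdf g \<epsilon> \<nu>" "g 0" "loss_const \<epsilon> \<gamma> \<nu>" "\<epsilon> / real CARD('k)"
    by (rule alt_cdf_concentrated[OF S \<nu>])
  have "continuous_on UNIV (\<lambda>q. alt_cdf g \<epsilon> \<nu> (clamp01 q))"
    by (rule continuous_on_compose2[OF C.continuous_F1])
      (auto simp: continuous_at_imp_continuous_on isCont_clamp01, auto simp: clamp01_def)
  then have "continuous_on UNIV (alt_cdf g \<epsilon> \<nu>)" by (simp only: alt_cdf_clamp[OF S \<nu>, symmetric])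
  then have "isCont (alt_cdf g \<epsilon> \<nu>) q" by (simp add: continuous_on_eq_continuous_at)
  then show ?thesis unfolding score_cdf_def[abs_def] by (intro continuous_intros isCont_clamp01)
qed

lemma frequencies_AE:
  assumes S: "standing_assumptions g \<epsilon> \<gamma> r" and \<nu>: "\<And>k. 0 < \<nu> $ k"
  shows "AE \<omega> in M. (\<forall>q\<in>\<rat>. (\<lambda>n. real (card {j \<in> {..<n}. score \<epsilon> \<nu> j \<omega> \<le> q}) / real n) \<longlonglongrightarrow> score_cdf \<epsilon> \<nu> q)
    \<and> (\<forall>q\<in>\<rat>. (\<lambda>n. real (card {j \<in> {..<n}. score \<epsilon> \<nu> j \<omega> \<le> q \<and> \<not> \<theta> j \<omega>}) / real n) \<longlonglongrightarrow> (1 - a) * clamp01 q)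
    \<and> (\<lambda>n. real (card {j \<in> {..<n}. \<not> \<theta> j \<omega>}) / real n) \<longlonglongrightarrow> 1 - a"
proof -
  note \<epsilon> = standing_assumptionsD(5)[OF S]
  let ?P = "count_space (UNIV :: bool set) \<Otimes>\<^sub>M (borel :: (real ^ 'k) measure)"
  have freq: "AE \<omega> in M. (\<lambda>n. real (card {j \<in> {..<n}. Q (\<theta> j \<omega>, \<xi> j \<omega>)}) / real n) \<longlonglongrightarrow> p"
    if Q [measurable]: "Measurable.pred ?P Q" and p: "\<And>i. prob {\<omega> \<in> space M. Q (\<theta> i \<omega>, \<xi> i \<omega>)} = p" for Q p
  proof -
    have "{x. Q x} \<in> sets ?P" using predE[OF Q] by (simp add: space_pair_measure)
    from event_frequency_AE[OF indep_pairs this, of p] p show ?thesis by simp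
  qed
  have "AE \<omega> in M. (\<lambda>n. real (card {j \<in> {..<n}. score \<epsilon> \<nu> j \<omega> \<le> q}) / real n) \<longlonglongrightarrow> score_cdf \<epsilon> \<nu> q" for q
    using freq[of "\<lambda>p. h \<epsilon> \<nu> (\<nu> \<bullet> vpow (snd p) \<epsilon>) \<le> q" "score_cdf \<epsilon> \<nu> q"] prob_score[OF S \<nu>, of _ q]
    by (simp add: score_def)
  moreover have "AE \<omega> in M. (\<lambda>n. real (card {j \<in> {..<n}. score \<epsilon> \<nu> j \<omega> \<le> q \<and> \<not> \<theta> j \<omega>}) / real n)
      \<longlonglongrightarrow> (1 - a) * clamp01 q" for q
    using freq[of "\<lambda>p. h \<epsilon> \<nu> (\<nu> \<bullet> vpow (snd p) \<epsilon>) \<le> q \<and> \<not> fst p" "(1 - a) * clamp01 q"]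
      prob_null_score[OF \<epsilon> \<nu>, of _ q]
    by (simp add: score_def conj_commute)
  moreover have "AE \<omega> in M. (\<lambda>n. real (card {j \<in> {..<n}. \<not> \<theta> j \<omega>}) / real n) \<longlonglongrightarrow> 1 - a"
    using freq[of "\<lambda>p. \<not> fst p" "1 - a"] prob_null by simp
  ultimately show ?thesis by (simp add: AE_ball_countable countable_rat)
qed

text \<open>On the event where all the frequencies converge, the threshold tends to \<open>\<tau>\<close>, and so the
  frequencies may be evaluated at the random threshold.\<close>

lemma rejection_limits_AE:
  assumes S: "standing_assumptions g \<epsilon> \<gamma> r" and \<nu>: "\<And>k. 0 < \<nu> $ k"
    and \<alpha>: "0 < \<alpha>"
    and cross: "crosses_at (\<lambda>t. (1 - a) * t + a * alt_cdf g \<epsilon> \<nu> t) \<alpha> \<tau>"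
  shows "AE \<omega> in M.
      (\<lambda>n. real (card (nu_rejected \<xi> \<epsilon> \<nu> n \<alpha> \<omega>)) / real n) \<longlonglongrightarrow> \<tau> / \<alpha>
    \<and> (\<lambda>n. real (card {i \<in> nu_rejected \<xi> \<epsilon> \<nu> n \<alpha> \<omega>. \<not> \<theta> i \<omega>}) / real n) \<longlonglongrightarrow> (1 - a) * \<tau>
    \<and> (\<lambda>n. real (card {i \<in> {..<n}. \<not> \<theta> i \<omega>}) / real n) \<longlonglongrightarrow> 1 - a"
  using frequencies_AE[OF S \<nu>]
proof eventually_elim
  case (elim \<omega>)
  have \<tau>: "0 < \<tau>" "\<tau> < 1" and eq: "(1 - a) * \<tau> + a * alt_cdf g \<epsilon> \<nu> \<tau> = \<tau> / \<alpha>"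
    and above: "\<And>t. 0 < t \<Longrightarrow> t < \<tau> \<Longrightarrow> t / \<alpha> < (1 - a) * t + a * alt_cdf g \<epsilon> \<nu> t"
    and below: "\<And>t. \<tau> < t \<Longrightarrow> t \<le> 1 \<Longrightarrow> (1 - a) * t + a * alt_cdf g \<epsilon> \<nu> t < t / \<alpha>"
    using cross unfolding crosses_at_def by blast+
  let ?s = "\<lambda>j. score \<epsilon> \<nu> j \<omega>"
  let ?T = "\<lambda>n. BH_threshold \<alpha> n ?s"
  have clamp: "clamp01 t = t" if "0 \<le> t" "t \<le> 1" for t using that by (simp add: clamp01_def)
  have T: "(\<lambda>n. ?T n) \<longlonglongrightarrow> \<tau>"
  proof (rule BH_threshold_tendsto[OF \<alpha>, where F = "score_cdf \<epsilon> \<nu>"])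
    show "(\<lambda>n. real (card {j \<in> {..<n}. ?s j \<le> q}) / real n) \<longlonglongrightarrow> score_cdf \<epsilon> \<nu> q" if "q \<in> \<rat>" for q
      using elim that by blast
    show "isCont (score_cdf \<epsilon> \<nu>) t" for t by (rule isCont_score_cdf[OF S \<nu>])
    show "t / \<alpha> < score_cdf \<epsilon> \<nu> t" if "0 < t" "t < \<tau>" for t
      using above[OF that] that \<tau> by (simp add: score_cdf_def clamp)
    show "score_cdf \<epsilon> \<nu> t < t / \<alpha>" if "\<tau> < t" "t \<le> 1" for t
      using below[OF that] that \<tau> by (simp add: score_cdf_def clamp)
  qed (use \<tau> in auto)
  have R_eq: "nu_rejected \<xi> \<epsilon> \<nu> n \<alpha> \<omega> = {i \<in> {..<n}. ?s i \<le> ?T n}" for n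
    by (simp add: nu_rejected_score BH_rejected_def)
  have V_eq: "{i \<in> nu_rejected \<xi> \<epsilon> \<nu> n \<alpha> \<omega>. \<not> \<theta> i \<omega>} = {i \<in> {..<n}. ?s i \<le> ?T n \<and> \<not> \<theta> i \<omega>}" for n
    by (auto simp: R_eq)
  have "(\<lambda>n. real (card {i \<in> {..<n}. ?s i \<le> ?T n}) / real n) \<longlonglongrightarrow> score_cdf \<epsilon> \<nu> \<tau>"
  proof (rule mono_tendsto_at_moving_point[OF _ _ isCont_score_cdf[OF S \<nu>] T,
      where c = "\<lambda>n t. real (card {i \<in> {..<n}. ?s i \<le> t}) / real n"])
    show "mono (\<lambda>t. real (card {i \<in> {..<n}. ?s i \<le> t}) / real n)" for n
      using mono_frequency[of n ?s "\<lambda>_. True"] by simp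
  qed (use elim in blast)
  moreover have "score_cdf \<epsilon> \<nu> \<tau> = \<tau> / \<alpha>" using eq \<tau> by (simp add: score_cdf_def clamp)
  moreover have "(\<lambda>n. real (card {i \<in> {..<n}. ?s i \<le> ?T n \<and> \<not> \<theta> i \<omega>}) / real n) \<longlonglongrightarrow> (1 - a) * clamp01 \<tau>"
  proof (rule mono_tendsto_at_moving_point[OF mono_frequency _ _ T, where F = "\<lambda>q. (1 - a) * clamp01 q"])
    show "isCont (\<lambda>q. (1 - a) * clamp01 q) \<tau>" by (intro continuous_intros isCont_clamp01)
  qed (use elim in blast)
  ultimately show ?case using elim \<tau> by (simp add: R_eq V_eq clamp)
qed

lemma null_card_bounds:
  "card {i \<in> nu_rejected \<xi> \<epsilon> \<nu> n \<alpha> \<omega>. \<not> \<theta> i \<omega>} \<le> card (nu_rejected \<xi> \<epsilon> \<nu> n \<alpha> \<omega>)"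
  "card (nu_rejected \<xi> \<epsilon> \<nu> n \<alpha> \<omega>) - card {i \<in> nu_rejected \<xi> \<epsilon> \<nu> n \<alpha> \<omega>. \<not> \<theta> i \<omega>}
    \<le> n - card {i \<in> {..<n}. \<not> \<theta> i \<omega>}"
proof -
  let ?D = "nu_rejected \<xi> \<epsilon> \<nu> n \<alpha> \<omega>"
  let ?V = "{i \<in> ?D. \<not> \<theta> i \<omega>}"
  show "card ?V \<le> card ?D" by (rule card_mono) auto
  have "card ?D - card ?V = card (?D - ?V)"
    by (rule card_Diff_subset[symmetric]) auto
  also have "\<dots> \<le> card ({..<n} - {i \<in> {..<n}. \<not> \<theta> i \<omega>})"
    using BH_rejected_subset by (intro card_mono) (auto simp: nu_rejected_score)
  also have "\<dots> = n - card {i \<in> {..<n}. \<not> \<theta> i \<omega>}"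
    by (subst card_Diff_subset) auto
  finally show "card ?D - card ?V \<le> n - card {i \<in> {..<n}. \<not> \<theta> i \<omega>}" .
qed

text \<open>The ratio inside the expectation is bounded by \<open>1\<close> and converges almost surely to
  \<open>(\<tau> / \<alpha> - (1 - a) * \<tau>) / a\<close>, which is \<open>alt_cdf g \<epsilon> \<nu> \<tau>\<close> by the crossing equation.\<close>

lemma testing_power_tendsto:
  assumes S: "standing_assumptions g \<epsilon> \<gamma> r" and \<nu>: "\<And>k. 0 < \<nu> $ k"
    and \<alpha>: "0 < \<alpha>" "\<alpha> < 1"
    and cross: "crosses_at (\<lambda>t. (1 - a) * t + a * alt_cdf g \<epsilon> \<nu> t) \<alpha> \<tau>"
  shows "(\<lambda>n. testing_power M \<theta> n (nu_rejected \<xi> \<epsilon> \<nu> n \<alpha>)) \<longlonglongrightarrow> alt_cdf g \<epsilon> \<nu> \<tau>"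
proof -
  have \<tau>: "0 < \<tau>" and eq: "(1 - a) * \<tau> + a * alt_cdf g \<epsilon> \<nu> \<tau> = \<tau> / \<alpha>"
    using cross unfolding crosses_at_def by blast+
  let ?R = "\<lambda>n \<omega>. real (card (nu_rejected \<xi> \<epsilon> \<nu> n \<alpha> \<omega>))"
  let ?V = "\<lambda>n \<omega>. real (card {i \<in> nu_rejected \<xi> \<epsilon> \<nu> n \<alpha> \<omega>. \<not> \<theta> i \<omega>})"
  let ?N = "\<lambda>n \<omega>. real (card {i \<in> {..<n}. \<not> \<theta> i \<omega>})"
  let ?f = "\<lambda>n \<omega>. (?R n \<omega> - ?V n \<omega>) / max (real n - ?N n \<omega>) 1"
  note [measurable] = card_nu_rejected_measurable[OF \<alpha>, of \<epsilon> \<nu>]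
  have "(\<lambda>n. \<integral>\<omega>. ?f n \<omega> \<partial>M) \<longlonglongrightarrow> (\<integral>\<omega>. alt_cdf g \<epsilon> \<nu> \<tau> \<partial>M)"
  proof (rule integral_dominated_convergence[where w = "\<lambda>_. 1"])
    show "AE \<omega> in M. (\<lambda>n. ?f n \<omega>) \<longlonglongrightarrow> alt_cdf g \<epsilon> \<nu> \<tau>"
      using rejection_limits_AE[OF S \<nu> \<alpha>(1) cross]
    proof eventually_elim
      case (elim \<omega>)
      have R: "(\<lambda>n. ?R n \<omega> / real n) \<longlonglongrightarrow> \<tau> / \<alpha>" and V: "(\<lambda>n. ?V n \<omega> / real n) \<longlonglongrightarrow> (1 - a) * \<tau>"
        and N: "(\<lambda>n. ?N n \<omega> / real n) \<longlonglongrightarrow> 1 - a"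
        using elim by blast+
      have lim: "(\<lambda>n. (?R n \<omega> / real n - ?V n \<omega> / real n) / max (1 - ?N n \<omega> / real n) (1 / real n))
          \<longlonglongrightarrow> (\<tau> / \<alpha> - (1 - a) * \<tau>) / max (1 - (1 - a)) 0"
        by (rule tendsto_divide[OF tendsto_diff[OF R V] tendsto_max[OF tendsto_diff[OF tendsto_const N] lim_1_over_n]])
          (use a_bounds in simp)
      have const: "(\<tau> / \<alpha> - (1 - a) * \<tau>) / max (1 - (1 - a)) 0 = alt_cdf g \<epsilon> \<nu> \<tau>"
        unfolding eq[symmetric] using a_bounds by simp
      have "eventually (\<lambda>n. (?R n \<omega> / real n - ?V n \<omega> / real n) / max (1 - ?N n \<omega> / real n) (1 / real n) = ?f n \<omega>) sequentially"
        using eventually_gt_at_top[of 0]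
      proof eventually_elim
        case (elim n)
        have "max (1 - ?N n \<omega> / real n) (1 / real n) = max (real n - ?N n \<omega>) 1 / real n"
          using elim by (simp add: max_divide_distrib_right diff_divide_distrib)
        then show ?case using elim by (simp flip: diff_divide_distrib)
      qed
      then show ?case by (rule Lim_transform_eventually[OF lim[unfolded const]])
    qed
    show "AE \<omega> in M. norm (?f n \<omega>) \<le> 1" for n
    proof (rule AE_I2)
      fix \<omega>
      have "card {i \<in> {..<n}. \<not> \<theta> i \<omega>} \<le> card {..<n}" by (rule card_mono) auto
      then have N: "card {i \<in> {..<n}. \<not> \<theta> i \<omega>} \<le> n" by simp
      have "0 \<le> ?R n \<omega> - ?V n \<omega>" "?R n \<omega> - ?V n \<omega> \<le> real n - ?N n \<omega>"
        using null_card_bounds[of \<epsilon> \<nu> n \<alpha> \<omega>] N by linarith+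
      then show "norm (?f n \<omega>) \<le> 1" by (auto simp: divide_le_eq le_max_iff_disj)
    qed
    show "?f n \<in> borel_measurable M" for n by measurable
  qed simp_all
  then show ?thesis by (simp add: testing_power_def prob_space)
qed

text \<open>The proportion \<open>V / R\<close> tends almost surely to \<open>(1 - a) * \<tau> / (\<tau> / \<alpha>)\<close>, and the event \<open>R > 0\<close> on
  which the pFDR is conditioned has probability tending to \<open>1\<close>.\<close>

lemma pFDR_tendsto:
  assumes S: "standing_assumptions g \<epsilon> \<gamma> r" and \<nu>: "\<And>k. 0 < \<nu> $ k"
    and \<alpha>: "0 < \<alpha>" "\<alpha> < 1"
    and cross: "crosses_at (\<lambda>t. (1 - a) * t + a * alt_cdf g \<epsilon> \<nu> t) \<alpha> \<tau>"
  shows "(\<lambda>n. pFDR M \<theta> (nu_rejected \<xi> \<epsilon> \<nu> n \<alpha>)) \<longlonglongrightarrow> (1 - a) * \<alpha>"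
proof -
  note \<epsilon> = standing_assumptionsD(5)[OF S]
  have \<tau>: "0 < \<tau>" using cross by (simp add: crosses_at_def)
  let ?R = "\<lambda>n \<omega>. real (card (nu_rejected \<xi> \<epsilon> \<nu> n \<alpha> \<omega>))"
  let ?V = "\<lambda>n \<omega>. real (card {i \<in> nu_rejected \<xi> \<epsilon> \<nu> n \<alpha> \<omega>. \<not> \<theta> i \<omega>})"
  let ?A = "\<lambda>n. {\<omega> \<in> space M. 0 < card (nu_rejected \<xi> \<epsilon> \<nu> n \<alpha> \<omega>)}"
  note [measurable] = card_nu_rejected_measurable[OF \<alpha>, of \<epsilon> \<nu>]
  have "{\<omega> \<in> space M. 0 < ?R n \<omega>} \<in> events" for n by measurable
  then have A [measurable]: "?A n \<in> events" for n by simp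
  note lims = rejection_limits_AE[OF S \<nu> \<alpha>(1) cross]
  have "(\<lambda>n. \<integral>\<omega>. ?V n \<omega> / ?R n \<omega> \<partial>M) \<longlonglongrightarrow> (\<integral>\<omega>. (1 - a) * \<alpha> \<partial>M)"
  proof (rule integral_dominated_convergence[where w = "\<lambda>_. 1"])
    show "AE \<omega> in M. (\<lambda>n. ?V n \<omega> / ?R n \<omega>) \<longlonglongrightarrow> (1 - a) * \<alpha>"
      using lims
    proof eventually_elim
      case (elim \<omega>)
      have R: "(\<lambda>n. ?R n \<omega> / real n) \<longlonglongrightarrow> \<tau> / \<alpha>" and V: "(\<lambda>n. ?V n \<omega> / real n) \<longlonglongrightarrow> (1 - a) * \<tau>"
        using elim by blast+
      have lim: "(\<lambda>n. (?V n \<omega> / real n) / (?R n \<omega> / real n)) \<longlonglongrightarrow> ((1 - a) * \<tau>) / (\<tau> / \<alpha>)"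
        by (rule tendsto_divide[OF V R]) (use \<tau> \<alpha> in simp)
      have const: "((1 - a) * \<tau>) / (\<tau> / \<alpha>) = (1 - a) * \<alpha>" using \<tau> by simp
      have "eventually (\<lambda>n. (?V n \<omega> / real n) / (?R n \<omega> / real n) = ?V n \<omega> / ?R n \<omega>) sequentially"
        using eventually_gt_at_top[of 0] by eventually_elim simp
      then show ?case by (rule Lim_transform_eventually[OF lim[unfolded const]])
    qed
    show "AE \<omega> in M. norm (?V n \<omega> / ?R n \<omega>) \<le> 1" for n
      using null_card_bounds(1) by (intro AE_I2) (auto simp: divide_le_eq_1 card_gt_0_iff)
    show "(\<lambda>\<omega>. ?V n \<omega> / ?R n \<omega>) \<in> borel_measurable M" for n by measurable
  qed simp_all
  then have E: "(\<lambda>n. \<integral>\<omega>. ?V n \<omega> / ?R n \<omega> \<partial>M) \<longlonglongrightarrow> (1 - a) * \<alpha>" by (simp add: prob_space)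
  have "(\<lambda>n. \<integral>\<omega>. (indicator (?A n) \<omega> :: real) \<partial>M) \<longlonglongrightarrow> (\<integral>\<omega>. (1 :: real) \<partial>M)"
  proof (rule integral_dominated_convergence[where w = "\<lambda>_. 1"])
    show "AE \<omega> in M. (\<lambda>n. indicator (?A n) \<omega> :: real) \<longlonglongrightarrow> 1"
      using lims AE_space
    proof eventually_elim
      case (elim \<omega>)
      then have "(\<lambda>n. ?R n \<omega> / real n) \<longlonglongrightarrow> \<tau> / \<alpha>" by blast
      then have "eventually (\<lambda>n. 0 < ?R n \<omega> / real n) sequentially"
        by (rule order_tendstoD(1)) (use \<tau> \<alpha> in simp)
      then have "eventually (\<lambda>n. indicator (?A n) \<omega> = (1 :: real)) sequentially"
        by eventually_elim (use elim in \<open>auto simp: indicator_def zero_less_divide_iff\<close>)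
      then show ?case by (rule tendsto_eventually)
    qed
    show "(\<lambda>\<omega>. indicator (?A n) \<omega> :: real) \<in> borel_measurable M" for n by measurable
  qed (simp_all add: indicator_def)
  then have P: "(\<lambda>n. prob (?A n)) \<longlonglongrightarrow> 1" by (simp add: prob_space)
  have "(\<lambda>n. (\<integral>\<omega>. ?V n \<omega> / ?R n \<omega> \<partial>M) / prob (?A n)) \<longlonglongrightarrow> (1 - a) * \<alpha> / 1"
    by (intro tendsto_divide E P) simp
  then have "(\<lambda>n. (\<integral>\<omega>. ?V n \<omega> / ?R n \<omega> \<partial>M) / prob (?A n)) \<longlonglongrightarrow> (1 - a) * \<alpha>" by simp
  moreover have "eventually (\<lambda>n. (\<integral>\<omega>. ?V n \<omega> / ?R n \<omega> \<partial>M) / prob (?A n) = pFDR M \<theta> (nu_rejected \<xi> \<epsilon> \<nu> n \<alpha>)) sequentially"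
    using eventually_gt_at_top[of 0] by eventually_elim (simp only: pFDR_eq[OF \<epsilon> \<nu> \<alpha>])
  ultimately show ?thesis by (rule Lim_transform_eventually)
qed

end

section \<open>Minimum attainable pFDR and the order of the power\<close>

text \<open>The product of the \<open>\<nu> $ k powr (- 1 / \<epsilon>)\<close> in \<open>simplex_const\<close> is \<open>\<nu>bar powr (- K / \<epsilon>)\<close>; moving it
  into the power turns \<open>\<gamma> $ k / \<nu> $ k\<close> into \<open>\<nu>bar * \<gamma> $ k / \<nu> $ k\<close>.\<close>

lemma loss_const_power_mean:
  fixes \<nu> \<gamma> :: "real ^ 'k"
  assumes \<epsilon>: "0 < \<epsilon>" and \<nu>: "\<And>k. 0 < \<nu> $ k" and \<gamma>: "\<And>k. 0 < \<gamma> $ k" and b: "0 < b"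
  defines "K \<equiv> real CARD('k)"
  defines "\<nu>bar \<equiv> (\<Prod>k\<in>UNIV. \<nu> $ k) powr (1 / K)"
  shows "(1 / (b * loss_const \<epsilon> \<gamma> \<nu>)) powr (K / \<epsilon>) =
    V_vol TYPE('k) \<epsilon> * (((K + \<epsilon>) / b) / (\<Sum>k\<in>UNIV. \<nu>bar * \<gamma> $ k / \<nu> $ k)) powr (K / \<epsilon>)"
proof -
  let ?c = "simplex_const \<epsilon> \<nu>" and ?\<Sigma> = "\<Sum>k\<in>UNIV. \<gamma> $ k / \<nu> $ k"
  have K: "0 < K" by (simp add: K_def)
  have c: "0 < ?c" by (rule simplex_const_pos[OF \<epsilon> \<nu>])
  have \<Sigma>: "0 < ?\<Sigma>" using \<nu> \<gamma> by (intro sum_pos) auto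
  have prod: "0 < (\<Prod>k\<in>UNIV. \<nu> $ k)" using \<nu> by (intro prod_pos) auto
  then have \<nu>bar: "0 < \<nu>bar" by (metis \<nu>bar_def powr_gt_zero less_irrefl)
  define Q where "Q = (K + \<epsilon>) / (b * ?\<Sigma>)"
  have Q: "0 < Q" using K \<epsilon> b \<Sigma> by (simp add: Q_def)
  have "1 / (b * loss_const \<epsilon> \<gamma> \<nu>) = Q * ?c powr (\<epsilon> / K)"
    using c K \<epsilon> by (simp add: loss_const_def Q_def K_def[symmetric] powr_minus_divide flip: minus_divide_left)
  then have "(1 / (b * loss_const \<epsilon> \<gamma> \<nu>)) powr (K / \<epsilon>) = Q powr (K / \<epsilon>) * ?c"
    using Q c K \<epsilon> by (simp add: powr_mult powr_powr)
  moreover have "((K + \<epsilon>) / b) / (\<Sum>k\<in>UNIV. \<nu>bar * \<gamma> $ k / \<nu> $ k) = Q / \<nu>bar"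
  proof -
    have "(\<Sum>k\<in>UNIV. \<nu>bar * \<gamma> $ k / \<nu> $ k) = \<nu>bar * ?\<Sigma>" by (simp add: sum_distrib_left)
    then show ?thesis by (simp add: Q_def mult_ac)
  qed
  moreover have "(Q / \<nu>bar) powr (K / \<epsilon>) = Q powr (K / \<epsilon>) / \<nu>bar powr (K / \<epsilon>)"
    using Q \<nu>bar by (simp add: powr_divide)
  moreover have "?c = V_vol TYPE('k) \<epsilon> / \<nu>bar powr (K / \<epsilon>)"
  proof -
    have "\<nu>bar powr (K / \<epsilon>) = (\<Prod>k\<in>UNIV. \<nu> $ k) powr (1 / \<epsilon>)"
      using K by (simp add: \<nu>bar_def powr_powr)
    also have "\<dots> = (\<Prod>k\<in>UNIV. \<nu> $ k powr (1 / \<epsilon>))"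
      by (rule prod_powr_distrib)
    finally show ?thesis
      by (simp add: simplex_const_def powr_minus_divide prod_dividef flip: minus_divide_left)
  qed
  ultimately show ?thesis by simp
qed

theorem proposition4p1:
  fixes M :: "'w measure"
    and \<theta> :: "nat \<Rightarrow> 'w \<Rightarrow> bool"
    and \<xi> :: "nat \<Rightarrow> 'w \<Rightarrow> real ^ 'k"
    and g r :: "real ^ 'k \<Rightarrow> real"
    and \<gamma> \<nu> :: "real ^ 'k"
    and a \<epsilon> :: real
  assumes "standing_assumptions g \<epsilon> \<gamma> r"
    and "random_effects_model M \<theta> \<xi> a g"
    and "\<And>k. 0 < \<nu> $ k"
  defines "K \<equiv> real CARD('k)"
    and "\<alpha>s \<equiv> alpha_star a g"
  defines "\<nu>bar \<equiv> (\<Prod>k\<in>UNIV. \<nu> $ k) powr (1 / K)"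
  shows "min_attainable_pFDR (\<lambda>n \<alpha>. pFDR M \<theta> (nu_rejected \<xi> \<epsilon> \<nu> n \<alpha>)) = ereal ((1 - a) * \<alpha>s)
    \<and> (\<forall>\<^sub>F \<alpha> in at_right \<alpha>s. convergent (\<lambda>n. testing_power M \<theta> n (nu_rejected \<xi> \<epsilon> \<nu> n \<alpha>)))
    \<and> lim_power M \<theta> \<xi> \<epsilon> \<nu> \<sim>[at_right \<alpha>s]
        (\<lambda>\<alpha>. g 0 * V_vol TYPE('k) \<epsilon>
              * (((K + \<epsilon>) / (a * \<alpha>s\<^sup>2 * g 0)) / (\<Sum>k\<in>UNIV. \<nu>bar * \<gamma> $ k / \<nu> $ k)) powr (K / \<epsilon>)
              * (\<alpha> - \<alpha>s) powr (K / \<epsilon>))"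
proof -
  let ?F = "alt_cdf g \<epsilon> \<nu>"
  let ?P = "\<lambda>n \<alpha>. testing_power M \<theta> n (nu_rejected \<xi> \<epsilon> \<nu> n \<alpha>)"
  let ?q = "\<lambda>n \<alpha>. pFDR M \<theta> (nu_rejected \<xi> \<epsilon> \<nu> n \<alpha>)"
  note S = assms(1) and \<nu> = assms(3)
  note \<epsilon> = standing_assumptionsD(5)[OF S]
  interpret random_effects M \<theta> \<xi> a g
    using assms(2) by (intro random_effects.intro random_effects_axioms.intro)
      (auto simp: random_effects_model_def)
  interpret C: concentrated_cdf "?F" "g 0" "loss_const \<epsilon> \<gamma> \<nu>" "\<epsilon> / real CARD('k)"
    by (rule alt_cdf_concentrated[OF S \<nu>])
  have g: "\<And>x. x \<in> cbox 0 1 \<Longrightarrow> 0 \<le> g x" "\<And>x. x \<in> cbox 0 1 \<Longrightarrow> g x \<le> g 0"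
    using standing_assumptionsD(1)[OF S] density_le_max[OF S] by auto
  have K: "0 < K" by (simp add: K_def)
  have "1 < 1 - a + a * g 0" using a_bounds C.g0_gt_1 mult_strict_left_mono[of 1 "g 0" a] by simp
  then have \<alpha>s: "0 < \<alpha>s" "\<alpha>s < 1" by (auto simp: \<alpha>s_def alpha_star_def)
  have \<alpha>s_eq: "\<alpha>s = 1 / (1 - a + a * g 0)" by (simp add: \<alpha>s_def alpha_star_def)
  obtain \<tau> where \<tau>: "eventually (\<lambda>\<alpha>. crosses_at (\<lambda>t. (1 - a) * t + a * ?F t) \<alpha> (\<tau> \<alpha>)) (at_right \<alpha>s)"
    and \<tau>_lim: "((\<lambda>\<alpha>. ?F (\<tau> \<alpha>) / (\<alpha> - \<alpha>s) powr (1 / (\<epsilon> / real CARD('k)))) \<longlongrightarrow>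
      g 0 * (1 / (a * \<alpha>s\<^sup>2 * g 0 * loss_const \<epsilon> \<gamma> \<nu>)) powr (1 / (\<epsilon> / real CARD('k)))) (at_right \<alpha>s)"
    using C.crossing_point[OF a_bounds] unfolding \<alpha>s_eq[symmetric] by blast
  have range: "eventually (\<lambda>\<alpha>. \<alpha> \<in> {\<alpha>s<..<1}) (at_right \<alpha>s)"
    using \<alpha>s(2) by (rule eventually_at_right_real)
  have limits: "eventually (\<lambda>\<alpha>. 0 < \<alpha> \<and> \<alpha> < 1 \<and>
      (\<lambda>n. ?P n \<alpha>) \<longlonglongrightarrow> ?F (\<tau> \<alpha>) \<and>
      (\<lambda>n. ?q n \<alpha>) \<longlonglongrightarrow> (1 - a) * \<alpha>) (at_right \<alpha>s)"
    using \<tau> range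
  proof eventually_elim
    case (elim \<alpha>)
    then have \<alpha>: "0 < \<alpha>" "\<alpha> < 1" using \<alpha>s by auto
    have "(\<lambda>n. ?P n \<alpha>) \<longlonglongrightarrow> ?F (\<tau> \<alpha>)"
      by (rule testing_power_tendsto[OF S \<nu> \<alpha> elim(1)])
    moreover have "(\<lambda>n. ?q n \<alpha>) \<longlonglongrightarrow> (1 - a) * \<alpha>"
      by (rule pFDR_tendsto[OF S \<nu> \<alpha> elim(1)])
    ultimately show ?case using \<alpha> by blast
  qed
  show ?thesis
  proof (intro conjI)
    let ?L = "{ereal L | L. \<exists>\<alpha>. 0 < \<alpha> \<and> \<alpha> < 1 \<and> (\<lambda>n. ?q n \<alpha>) \<longlonglongrightarrow> L}"
    show "min_attainable_pFDR (\<lambda>n \<alpha>. ?q n \<alpha>) = ereal ((1 - a) * \<alpha>s)"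
      unfolding min_attainable_pFDR_def
    proof (rule antisym)
      have "eventually (\<lambda>\<alpha>. Inf ?L \<le> ereal ((1 - a) * \<alpha>)) (at_right \<alpha>s)"
        using limits by eventually_elim (rule Inf_lower, blast)
      moreover have "((\<lambda>\<alpha>. ereal ((1 - a) * \<alpha>)) \<longlongrightarrow> ereal ((1 - a) * \<alpha>s)) (at_right \<alpha>s)"
        by (intro tendsto_intros)
      ultimately show "Inf ?L \<le> ereal ((1 - a) * \<alpha>s)"
        by (intro tendsto_lowerbound[of _ _ "at_right \<alpha>s"]) (auto simp: trivial_limit_at_right_real)
      show "ereal ((1 - a) * \<alpha>s) \<le> Inf ?L"
      proof (rule Inf_greatest)
        fix e assume "e \<in> ?L"
        then obtain L \<alpha> where L: "e = ereal L" "0 < \<alpha>" "\<alpha> < 1"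
          and lim: "(\<lambda>n. ?q n \<alpha>) \<longlonglongrightarrow> L" by blast
        have "(1 - a) * \<alpha>s \<le> L"
        proof (rule LIMSEQ_le_const[OF lim], intro exI[of _ 1] allI impI)
          fix n :: nat assume "1 \<le> n"
          then show "(1 - a) * \<alpha>s \<le> ?q n \<alpha>"
            unfolding \<alpha>s_def by (intro pFDR_lower_bound[OF \<epsilon> \<nu> L(2,3) _ g]) auto
        qed
        then show "ereal ((1 - a) * \<alpha>s) \<le> e" by (simp add: L(1))
      qed
    qed
    show "\<forall>\<^sub>F \<alpha> in at_right \<alpha>s. convergent (\<lambda>n. ?P n \<alpha>)"
      using limits by eventually_elim (auto simp: convergent_def)
    let ?C = "g 0 * V_vol TYPE('k) \<epsilon>
        * (((K + \<epsilon>) / (a * \<alpha>s\<^sup>2 * g 0)) / (\<Sum>k\<in>UNIV. \<nu>bar * \<gamma> $ k / \<nu> $ k)) powr (K / \<epsilon>)"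
    have b: "0 < a * \<alpha>s\<^sup>2 * g 0" using a_bounds \<alpha>s C.g0_pos by simp
    have C_eq: "g 0 * (1 / (a * \<alpha>s\<^sup>2 * g 0 * loss_const \<epsilon> \<gamma> \<nu>)) powr (K / \<epsilon>) = ?C"
      using loss_const_power_mean[OF \<epsilon> \<nu> standing_assumptionsD(6)[OF S] b]
      by (simp add: K_def \<nu>bar_def)
    have "((\<lambda>\<alpha>. ?F (\<tau> \<alpha>) / (\<alpha> - \<alpha>s) powr (K / \<epsilon>)) \<longlongrightarrow> ?C) (at_right \<alpha>s)"
      using \<tau>_lim unfolding C_eq[symmetric] by (simp add: K_def)
    moreover have "eventually (\<lambda>\<alpha>. ?F (\<tau> \<alpha>) / (\<alpha> - \<alpha>s) powr (K / \<epsilon>)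
        = lim_power M \<theta> \<xi> \<epsilon> \<nu> \<alpha> / (\<alpha> - \<alpha>s) powr (K / \<epsilon>)) (at_right \<alpha>s)"
      using limits by eventually_elim (auto simp: lim_power_def dest: limI)
    ultimately have "((\<lambda>\<alpha>. lim_power M \<theta> \<xi> \<epsilon> \<nu> \<alpha> / (\<alpha> - \<alpha>s) powr (K / \<epsilon>)) \<longlongrightarrow> ?C) (at_right \<alpha>s)"
      by (rule Lim_transform_eventually)
    moreover have "?C \<noteq> 0"
      unfolding C_eq[symmetric] using C.g0_pos C.L a_bounds \<alpha>s by simp
    ultimately show "lim_power M \<theta> \<xi> \<epsilon> \<nu> \<sim>[at_right \<alpha>s] (\<lambda>\<alpha>. ?C * (\<alpha> - \<alpha>s) powr (K / \<epsilon>))"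
      by (rule asymp_equivI'_const)
  qed
qed

end
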